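(* Let $T$ be an additive ternary $\Gamma$-ring; write $\mathcal A=\mathcal A(T,\Gamma)$, $\mathcal R=\mathcal R_T$ for its regular operator ring, and $\mathcal C(T,\Gamma)=K/K^2$ for its conormal operator defect. There is a canonical isomorphism of $\mathcal R$-bimodules $$\mathcal C(T,\Gamma)\cong\operatorname{Tor}^{\mathcal A}_1(\mathcal R,\mathcal R).$$
   Context: An additive ternary $\Gamma$-ring consists of abelian groups $(T,+)$, $(\Gamma,+)$ and a map $T\times\Gamma\times T\times\Gamma\times T\to T$, $(x,\alpha,y,\beta,z)\mapsto x\alpha y\beta z$, additive in each of the five variables, with $(x\alpha y\beta z)\gamma u\delta v=x\alpha(y\beta z\gamma u)\delta v=x\alpha y\beta(z\gamma u\delta v)$. Let $F(T,\Gamma)=T\otimes_{\mathbb Z}\Gamma\otimes_{\mathbb Z}T\otimes_{\mathbb Z}\Gamma$ with the associative bilinear multiplication $(a\otimes\alpha\otimes b\otimes\beta)(c\otimes\gamma\otimes d\otimes\delta)=(a\alpha b\beta c)\otimes\gamma\otimes d\otimes\delta$, let $J(T,\Gamma)$ be the two-sided ideal generated by all $(a\alpha b\beta c)\otimes\gamma\otimes d\otimes\delta-a\otimes\alpha\otimes(b\beta c\gamma d)\otimes\delta$, and let $\mathcal O(T,\Gamma)=F(T,\Gamma)/J(T,\Gamma)$; $[a,\alpha,b,\beta]$ is the class of a pure tensor. The unital ring $\mathcal A(T,\Gamma)=\mathbb Z\ltimes\mathcal O(T,\Gamma)$ is $\mathbb Z\oplus\mathcal O(T,\Gamma)$ with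 $(n,r)(m,s)=(nm,ns+mr+rs)$. The regular representation is $\rho_T:\mathcal O(T,\Gamma)\to\operatorname{End}_{\mathbb Z}(T)$, $\rho_T([a,\alpha,b,\beta])(x)=a\alpha b\beta x$, and its unital extension is $\widehat\rho_T:\mathcal A(T,\Gamma)\to\operatorname{End}_{\mathbb Z}(T)$, $\widehat\rho_T(n,u)=n\operatorname{id}_T+\rho_T(u)$. The unital regular defect is $K=\ker\widehat\rho_T$ and the regular operator ring is $\mathcal R_T=\operatorname{im}\widehat\rho_T\cong\mathcal A/K$. The conormal operator defect $\mathcal C(T,\Gamma)=K/K^2$ is an $\mathcal R_T$-bimodule via lifts of elements of $\mathcal R_T$ to $\mathcal A$. In the $\operatorname{Tor}$ group the first $\mathcal R$ is a right and the second a left $\mathcal A$-module through $\mathcal A\twoheadrightarrow\mathcal R$. *)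

theory Defs
  imports "HOL-Algebra.Free_Abelian_Groups" "HOL-Algebra.Product_Groups" "HOL-Algebra.QuotRing"
    "HOL-Algebra.Ideal_Product"
begin

section \<open>Additive ternary Gamma-rings\<close>

text \<open>The abelian groups \<open>(T, +)\<close> and \<open>(\<Gamma>, +)\<close> are groups in the sense of the locale
  \<^locale>\<open>comm_group\<close>, so their addition is written multiplicatively;
  \<open>tp x \<alpha> y \<beta> z\<close> is the ternary product \<open>x\<alpha>y\<beta>z\<close>.\<close>

locale ternary_gamma_ring = T: comm_group T + \<Gamma>: comm_group \<Gamma>
  for T :: "('t, 'p) monoid_scheme" and \<Gamma> :: "('g, 'q) monoid_scheme" +
  fixes tp :: "'t \<Rightarrow> 'g \<Rightarrow> 't \<Rightarrow> 'g \<Rightarrow> 't \<Rightarrow> 't"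
  assumes additive1: "\<lbrakk>\<alpha> \<in> carrier \<Gamma>; y \<in> carrier T; \<beta> \<in> carrier \<Gamma>; z \<in> carrier T\<rbrakk>
      \<Longrightarrow> (\<lambda>x. tp x \<alpha> y \<beta> z) \<in> hom T T"
    and additive2: "\<lbrakk>x \<in> carrier T; y \<in> carrier T; \<beta> \<in> carrier \<Gamma>; z \<in> carrier T\<rbrakk>
      \<Longrightarrow> (\<lambda>\<alpha>. tp x \<alpha> y \<beta> z) \<in> hom \<Gamma> T"
    and additive3: "\<lbrakk>x \<in> carrier T; \<alpha> \<in> carrier \<Gamma>; \<beta> \<in> carrier \<Gamma>; z \<in> carrier T\<rbrakk>
      \<Longrightarrow> (\<lambda>y. tp x \<alpha> y \<beta> z) \<in> hom T T"
    and additive4: "\<lbrakk>x \<in> carrier T; \<alpha> \<in> carrier \<Gamma>; y \<in> carrier T; z \<in> carrier T\<rbrakk>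
      \<Longrightarrow> (\<lambda>\<beta>. tp x \<alpha> y \<beta> z) \<in> hom \<Gamma> T"
    and additive5: "\<lbrakk>x \<in> carrier T; \<alpha> \<in> carrier \<Gamma>; y \<in> carrier T; \<beta> \<in> carrier \<Gamma>\<rbrakk>
      \<Longrightarrow> (\<lambda>z. tp x \<alpha> y \<beta> z) \<in> hom T T"
    and assoc_left: "\<lbrakk>x \<in> carrier T; \<alpha> \<in> carrier \<Gamma>; y \<in> carrier T; \<beta> \<in> carrier \<Gamma>; z \<in> carrier T;
        \<gamma> \<in> carrier \<Gamma>; u \<in> carrier T; \<delta> \<in> carrier \<Gamma>; v \<in> carrier T\<rbrakk>
      \<Longrightarrow> tp (tp x \<alpha> y \<beta> z) \<gamma> u \<delta> v = tp x \<alpha> (tp y \<beta> z \<gamma> u) \<delta> v"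
    and assoc_right: "\<lbrakk>x \<in> carrier T; \<alpha> \<in> carrier \<Gamma>; y \<in> carrier T; \<beta> \<in> carrier \<Gamma>; z \<in> carrier T;
        \<gamma> \<in> carrier \<Gamma>; u \<in> carrier T; \<delta> \<in> carrier \<Gamma>; v \<in> carrier T\<rbrakk>
      \<Longrightarrow> tp x \<alpha> (tp y \<beta> z \<gamma> u) \<delta> v = tp x \<alpha> y \<beta> (tp z \<gamma> u \<delta> v)"


section \<open>The operator rings\<close>

subsection \<open>The tensor product of T, Gamma, T, Gamma over the integers\<close>

definition quad_group ::
  "('t, 'p) monoid_scheme \<Rightarrow> ('g, 'q) monoid_scheme \<Rightarrow> ('t \<times> 'g \<times> 't \<times> 'g \<Rightarrow>\<^sub>0 int) monoid" where
  "quad_group T \<Gamma> = free_Abelian_group (carrier T \<times> carrier \<Gamma> \<times> carrier T \<times> carrier \<Gamma>)"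

definition quad_relators ::
  "('t, 'p) monoid_scheme \<Rightarrow> ('g, 'q) monoid_scheme \<Rightarrow> ('t \<times> 'g \<times> 't \<times> 'g \<Rightarrow>\<^sub>0 int) set" where
  "quad_relators T \<Gamma> =
     {frag_of (a \<otimes>\<^bsub>T\<^esub> a', \<alpha>, b, \<beta>) - frag_of (a, \<alpha>, b, \<beta>) - frag_of (a', \<alpha>, b, \<beta>) | a a' \<alpha> b \<beta>.
        a \<in> carrier T \<and> a' \<in> carrier T \<and> \<alpha> \<in> carrier \<Gamma> \<and> b \<in> carrier T \<and> \<beta> \<in> carrier \<Gamma>} \<union>
     {frag_of (a, \<alpha> \<otimes>\<^bsub>\<Gamma>\<^esub> \<alpha>', b, \<beta>) - frag_of (a, \<alpha>, b, \<beta>) - frag_of (a, \<alpha>', b, \<beta>) | a \<alpha> \<alpha>' b \<beta>.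
        a \<in> carrier T \<and> \<alpha> \<in> carrier \<Gamma> \<and> \<alpha>' \<in> carrier \<Gamma> \<and> b \<in> carrier T \<and> \<beta> \<in> carrier \<Gamma>} \<union>
     {frag_of (a, \<alpha>, b \<otimes>\<^bsub>T\<^esub> b', \<beta>) - frag_of (a, \<alpha>, b, \<beta>) - frag_of (a, \<alpha>, b', \<beta>) | a \<alpha> b b' \<beta>.
        a \<in> carrier T \<and> \<alpha> \<in> carrier \<Gamma> \<and> b \<in> carrier T \<and> b' \<in> carrier T \<and> \<beta> \<in> carrier \<Gamma>} \<union>
     {frag_of (a, \<alpha>, b, \<beta> \<otimes>\<^bsub>\<Gamma>\<^esub> \<beta>') - frag_of (a, \<alpha>, b, \<beta>) - frag_of (a, \<alpha>, b, \<beta>') | a \<alpha> b \<beta> \<beta>'.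
        a \<in> carrier T \<and> \<alpha> \<in> carrier \<Gamma> \<and> b \<in> carrier T \<and> \<beta> \<in> carrier \<Gamma> \<and> \<beta>' \<in> carrier \<Gamma>}"

definition quad_subgroup ::
  "('t, 'p) monoid_scheme \<Rightarrow> ('g, 'q) monoid_scheme \<Rightarrow> ('t \<times> 'g \<times> 't \<times> 'g \<Rightarrow>\<^sub>0 int) set" where
  "quad_subgroup T \<Gamma> = generate (quad_group T \<Gamma>) (quad_relators T \<Gamma>)"

definition pure_tensor ::
  "('t, 'p) monoid_scheme \<Rightarrow> ('g, 'q) monoid_scheme \<Rightarrow> 't \<times> 'g \<times> 't \<times> 'g
     \<Rightarrow> ('t \<times> 'g \<times> 't \<times> 'g \<Rightarrow>\<^sub>0 int) set" where
  "pure_tensor T \<Gamma> s = quad_subgroup T \<Gamma> #>\<^bsub>quad_group T \<Gamma>\<^esub> frag_of s"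

subsection \<open>The rings F, O and A\<close>

text \<open>The bilinear extension to the free abelian group of
  \<open>(a, \<alpha>, b, \<beta>) (c, \<gamma>, d, \<delta>) = (a\<alpha>b\<beta>c, \<gamma>, d, \<delta>)\<close>.\<close>

definition quad_mult ::
  "('t \<Rightarrow> 'g \<Rightarrow> 't \<Rightarrow> 'g \<Rightarrow> 't \<Rightarrow> 't) \<Rightarrow> ('t \<times> 'g \<times> 't \<times> 'g \<Rightarrow>\<^sub>0 int)
     \<Rightarrow> ('t \<times> 'g \<times> 't \<times> 'g \<Rightarrow>\<^sub>0 int) \<Rightarrow> ('t \<times> 'g \<times> 't \<times> 'g \<Rightarrow>\<^sub>0 int)" where
  "quad_mult tp p q =
     frag_extend (\<lambda>(a, \<alpha>, b, \<beta>). frag_extend (\<lambda>(c, \<gamma>, d, \<delta>). frag_of (tp a \<alpha> b \<beta> c, \<gamma>, d, \<delta>)) q) p"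

text \<open>\<open>F(T,\<Gamma>)\<close> and its quotient \<open>\<O>(T,\<Gamma>)\<close> need not have an identity; they are
  represented by ring records in which the field \<open>one\<close> has no meaning and is never used.\<close>

definition F_ring ::
  "('t, 'p) monoid_scheme \<Rightarrow> ('g, 'q) monoid_scheme \<Rightarrow> ('t \<Rightarrow> 'g \<Rightarrow> 't \<Rightarrow> 'g \<Rightarrow> 't \<Rightarrow> 't)
     \<Rightarrow> ('t \<times> 'g \<times> 't \<times> 'g \<Rightarrow>\<^sub>0 int) set ring" where
  "F_ring T \<Gamma> tp =
     \<lparr>carrier = carrier (quad_group T \<Gamma> Mod quad_subgroup T \<Gamma>),
      mult = (\<lambda>X Y. \<Union>p\<in>X. \<Union>q\<in>Y. quad_subgroup T \<Gamma> #>\<^bsub>quad_group T \<Gamma>\<^esub> quad_mult tp p q),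
      one = undefined,
      zero = one (quad_group T \<Gamma> Mod quad_subgroup T \<Gamma>),
      add = mult (quad_group T \<Gamma> Mod quad_subgroup T \<Gamma>)\<rparr>"

definition J_generators ::
  "('t, 'p) monoid_scheme \<Rightarrow> ('g, 'q) monoid_scheme \<Rightarrow> ('t \<Rightarrow> 'g \<Rightarrow> 't \<Rightarrow> 'g \<Rightarrow> 't \<Rightarrow> 't)
     \<Rightarrow> ('t \<times> 'g \<times> 't \<times> 'g \<Rightarrow>\<^sub>0 int) set set" where
  "J_generators T \<Gamma> tp =
     {pure_tensor T \<Gamma> (tp a \<alpha> b \<beta> c, \<gamma>, d, \<delta>) \<ominus>\<^bsub>F_ring T \<Gamma> tp\<^esub> pure_tensor T \<Gamma> (a, \<alpha>, tp b \<beta> c \<gamma> d, \<delta>)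
        | a \<alpha> b \<beta> c \<gamma> d \<delta>.
        a \<in> carrier T \<and> \<alpha> \<in> carrier \<Gamma> \<and> b \<in> carrier T \<and> \<beta> \<in> carrier \<Gamma> \<and>
        c \<in> carrier T \<and> \<gamma> \<in> carrier \<Gamma> \<and> d \<in> carrier T \<and> \<delta> \<in> carrier \<Gamma>}"

text \<open>The locale \<^locale>\<open>ideal\<close> presupposes a ring with identity, hence the following version for
  rings that need not have one.\<close>

definition two_sided_ideal :: "('a, 'b) ring_scheme \<Rightarrow> 'a set \<Rightarrow> bool" where
  "two_sided_ideal R I \<longleftrightarrow> subgroup I (add_monoid R) \<and>
     (\<forall>x\<in>carrier R. \<forall>i\<in>I. x \<otimes>\<^bsub>R\<^esub> i \<in> I \<and> i \<otimes>\<^bsub>R\<^esub> x \<in> I)"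

definition J_ideal ::
  "('t, 'p) monoid_scheme \<Rightarrow> ('g, 'q) monoid_scheme \<Rightarrow> ('t \<Rightarrow> 'g \<Rightarrow> 't \<Rightarrow> 'g \<Rightarrow> 't \<Rightarrow> 't)
     \<Rightarrow> ('t \<times> 'g \<times> 't \<times> 'g \<Rightarrow>\<^sub>0 int) set set" where
  "J_ideal T \<Gamma> tp = \<Inter>{I. two_sided_ideal (F_ring T \<Gamma> tp) I \<and> J_generators T \<Gamma> tp \<subseteq> I}"

type_synonym ('t, 'g) operator = "('t \<times> 'g \<times> 't \<times> 'g \<Rightarrow>\<^sub>0 int) set set"

definition O_ring ::
  "('t, 'p) monoid_scheme \<Rightarrow> ('g, 'q) monoid_scheme \<Rightarrow> ('t \<Rightarrow> 'g \<Rightarrow> 't \<Rightarrow> 'g \<Rightarrow> 't \<Rightarrow> 't)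
     \<Rightarrow> ('t, 'g) operator ring" where
  "O_ring T \<Gamma> tp = F_ring T \<Gamma> tp Quot J_ideal T \<Gamma> tp"

definition int_unitization :: "('a, 'b) ring_scheme \<Rightarrow> (int \<times> 'a) ring" where
  "int_unitization R =
     \<lparr>carrier = UNIV \<times> carrier R,
      mult = (\<lambda>(n, r) (m, s). (n * m, [n] \<cdot>\<^bsub>R\<^esub> s \<oplus>\<^bsub>R\<^esub> [m] \<cdot>\<^bsub>R\<^esub> r \<oplus>\<^bsub>R\<^esub> r \<otimes>\<^bsub>R\<^esub> s)),
      one = (1, \<zero>\<^bsub>R\<^esub>),
      zero = (0, \<zero>\<^bsub>R\<^esub>),
      add = (\<lambda>(n, r) (m, s). (n + m, r \<oplus>\<^bsub>R\<^esub> s))\<rparr>"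

definition A_ring ::
  "('t, 'p) monoid_scheme \<Rightarrow> ('g, 'q) monoid_scheme \<Rightarrow> ('t \<Rightarrow> 'g \<Rightarrow> 't \<Rightarrow> 'g \<Rightarrow> 't \<Rightarrow> 't)
     \<Rightarrow> (int \<times> ('t, 'g) operator) ring" where
  "A_ring T \<Gamma> tp = int_unitization (O_ring T \<Gamma> tp)"

subsection \<open>The regular representation\<close>

definition End_ring :: "('t, 'p) monoid_scheme \<Rightarrow> ('t \<Rightarrow> 't) ring" where
  "End_ring T =
     \<lparr>carrier = hom T T \<inter> extensional (carrier T),
      mult = compose (carrier T),
      one = (\<lambda>x\<in>carrier T. x),
      zero = (\<lambda>x\<in>carrier T. \<one>\<^bsub>T\<^esub>),
      add = (\<lambda>f g. \<lambda>x\<in>carrier T. f x \<otimes>\<^bsub>T\<^esub> g x)\<rparr>"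

text \<open>The additive extension of \<open>(a, \<alpha>, b, \<beta>) \<mapsto> (x \<mapsto> a\<alpha>b\<beta>x)\<close> to the free abelian group.\<close>

definition free_rho ::
  "('t, 'p) monoid_scheme \<Rightarrow> ('t \<Rightarrow> 'g \<Rightarrow> 't \<Rightarrow> 'g \<Rightarrow> 't \<Rightarrow> 't)
     \<Rightarrow> ('t \<times> 'g \<times> 't \<times> 'g \<Rightarrow>\<^sub>0 int) \<Rightarrow> 't \<Rightarrow> 't" where
  "free_rho T tp p = (\<lambda>x\<in>carrier T.
     finprod T (\<lambda>(a, \<alpha>, b, \<beta>). tp a \<alpha> b \<beta> x [^]\<^bsub>T\<^esub> Poly_Mapping.lookup p (a, \<alpha>, b, \<beta>))
       (Poly_Mapping.keys p))"

text \<open>An element \<open>u\<close> of \<open>\<O>(T,\<Gamma>)\<close> is a coset of cosets, so \<open>\<Union>u\<close> is the set of its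
  representatives in the free abelian group; \<open>free_rho\<close> is constant on it.\<close>

definition rho ::
  "('t, 'p) monoid_scheme \<Rightarrow> ('t \<Rightarrow> 'g \<Rightarrow> 't \<Rightarrow> 'g \<Rightarrow> 't \<Rightarrow> 't) \<Rightarrow> ('t, 'g) operator \<Rightarrow> 't \<Rightarrow> 't" where
  "rho T tp u = the_elem (free_rho T tp ` \<Union>u)"

definition rho_hat ::
  "('t, 'p) monoid_scheme \<Rightarrow> ('t \<Rightarrow> 'g \<Rightarrow> 't \<Rightarrow> 'g \<Rightarrow> 't \<Rightarrow> 't)
     \<Rightarrow> int \<times> ('t, 'g) operator \<Rightarrow> 't \<Rightarrow> 't" where
  "rho_hat T tp = (\<lambda>(n, u). [n] \<cdot>\<^bsub>End_ring T\<^esub> \<one>\<^bsub>End_ring T\<^esub> \<oplus>\<^bsub>End_ring T\<^esub> rho T tp u)"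

definition R_ring ::
  "('t, 'p) monoid_scheme \<Rightarrow> ('g, 'q) monoid_scheme \<Rightarrow> ('t \<Rightarrow> 'g \<Rightarrow> 't \<Rightarrow> 'g \<Rightarrow> 't \<Rightarrow> 't)
     \<Rightarrow> ('t \<Rightarrow> 't) ring" where
  "R_ring T \<Gamma> tp = (End_ring T)\<lparr>carrier := rho_hat T tp ` carrier (A_ring T \<Gamma> tp)\<rparr>"

definition K_ideal ::
  "('t, 'p) monoid_scheme \<Rightarrow> ('g, 'q) monoid_scheme \<Rightarrow> ('t \<Rightarrow> 'g \<Rightarrow> 't \<Rightarrow> 'g \<Rightarrow> 't \<Rightarrow> 't)
     \<Rightarrow> (int \<times> ('t, 'g) operator) set" where
  "K_ideal T \<Gamma> tp = a_kernel (A_ring T \<Gamma> tp) (End_ring T) (rho_hat T tp)"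


section \<open>Bimodules\<close>

text \<open>The underlying abelian group of a module is a \<^typ>\<open>'x monoid\<close>, so that the notions
  for groups (\<open>Mod\<close>, \<^const>\<open>kernel\<close>, \<^const>\<open>iso\<close>, \<dots>) apply to modules.
  The additive group of a ring \<open>R\<close> is \<open>add_monoid R\<close>.\<close>

record ('l, 'r, 'x) bimodule = "'x monoid" +
  lact :: "'l \<Rightarrow> 'x \<Rightarrow> 'x"
  ract :: "'x \<Rightarrow> 'r \<Rightarrow> 'x"

locale bimodule = L: ring R + R: ring S + M: comm_group M
  for R :: "('l, 'c) ring_scheme" and S :: "('r, 'd) ring_scheme"
    and M :: "('l, 'r, 'x, 'e) bimodule_scheme" (structure) +
  assumes lact_closed: "\<lbrakk>r \<in> carrier R; x \<in> carrier M\<rbrakk> \<Longrightarrow> lact M r x \<in> carrier M"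
    and lact_add_right: "\<lbrakk>r \<in> carrier R; x \<in> carrier M; y \<in> carrier M\<rbrakk>
      \<Longrightarrow> lact M r (x \<otimes> y) = lact M r x \<otimes> lact M r y"
    and lact_add_left: "\<lbrakk>r \<in> carrier R; r' \<in> carrier R; x \<in> carrier M\<rbrakk>
      \<Longrightarrow> lact M (r \<oplus>\<^bsub>R\<^esub> r') x = lact M r x \<otimes> lact M r' x"
    and lact_assoc: "\<lbrakk>r \<in> carrier R; r' \<in> carrier R; x \<in> carrier M\<rbrakk>
      \<Longrightarrow> lact M (r \<otimes>\<^bsub>R\<^esub> r') x = lact M r (lact M r' x)"
    and lact_one: "x \<in> carrier M \<Longrightarrow> lact M \<one>\<^bsub>R\<^esub> x = x"
    and ract_closed: "\<lbrakk>x \<in> carrier M; s \<in> carrier S\<rbrakk> \<Longrightarrow> ract M x s \<in> carrier M"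
    and ract_add_left: "\<lbrakk>x \<in> carrier M; y \<in> carrier M; s \<in> carrier S\<rbrakk>
      \<Longrightarrow> ract M (x \<otimes> y) s = ract M x s \<otimes> ract M y s"
    and ract_add_right: "\<lbrakk>x \<in> carrier M; s \<in> carrier S; s' \<in> carrier S\<rbrakk>
      \<Longrightarrow> ract M x (s \<oplus>\<^bsub>S\<^esub> s') = ract M x s \<otimes> ract M x s'"
    and ract_assoc: "\<lbrakk>x \<in> carrier M; s \<in> carrier S; s' \<in> carrier S\<rbrakk>
      \<Longrightarrow> ract M x (s \<otimes>\<^bsub>S\<^esub> s') = ract M (ract M x s) s'"
    and ract_one: "x \<in> carrier M \<Longrightarrow> ract M x \<one>\<^bsub>S\<^esub> = x"
    and lact_ract: "\<lbrakk>r \<in> carrier R; x \<in> carrier M; s \<in> carrier S\<rbrakk>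
      \<Longrightarrow> ract M (lact M r x) s = lact M r (ract M x s)"

definition bimodule_iso ::
  "('l, 'c) ring_scheme \<Rightarrow> ('r, 'd) ring_scheme \<Rightarrow> ('l, 'r, 'x, 'e) bimodule_scheme
     \<Rightarrow> ('l, 'r, 'y, 'f) bimodule_scheme \<Rightarrow> ('x \<Rightarrow> 'y) \<Rightarrow> bool" where
  "bimodule_iso R S M N \<phi> \<longleftrightarrow>
     bimodule R S M \<and> bimodule R S N \<and> \<phi> \<in> iso M N \<and>
     (\<forall>r\<in>carrier R. \<forall>x\<in>carrier M. \<phi> (lact M r x) = lact N r (\<phi> x)) \<and>
     (\<forall>s\<in>carrier S. \<forall>x\<in>carrier M. \<phi> (ract M x s) = ract N (\<phi> x) s)"

definition with_actions ::
  "('x, 'a) monoid_scheme \<Rightarrow> ('l \<Rightarrow> 'x \<Rightarrow> 'x) \<Rightarrow> ('x \<Rightarrow> 'r \<Rightarrow> 'x) \<Rightarrow> ('l, 'r, 'x) bimodule" where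
  "with_actions G l r = \<lparr>carrier = carrier G, mult = mult G, one = one G, lact = l, ract = r\<rparr>"

text \<open>For a surjective ring homomorphism \<open>q: A \<rightarrow> R\<close>: the conormal bimodule \<open>K/K\<^sup>2\<close> of its kernel
  \<open>K\<close>, on which \<open>R\<close> acts through lifts along \<open>q\<close>; and \<open>A\<close> and \<open>R\<close> as modules, \<open>R\<close> being
  restricted along \<open>q\<close> on one side.\<close>

definition conormal_bimodule ::
  "('a, 'm) ring_scheme \<Rightarrow> ('r, 'n) ring_scheme \<Rightarrow> ('a \<Rightarrow> 'r) \<Rightarrow> ('r, 'r, 'a set) bimodule" where
  "conormal_bimodule A R q =
     (let K = a_kernel A R q; K2 = ideal_prod A K K in
      with_actions ((add_monoid A)\<lparr>carrier := K\<rparr> Mod K2)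
        (\<lambda>r X. \<Union>a\<in>{a \<in> carrier A. q a = r}. \<Union>k\<in>X. K2 +>\<^bsub>A\<^esub> (a \<otimes>\<^bsub>A\<^esub> k))
        (\<lambda>X r. \<Union>a\<in>{a \<in> carrier A. q a = r}. \<Union>k\<in>X. K2 +>\<^bsub>A\<^esub> (k \<otimes>\<^bsub>A\<^esub> a)))"

definition regular_bimodule :: "('a, 'm) ring_scheme \<Rightarrow> ('a, 'a, 'a) bimodule" where
  "regular_bimodule A = with_actions (add_monoid A) (mult A) (mult A)"

definition restrict_right :: "('r, 'n) ring_scheme \<Rightarrow> ('a \<Rightarrow> 'r) \<Rightarrow> ('r, 'a, 'r) bimodule" where
  "restrict_right R q = with_actions (add_monoid R) (mult R) (\<lambda>x a. x \<otimes>\<^bsub>R\<^esub> q a)"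

definition restrict_left :: "('r, 'n) ring_scheme \<Rightarrow> ('a \<Rightarrow> 'r) \<Rightarrow> ('a, 'r, 'r) bimodule" where
  "restrict_left R q = with_actions (add_monoid R) (\<lambda>a x. q a \<otimes>\<^bsub>R\<^esub> x) (mult R)"


section \<open>Tensor products and the first Tor group\<close>

subsection \<open>The balanced tensor product\<close>

definition tensor_free ::
  "('s, 'a, 'm, 'c) bimodule_scheme \<Rightarrow> ('a, 'u, 'n, 'd) bimodule_scheme \<Rightarrow> ('m \<times> 'n \<Rightarrow>\<^sub>0 int) monoid" where
  "tensor_free M N = free_Abelian_group (carrier M \<times> carrier N)"

definition tensor_relators ::
  "('a, 'z) ring_scheme \<Rightarrow> ('s, 'a, 'm, 'c) bimodule_scheme \<Rightarrow> ('a, 'u, 'n, 'd) bimodule_scheme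
     \<Rightarrow> ('m \<times> 'n \<Rightarrow>\<^sub>0 int) set" where
  "tensor_relators A M N =
     {frag_of (x \<otimes>\<^bsub>M\<^esub> x', y) - frag_of (x, y) - frag_of (x', y) | x x' y.
        x \<in> carrier M \<and> x' \<in> carrier M \<and> y \<in> carrier N} \<union>
     {frag_of (x, y \<otimes>\<^bsub>N\<^esub> y') - frag_of (x, y) - frag_of (x, y') | x y y'.
        x \<in> carrier M \<and> y \<in> carrier N \<and> y' \<in> carrier N} \<union>
     {frag_of (ract M x a, y) - frag_of (x, lact N a y) | x a y.
        x \<in> carrier M \<and> a \<in> carrier A \<and> y \<in> carrier N}"

definition tensor_subgroup ::
  "('a, 'z) ring_scheme \<Rightarrow> ('s, 'a, 'm, 'c) bimodule_scheme \<Rightarrow> ('a, 'u, 'n, 'd) bimodule_scheme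
     \<Rightarrow> ('m \<times> 'n \<Rightarrow>\<^sub>0 int) set" where
  "tensor_subgroup A M N = generate (tensor_free M N) (tensor_relators A M N)"

definition tensor_class ::
  "('a, 'z) ring_scheme \<Rightarrow> ('s, 'a, 'm, 'c) bimodule_scheme \<Rightarrow> ('a, 'u, 'n, 'd) bimodule_scheme
     \<Rightarrow> 'm \<Rightarrow> 'n \<Rightarrow> ('m \<times> 'n \<Rightarrow>\<^sub>0 int) set" where
  "tensor_class A M N x y = tensor_subgroup A M N #>\<^bsub>tensor_free M N\<^esub> frag_of (x, y)"

text \<open>The map \<open>f \<otimes> g\<close> into the tensor product of \<open>M\<close> and \<open>N\<close>.\<close>

definition tensor_map ::
  "('a, 'z) ring_scheme \<Rightarrow> ('s, 'a, 'm, 'c) bimodule_scheme \<Rightarrow> ('a, 'u, 'n, 'd) bimodule_scheme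
     \<Rightarrow> ('x \<Rightarrow> 'm) \<Rightarrow> ('y \<Rightarrow> 'n) \<Rightarrow> ('x \<times> 'y \<Rightarrow>\<^sub>0 int) set \<Rightarrow> ('m \<times> 'n \<Rightarrow>\<^sub>0 int) set" where
  "tensor_map A M N f g X =
     (\<Union>p\<in>X. tensor_subgroup A M N #>\<^bsub>tensor_free M N\<^esub> frag_extend (\<lambda>(x, y). frag_of (f x, g y)) p)"

definition tensor ::
  "('a, 'z) ring_scheme \<Rightarrow> ('s, 'a, 'm, 'c) bimodule_scheme \<Rightarrow> ('a, 'u, 'n, 'd) bimodule_scheme
     \<Rightarrow> ('s, 'u, ('m \<times> 'n \<Rightarrow>\<^sub>0 int) set) bimodule" where
  "tensor A M N = with_actions (tensor_free M N Mod tensor_subgroup A M N)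
     (\<lambda>s. tensor_map A M N (lact M s) id)
     (\<lambda>X u. tensor_map A M N id (\<lambda>y. ract N y u) X)"

subsection \<open>A functorial free resolution\<close>

text \<open>For a subset \<open>Z\<close> of a right \<open>A\<close>-module \<open>Q\<close>: the free right \<open>A\<close>-module on \<open>Z\<close>, whose elements
  are the finitely supported functions from \<open>Z\<close> to \<open>A\<close>, and its canonical map
  \<open>\<Sum>z e\<^sub>z a\<^sub>z \<mapsto> \<Sum>z z a\<^sub>z\<close> to \<open>Q\<close>.  If \<open>s\<close> acts on \<open>Q\<close> from the left, preserving \<open>Z\<close>, then the
  left action of \<open>s\<close> on the free module is the \<open>A\<close>-linear map \<open>e\<^sub>z \<mapsto> e\<^bsub>s z\<^esub>\<close> induced by
  functoriality.  It is not additive in \<open>s\<close>, so the free module is not a bimodule; the actions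
  on Tor deduced from it are.\<close>

definition free_right_module ::
  "('a, 'z) ring_scheme \<Rightarrow> ('s, 'a, 'q, 'c) bimodule_scheme \<Rightarrow> 'q set \<Rightarrow> ('s, 'a, 'q \<Rightarrow> 'a) bimodule" where
  "free_right_module A Q Z = with_actions (sum_group Z (\<lambda>_. add_monoid A))
     (\<lambda>s f. \<lambda>y\<in>Z. gfinprod (add_monoid A) f {x \<in> Z. lact Q s x = y})
     (\<lambda>f a. \<lambda>y\<in>Z. f y \<otimes>\<^bsub>A\<^esub> a)"

definition free_eval :: "('s, 'a, 'q, 'c) bimodule_scheme \<Rightarrow> 'q set \<Rightarrow> ('q \<Rightarrow> 'a) \<Rightarrow> 'q" where
  "free_eval Q Z f = gfinprod Q (\<lambda>z. ract Q z (f z)) Z"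

text \<open>The beginning \<open>P\<^sub>2 \<rightarrow> P\<^sub>1 \<rightarrow> P\<^sub>0 \<rightarrow> M \<rightarrow> 0\<close> of the free resolution in which \<open>P\<^sub>0\<close> is
  free on all elements of \<open>M\<close> and each further module on all elements of the preceding kernel.\<close>

definition res0 ::
  "('a, 'z) ring_scheme \<Rightarrow> ('s, 'a, 'm, 'c) bimodule_scheme \<Rightarrow> ('s, 'a, 'm \<Rightarrow> 'a) bimodule" where
  "res0 A M = free_right_module A M (carrier M)"

definition augmentation :: "('s, 'a, 'm, 'c) bimodule_scheme \<Rightarrow> ('m \<Rightarrow> 'a) \<Rightarrow> 'm" where
  "augmentation M = free_eval M (carrier M)"

definition syzygies0 ::
  "('a, 'z) ring_scheme \<Rightarrow> ('s, 'a, 'm, 'c) bimodule_scheme \<Rightarrow> ('m \<Rightarrow> 'a) set" where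
  "syzygies0 A M = kernel (res0 A M) M (augmentation M)"

definition res1 ::
  "('a, 'z) ring_scheme \<Rightarrow> ('s, 'a, 'm, 'c) bimodule_scheme
     \<Rightarrow> ('s, 'a, ('m \<Rightarrow> 'a) \<Rightarrow> 'a) bimodule" where
  "res1 A M = free_right_module A (res0 A M) (syzygies0 A M)"

definition diff1 ::
  "('a, 'z) ring_scheme \<Rightarrow> ('s, 'a, 'm, 'c) bimodule_scheme \<Rightarrow> (('m \<Rightarrow> 'a) \<Rightarrow> 'a) \<Rightarrow> ('m \<Rightarrow> 'a)" where
  "diff1 A M = free_eval (res0 A M) (syzygies0 A M)"

definition syzygies1 ::
  "('a, 'z) ring_scheme \<Rightarrow> ('s, 'a, 'm, 'c) bimodule_scheme \<Rightarrow> (('m \<Rightarrow> 'a) \<Rightarrow> 'a) set" where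
  "syzygies1 A M = kernel (res1 A M) (res0 A M) (diff1 A M)"

definition res2 ::
  "('a, 'z) ring_scheme \<Rightarrow> ('s, 'a, 'm, 'c) bimodule_scheme
     \<Rightarrow> ('s, 'a, (('m \<Rightarrow> 'a) \<Rightarrow> 'a) \<Rightarrow> 'a) bimodule" where
  "res2 A M = free_right_module A (res1 A M) (syzygies1 A M)"

definition diff2 ::
  "('a, 'z) ring_scheme \<Rightarrow> ('s, 'a, 'm, 'c) bimodule_scheme
     \<Rightarrow> ((('m \<Rightarrow> 'a) \<Rightarrow> 'a) \<Rightarrow> 'a) \<Rightarrow> (('m \<Rightarrow> 'a) \<Rightarrow> 'a)" where
  "diff2 A M = free_eval (res1 A M) (syzygies1 A M)"

subsection \<open>Tor in degree one\<close>

definition tor1_cycles ::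
  "('a, 'z) ring_scheme \<Rightarrow> ('s, 'a, 'm, 'c) bimodule_scheme \<Rightarrow> ('a, 'u, 'n, 'd) bimodule_scheme
     \<Rightarrow> ((('m \<Rightarrow> 'a) \<Rightarrow> 'a) \<times> 'n \<Rightarrow>\<^sub>0 int) set set" where
  "tor1_cycles A M N = kernel (tensor A (res1 A M) N) (tensor A (res0 A M) N)
     (tensor_map A (res0 A M) N (diff1 A M) id)"

definition tor1_boundaries ::
  "('a, 'z) ring_scheme \<Rightarrow> ('s, 'a, 'm, 'c) bimodule_scheme \<Rightarrow> ('a, 'u, 'n, 'd) bimodule_scheme
     \<Rightarrow> ((('m \<Rightarrow> 'a) \<Rightarrow> 'a) \<times> 'n \<Rightarrow>\<^sub>0 int) set set" where
  "tor1_boundaries A M N =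
     tensor_map A (res1 A M) N (diff2 A M) id ` carrier (tensor A (res2 A M) N)"

text \<open>For an \<open>(S,A)\<close>-bimodule \<open>M\<close> and an \<open>(A,U)\<close>-bimodule \<open>N\<close>, the actions of \<open>S\<close> and \<open>U\<close> on
  \<open>Tor\<close> are those given by functoriality in \<open>M\<close> and in \<open>N\<close>.\<close>

definition Tor1 ::
  "('a, 'z) ring_scheme \<Rightarrow> ('s, 'a, 'm, 'c) bimodule_scheme \<Rightarrow> ('a, 'u, 'n, 'd) bimodule_scheme
     \<Rightarrow> ('s, 'u, ((('m \<Rightarrow> 'a) \<Rightarrow> 'a) \<times> 'n \<Rightarrow>\<^sub>0 int) set set) bimodule" where
  "Tor1 A M N =
     (let C1 = tensor A (res1 A M) N; B = tor1_boundaries A M N in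
      with_actions (C1\<lparr>carrier := tor1_cycles A M N\<rparr> Mod B)
        (\<lambda>s X. \<Union>x\<in>X. B #>\<^bsub>C1\<^esub> lact C1 s x)
        (\<lambda>X u. \<Union>x\<in>X. B #>\<^bsub>C1\<^esub> ract C1 x u))"

text \<open>For a surjection \<open>q: L \<rightarrow> M\<close> of right \<open>A\<close>-modules with kernel \<open>K\<close>: the connecting homomorphism
  from \<open>Tor\<^sub>1(M, N)\<close> to \<open>K \<otimes> N\<close> of the exact sequence \<open>0 \<rightarrow> K \<rightarrow> L \<rightarrow> M \<rightarrow> 0\<close>.  A linear lift
  \<open>P\<^sub>0 \<rightarrow> L\<close> of the augmentation exists because \<open>P\<^sub>0\<close> is free; composed with \<open>P\<^sub>1 \<rightarrow> P\<^sub>0\<close> it maps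
  \<open>P\<^sub>1\<close> to \<open>K\<close>, and the map on homology does not depend on its choice.\<close>

definition augmentation_lift ::
  "('a, 'z) ring_scheme \<Rightarrow> ('l, 'a, 'x, 'e) bimodule_scheme \<Rightarrow> ('s, 'a, 'm, 'c) bimodule_scheme
     \<Rightarrow> ('x \<Rightarrow> 'm) \<Rightarrow> (('m \<Rightarrow> 'a) \<Rightarrow> 'x) \<Rightarrow> bool" where
  "augmentation_lift A L M q f \<longleftrightarrow> f \<in> hom (res0 A M) L \<and>
     (\<forall>x\<in>carrier (res0 A M). \<forall>a\<in>carrier A. f (ract (res0 A M) x a) = ract L (f x) a) \<and>
     (\<forall>x\<in>carrier (res0 A M). q (f x) = augmentation M x)"

definition connecting_hom ::
  "('a, 'z) ring_scheme \<Rightarrow> ('l, 'a, 'x, 'e) bimodule_scheme \<Rightarrow> ('s, 'a, 'm, 'c) bimodule_scheme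
     \<Rightarrow> ('a, 'u, 'n, 'd) bimodule_scheme \<Rightarrow> ('x \<Rightarrow> 'm)
     \<Rightarrow> ((('m \<Rightarrow> 'a) \<Rightarrow> 'a) \<times> 'n \<Rightarrow>\<^sub>0 int) set set \<Rightarrow> ('x \<times> 'n \<Rightarrow>\<^sub>0 int) set" where
  "connecting_hom A L M N q X =
     (let f = (SOME f. augmentation_lift A L M q f) in
      \<Union>x\<in>X. tensor_map A (L\<lparr>carrier := kernel L M q\<rparr>) N (f \<circ> diff1 A M) id x)"


section \<open>The two bimodules over the regular operator ring\<close>

definition conormal_operator_defect ::
  "('t, 'p) monoid_scheme \<Rightarrow> ('g, 'q) monoid_scheme \<Rightarrow> ('t \<Rightarrow> 'g \<Rightarrow> 't \<Rightarrow> 'g \<Rightarrow> 't \<Rightarrow> 't)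
     \<Rightarrow> ('t \<Rightarrow> 't, 't \<Rightarrow> 't, (int \<times> ('t, 'g) operator) set) bimodule" where
  "conormal_operator_defect T \<Gamma> tp =
     conormal_bimodule (A_ring T \<Gamma> tp) (R_ring T \<Gamma> tp) (rho_hat T tp)"

definition right_A_module_R where
  "right_A_module_R T \<Gamma> tp = restrict_right (R_ring T \<Gamma> tp) (rho_hat T tp)"

definition left_A_module_R where
  "left_A_module_R T \<Gamma> tp = restrict_left (R_ring T \<Gamma> tp) (rho_hat T tp)"

definition Tor1_R_R where
  "Tor1_R_R T \<Gamma> tp =
     Tor1 (A_ring T \<Gamma> tp) (right_A_module_R T \<Gamma> tp) (left_A_module_R T \<Gamma> tp)"

text \<open>The connecting homomorphism \<open>Tor\<^sub>1(R, R) \<rightarrow> K \<otimes> R\<close> of \<open>0 \<rightarrow> K \<rightarrow> A \<rightarrow> R \<rightarrow> 0\<close>, and the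
  element \<open>k \<otimes> 1\<close> of \<open>K \<otimes> R\<close>.\<close>

definition connecting_R where
  "connecting_R T \<Gamma> tp =
     connecting_hom (A_ring T \<Gamma> tp) (regular_bimodule (A_ring T \<Gamma> tp))
       (right_A_module_R T \<Gamma> tp) (left_A_module_R T \<Gamma> tp) (rho_hat T tp)"

definition K_tensor_one where
  "K_tensor_one T \<Gamma> tp k =
     tensor_class (A_ring T \<Gamma> tp)
       ((regular_bimodule (A_ring T \<Gamma> tp))\<lparr>carrier := K_ideal T \<Gamma> tp\<rparr>)
       (left_A_module_R T \<Gamma> tp) k \<one>\<^bsub>R_ring T \<Gamma> tp\<^esub>"

end

theory Submission
  imports Defs "HOL-Algebra.Subrings"
begin

text \<open>The statement holds for every surjective ring homomorphism \<open>q: A \<rightarrow> R\<close> with kernel \<open>K\<close>.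
  Let \<open>Z\<^sub>0 \<subseteq> P\<^sub>0\<close> be the kernel of the augmentation \<open>P\<^sub>0 \<rightarrow> R\<close>.  Modulo boundaries, the class of
  \<open>p \<otimes> r\<close> with \<open>p \<in> P\<^sub>1\<close> depends only on \<open>d\<^sub>1 p \<in> Z\<^sub>0\<close> and \<open>r\<close>; write it as \<open>u (d\<^sub>1 p) r\<close>, a
  balanced biadditive function.  With \<open>i a = e\<^sub>1 a \<in> P\<^sub>0\<close>, where \<open>e\<^sub>1\<close> is the generator belonging to
  \<open>1 \<in> R\<close>, the isomorphism sends \<open>k + K\<^sup>2\<close> to \<open>u (i k) 1\<close>.

  Let \<open>f: P\<^sub>0 \<rightarrow> A\<close> be a linear lift of the augmentation.  It maps \<open>Z\<^sub>0\<close> to \<open>K\<close>, and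
  \<open>f (i k) = f (e\<^sub>1) k\<close> is congruent to \<open>k\<close> modulo \<open>K\<^sup>2\<close> because \<open>f (e\<^sub>1) - 1 \<in> K\<close>.
  Hence \<open>p \<otimes> r \<mapsto> f (d\<^sub>1 p) a + K\<^sup>2\<close>, for any lift \<open>a\<close> of \<open>r\<close>, kills the boundaries and inverts the
  map from the left.  For surjectivity, \<open>y \<otimes> r \<mapsto> u (y - i (f y)) r\<close> is defined on \<open>P\<^sub>0 \<otimes> R\<close>;
  applying it to \<open>d\<^sub>1 p \<otimes> 1 = 0\<close> for a cycle \<open>p \<otimes> 1\<close> gives \<open>u (d\<^sub>1 p) 1 = u (i (f (d\<^sub>1 p))) 1\<close>.
  The bimodule structure of Tor is transported along the isomorphism.\<close>

section \<open>Groups and cosets\<close>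

text \<open>\<open>P2\<close> is free on all of \<open>Z1\<close>, the kernel of \<open>d1\<close>.
  So each \<open>z \<in> Z1\<close> is \<open>d2\<close> of a generator and the tensors
  \<open>z \<otimes> r\<close> generate the boundaries. This makes \<open>u\<close> well defined,
  since two preimages of a syzygy under \<open>d1\<close> differ by an element of \<open>Z1\<close>,
  and it identifies \<open>Tor\<close> with the kernel of the map from \<open>Z0 \<otimes> R\<close>
  to \<open>P0 \<otimes> R\<close>. That map need not be injective, so the vanishing of a cycle in
  \<open>P0 \<otimes> R\<close> says nothing about \<open>u\<close> directly; \<open>u\<close> has
  to be traded for a function on all of \<open>P0\<close>. The term \<open>y - i (f y)\<close> does
  this because \<open>y\<close> and \<open>i (f y)\<close> have the same augmentation. Everything
  modulo \<open>K2\<close> rests on one computation: \<open>z k \<otimes> r\<close> equals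
  \<open>z \<otimes> q(k) r\<close>, which is zero, for \<open>z \<in> Z0\<close> and
  \<open>k \<in> K\<close>. It shows that \<open>eta\<close> kills \<open>K2\<close>. It also
  settles the left action, which moves \<open>e_1\<close> to another generator and leaves an error
  of exactly this form. For the operator rings, the remaining work is to carry associativity and the
  representation through two quotients of a ring without identity.\<close>

lemma with_actions_simps [simp]:
  "carrier (with_actions G l r) = carrier G"
  "mult (with_actions G l r) = mult G"
  "one (with_actions G l r) = one G"
  "lact (with_actions G l r) = l"
  "ract (with_actions G l r) = r"
  by (simp_all add: with_actions_def)

lemma r_coset_with_actions [simp]: "H #>\<^bsub>with_actions G l r\<^esub> x = H #>\<^bsub>G\<^esub> x"
  by (simp add: r_coset_def)

lemma r_coset_carrier_update [simp]: "H #>\<^bsub>G\<lparr>carrier := C\<rparr>\<^esub> x = H #>\<^bsub>G\<^esub> x"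
  by (simp add: r_coset_def)

lemma hom_with_actions [simp]:
  "hom (with_actions G l r) H = hom G H" "hom H (with_actions G l r) = hom H G"
  by (simp_all add: hom_def)

lemma comm_group_with_actions:
  assumes "comm_group G" shows "comm_group (with_actions G l r)"
proof -
  interpret comm_group G by fact
  show ?thesis
    by (rule comm_groupI) (auto intro: m_assoc m_comm l_inv_ex)
qed

lemma group_hom_intro: "\<lbrakk>comm_group G; comm_group H; h \<in> hom G H\<rbrakk> \<Longrightarrow> group_hom G H h"
  by (simp add: group_hom_def group_hom_axioms_def comm_group.axioms)

text \<open>Maps on quotients are defined as unions over all representatives. Such a union collapses
  to a single value once its members do not depend on the representative.\<close>

lemma UN_const: "\<lbrakk>x \<in> X; \<And>y. y \<in> X \<Longrightarrow> F y = c\<rbrakk> \<Longrightarrow> (\<Union>y\<in>X. F y) = c"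
  by auto

lemma (in group) r_coset_eq_iff:
  assumes "subgroup H G" "x \<in> carrier G" "y \<in> carrier G"
  shows "H #> x = H #> y \<longleftrightarrow> x \<otimes> inv y \<in> H"
proof
  assume "H #> x = H #> y"
  then have "x \<in> H #> y"
    using rcos_self assms by blast
  then show "x \<otimes> inv y \<in> H"
    using subgroup.rcos_module_imp[OF assms(1) is_group assms(3)] assms by blast
next
  assume "x \<otimes> inv y \<in> H"
  then have "x \<in> H #> y"
    using subgroup.rcos_module_rev[OF assms(1) is_group assms(3)] assms by blast
  then show "H #> x = H #> y"
    using repr_independence assms by metis
qed

text \<open>This is descent to quotient groups for maps written as unions: another representative
  changes the value by some \<open>h k \<in> H'\<close>, which the coset absorbs.
  \<open>tensor_map\<close> and the actions on \<open>Tor1\<close> have this form.\<close>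

lemma UN_coset_hom:
  assumes "group G" "group G'" "h \<in> hom G G'" "subgroup H G" "subgroup H' G'"
    and "\<And>x. x \<in> H \<Longrightarrow> h x \<in> H'" "x \<in> carrier G"
  shows "(\<Union>y\<in>H #>\<^bsub>G\<^esub> x. H' #>\<^bsub>G'\<^esub> h y) = H' #>\<^bsub>G'\<^esub> h x"
proof (rule UN_const)
  interpret G: group G by fact
  interpret G': group G' by fact
  show "x \<in> H #>\<^bsub>G\<^esub> x"
    using assms G.rcos_self by blast
  fix y assume "y \<in> H #>\<^bsub>G\<^esub> x"
  then obtain k where k: "k \<in> H" "y = k \<otimes>\<^bsub>G\<^esub> x"
    by (auto simp: r_coset_def)
  have kc: "k \<in> carrier G"
    using k assms subgroup.mem_carrier by metis
  have hc: "h k \<in> carrier G'" "h x \<in> carrier G'"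
    using kc assms by (auto simp: hom_def)
  have "H' #>\<^bsub>G'\<^esub> h y = H' #>\<^bsub>G'\<^esub> (h k \<otimes>\<^bsub>G'\<^esub> h x)"
    using k kc assms by (simp add: hom_mult)
  also have "\<dots> = (H' #>\<^bsub>G'\<^esub> h k) #>\<^bsub>G'\<^esub> h x"
    using G'.coset_mult_assoc hc assms subgroup.subset by metis
  also have "H' #>\<^bsub>G'\<^esub> h k = H'"
    using G'.coset_join2 hc assms k by metis
  finally show "H' #>\<^bsub>G'\<^esub> h y = H' #>\<^bsub>G'\<^esub> h x" .
qed

text \<open>Here the elements of \<open>G'\<close> are themselves sets, in applications cosets, and
  the union is taken of these sets. This is the shape of \<open>connecting_hom\<close>.\<close>

lemma UN_coset_hom_const:
  assumes "group G" "group G'" "h \<in> hom G G'" "subgroup H G"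
    and "\<And>x. x \<in> H \<Longrightarrow> h x = \<one>\<^bsub>G'\<^esub>" "x \<in> carrier G"
  shows "(\<Union>y\<in>H #>\<^bsub>G\<^esub> x. h y) = h x"
proof (rule UN_const)
  interpret G: group G by fact
  interpret G': group G' by fact
  show "x \<in> H #>\<^bsub>G\<^esub> x"
    using assms G.rcos_self by blast
  fix y assume "y \<in> H #>\<^bsub>G\<^esub> x"
  then obtain k where k: "k \<in> H" "y = k \<otimes>\<^bsub>G\<^esub> x"
    by (auto simp: r_coset_def)
  have kc: "k \<in> carrier G"
    using k assms subgroup.mem_carrier by metis
  have hc: "h x \<in> carrier G'"
    using assms by (auto simp: hom_def)
  show "h y = h x"
    using k kc hc assms by (simp add: hom_mult)
qed

lemma hom_generate_subset:
  assumes "group G" "group H" "h \<in> hom G H" "S \<subseteq> carrier G" "subgroup L H" "\<And>x. x \<in> S \<Longrightarrow> h x \<in> L"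
    and "x \<in> generate G S"
  shows "h x \<in> L"
proof -
  interpret group_hom G H h
    using assms by (simp add: group_hom_def group_hom_axioms_def)
  \<comment> \<open>Carrier membership is carried along because \<open>h\<close> respects products
    only inside the carrier.\<close>
  have "h x \<in> L \<and> x \<in> carrier G"
    using assms(7)
  proof induction
    case one
    then show ?case using assms(5) by (simp add: subgroup.one_closed)
  next
    case (incl h)
    then show ?case using assms by blast
  next
    case (inv h)
    then show ?case using assms(4,5,6) by (auto simp: subgroup.m_inv_closed subset_iff)
  next
    case (eng h1 h2)
    then show ?case using assms(5) by (simp add: subgroup.m_closed)
  qed
  then show ?thesis ..
qed

lemma subgroup_trivial: "group G \<Longrightarrow> subgroup {\<one>\<^bsub>G\<^esub>} G"
  by (rule group.triv_subgroup)

section \<open>One-sided modules\<close>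

text \<open>Only \<open>ract\<close> is constrained. The free modules of the resolution have a left
  action that is not additive in the scalar, so they fall outside \<open>bimodule\<close> and are
  treated as one-sided modules.\<close>

locale right_module = A: ring A + M: comm_group M
  for A :: "('a, 'z) ring_scheme" and M :: "('s, 'a, 'm, 'c) bimodule_scheme" +
  assumes act_closed [simp, intro]: "\<lbrakk>x \<in> carrier M; a \<in> carrier A\<rbrakk> \<Longrightarrow> ract M x a \<in> carrier M"
    and act_mult: "\<lbrakk>x \<in> carrier M; y \<in> carrier M; a \<in> carrier A\<rbrakk>
      \<Longrightarrow> ract M (x \<otimes>\<^bsub>M\<^esub> y) a = ract M x a \<otimes>\<^bsub>M\<^esub> ract M y a"
    and act_add: "\<lbrakk>x \<in> carrier M; a \<in> carrier A; b \<in> carrier A\<rbrakk>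
      \<Longrightarrow> ract M x (a \<oplus>\<^bsub>A\<^esub> b) = ract M x a \<otimes>\<^bsub>M\<^esub> ract M x b"
    and act_assoc: "\<lbrakk>x \<in> carrier M; a \<in> carrier A; b \<in> carrier A\<rbrakk>
      \<Longrightarrow> ract M x (a \<otimes>\<^bsub>A\<^esub> b) = ract M (ract M x a) b"
    and act_one [simp]: "x \<in> carrier M \<Longrightarrow> ract M x \<one>\<^bsub>A\<^esub> = x"
begin

lemma act_hom: "a \<in> carrier A \<Longrightarrow> (\<lambda>x. ract M x a) \<in> hom M M"
  by (auto simp: hom_def act_mult)

lemma act_add_hom: "x \<in> carrier M \<Longrightarrow> ract M x \<in> hom (add_monoid A) M"
  by (auto simp: hom_def act_add)

lemma act_unit [simp]: "a \<in> carrier A \<Longrightarrow> ract M \<one>\<^bsub>M\<^esub> a = \<one>\<^bsub>M\<^esub>"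
  using hom_one[OF act_hom] M.is_group by blast

lemma act_zero [simp]: "x \<in> carrier M \<Longrightarrow> ract M x \<zero>\<^bsub>A\<^esub> = \<one>\<^bsub>M\<^esub>"
  using hom_one[OF act_add_hom A.a_group M.is_group] by simp

lemma act_inv: "\<lbrakk>x \<in> carrier M; a \<in> carrier A\<rbrakk> \<Longrightarrow> ract M (inv\<^bsub>M\<^esub> x) a = inv\<^bsub>M\<^esub> (ract M x a)"
  using group_hom.hom_inv[of M M "\<lambda>x. ract M x a" x] act_hom
  by (simp add: group_hom_def group_hom_axioms_def)

end

locale left_module = A: ring A + N: comm_group N
  for A :: "('a, 'z) ring_scheme" and N :: "('a, 'u, 'n, 'd) bimodule_scheme" +
  assumes act_closed [simp, intro]: "\<lbrakk>a \<in> carrier A; x \<in> carrier N\<rbrakk> \<Longrightarrow> lact N a x \<in> carrier N"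
    and act_mult: "\<lbrakk>a \<in> carrier A; x \<in> carrier N; y \<in> carrier N\<rbrakk>
      \<Longrightarrow> lact N a (x \<otimes>\<^bsub>N\<^esub> y) = lact N a x \<otimes>\<^bsub>N\<^esub> lact N a y"
    and act_add: "\<lbrakk>a \<in> carrier A; b \<in> carrier A; x \<in> carrier N\<rbrakk>
      \<Longrightarrow> lact N (a \<oplus>\<^bsub>A\<^esub> b) x = lact N a x \<otimes>\<^bsub>N\<^esub> lact N b x"
    and act_assoc: "\<lbrakk>a \<in> carrier A; b \<in> carrier A; x \<in> carrier N\<rbrakk>
      \<Longrightarrow> lact N (a \<otimes>\<^bsub>A\<^esub> b) x = lact N a (lact N b x)"
    and act_one [simp]: "x \<in> carrier N \<Longrightarrow> lact N \<one>\<^bsub>A\<^esub> x = x"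

definition right_linear ::
  "('a, 'z) ring_scheme \<Rightarrow> ('s, 'a, 'm, 'c) bimodule_scheme \<Rightarrow> ('t, 'a, 'n, 'd) bimodule_scheme
     \<Rightarrow> ('m \<Rightarrow> 'n) \<Rightarrow> bool" where
  "right_linear A M N f \<longleftrightarrow> f \<in> hom M N \<and>
     (\<forall>x\<in>carrier M. \<forall>a\<in>carrier A. f (ract M x a) = ract N (f x) a)"

definition left_linear ::
  "('a, 'z) ring_scheme \<Rightarrow> ('a, 's, 'm, 'c) bimodule_scheme \<Rightarrow> ('a, 't, 'n, 'd) bimodule_scheme
     \<Rightarrow> ('m \<Rightarrow> 'n) \<Rightarrow> bool" where
  "left_linear A M N f \<longleftrightarrow> f \<in> hom M N \<and>
     (\<forall>a\<in>carrier A. \<forall>x\<in>carrier M. f (lact M a x) = lact N a (f x))"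

lemma right_linear_id: "right_linear A M M id"
  by (auto simp: right_linear_def hom_def)

lemma left_linear_id: "left_linear A M M id"
  by (auto simp: left_linear_def hom_def)

lemma right_linearD:
  assumes "right_linear A M N f"
  shows "f \<in> hom M N" "x \<in> carrier M \<Longrightarrow> f x \<in> carrier N"
    "\<lbrakk>x \<in> carrier M; y \<in> carrier M\<rbrakk> \<Longrightarrow> f (x \<otimes>\<^bsub>M\<^esub> y) = f x \<otimes>\<^bsub>N\<^esub> f y"
    "\<lbrakk>x \<in> carrier M; a \<in> carrier A\<rbrakk> \<Longrightarrow> f (ract M x a) = ract N (f x) a"
  using assms by (auto simp: right_linear_def hom_def)

lemma left_linearD:
  assumes "left_linear A M N f"
  shows "f \<in> hom M N" "x \<in> carrier M \<Longrightarrow> f x \<in> carrier N"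
    "\<lbrakk>x \<in> carrier M; y \<in> carrier M\<rbrakk> \<Longrightarrow> f (x \<otimes>\<^bsub>M\<^esub> y) = f x \<otimes>\<^bsub>N\<^esub> f y"
    "\<lbrakk>x \<in> carrier M; a \<in> carrier A\<rbrakk> \<Longrightarrow> f (lact M a x) = lact N a (f x)"
  using assms by (auto simp: left_linear_def hom_def)

section \<open>Balanced tensor products\<close>

lemma tensor_relatorsI:
  "\<lbrakk>x \<in> carrier M; x' \<in> carrier M; y \<in> carrier N\<rbrakk>
    \<Longrightarrow> frag_of (x \<otimes>\<^bsub>M\<^esub> x', y) - frag_of (x, y) - frag_of (x', y) \<in> tensor_relators A M N"
  "\<lbrakk>x \<in> carrier M; y \<in> carrier N; y' \<in> carrier N\<rbrakk>
    \<Longrightarrow> frag_of (x, y \<otimes>\<^bsub>N\<^esub> y') - frag_of (x, y) - frag_of (x, y') \<in> tensor_relators A M N"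
  "\<lbrakk>x \<in> carrier M; a \<in> carrier A; y \<in> carrier N\<rbrakk>
    \<Longrightarrow> frag_of (ract M x a, y) - frag_of (x, lact N a y) \<in> tensor_relators A M N"
  unfolding tensor_relators_def by blast+

lemma tensor_relatorsE [consumes 1, case_names left right balanced]:
  assumes "r \<in> tensor_relators A M N"
  obtains x x' y where "r = frag_of (x \<otimes>\<^bsub>M\<^esub> x', y) - frag_of (x, y) - frag_of (x', y)"
      "x \<in> carrier M" "x' \<in> carrier M" "y \<in> carrier N"
    | x y y' where "r = frag_of (x, y \<otimes>\<^bsub>N\<^esub> y') - frag_of (x, y) - frag_of (x, y')"
      "x \<in> carrier M" "y \<in> carrier N" "y' \<in> carrier N"
    | x a y where "r = frag_of (ract M x a, y) - frag_of (x, lact N a y)"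
      "x \<in> carrier M" "a \<in> carrier A" "y \<in> carrier N"
  using assms unfolding tensor_relators_def by blast

locale tensor_pair = M: right_module A M + N: left_module A N
  for A :: "('a, 'z) ring_scheme" and M :: "('s, 'a, 'm, 'c) bimodule_scheme"
    and N :: "('a, 'u, 'n, 'd) bimodule_scheme"
begin

abbreviation TF where "TF \<equiv> tensor_free M N"
abbreviation TS where "TS \<equiv> tensor_subgroup A M N"
abbreviation TP where "TP \<equiv> tensor A M N"
abbreviation tens (infix "\<diamondop>" 72) where "x \<diamondop> y \<equiv> tensor_class A M N x y"

lemma free_comm_group: "comm_group TF"
  by (simp add: tensor_free_def abelian_free_Abelian_group)

lemma free_group: "group TF"
  by (simp add: tensor_free_def)

lemma relators_subset: "tensor_relators A M N \<subseteq> carrier TF"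
  by (auto simp: tensor_free_def tensor_relators_def keys_frag_of dest!: subsetD[OF keys_diff])

lemma subgroup_TS: "subgroup TS TF"
  unfolding tensor_subgroup_def by (rule group.generate_is_subgroup[OF free_group relators_subset])

lemma normal_TS: "TS \<lhd> TF"
  using comm_group.normal_iff_subgroup[OF free_comm_group] subgroup_TS by blast

lemma tensor_comm_group: "comm_group TP"
  unfolding tensor_def
  by (rule comm_group_with_actions, rule comm_group.abelian_FactGroup[OF free_comm_group subgroup_TS])

sublocale TP: comm_group TP
  by (rule tensor_comm_group)

lemma carrier_tensor: "carrier TP = (\<lambda>p. TS #>\<^bsub>TF\<^esub> p) ` carrier TF"
  by (simp add: tensor_def FactGroup_def RCOSETS_def image_def) blast

lemma coset_hom: "(\<lambda>p. TS #>\<^bsub>TF\<^esub> p) \<in> hom TF TP"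
  using normal.r_coset_hom_Mod[OF normal_TS] by (simp add: tensor_def)

lemma one_tensor: "\<one>\<^bsub>TP\<^esub> = TS"
  by (simp add: tensor_def)

lemma relator_trivial:
  assumes "r \<in> tensor_relators A M N" shows "TS #>\<^bsub>TF\<^esub> r = \<one>\<^bsub>TP\<^esub>"
proof -
  have "r \<in> TS"
    unfolding tensor_subgroup_def using assms by (rule generate.incl)
  then show ?thesis
    using group.coset_join2[OF free_group _ subgroup_TS] subgroup.mem_carrier[OF subgroup_TS]
    by (simp add: one_tensor)
qed

lemma coset_add:
  assumes "p \<in> carrier TF" "p' \<in> carrier TF"
  shows "TS #>\<^bsub>TF\<^esub> (p + p') = (TS #>\<^bsub>TF\<^esub> p) \<otimes>\<^bsub>TP\<^esub> (TS #>\<^bsub>TF\<^esub> p')"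
  using hom_mult[OF coset_hom assms] by (simp add: tensor_free_def)

lemma coset_closed [simp]: "p \<in> carrier TF \<Longrightarrow> TS #>\<^bsub>TF\<^esub> p \<in> carrier TP"
  by (auto simp: carrier_tensor)

lemma frag_of_closed [simp]: "\<lbrakk>x \<in> carrier M; y \<in> carrier N\<rbrakk> \<Longrightarrow> frag_of (x, y) \<in> carrier TF"
  by (simp add: tensor_free_def)

lemma coset_relation:
  assumes "u - v \<in> tensor_relators A M N" "v \<in> carrier TF"
  shows "TS #>\<^bsub>TF\<^esub> u = TS #>\<^bsub>TF\<^esub> v"
proof -
  have "u - v \<in> carrier TF"
    using relators_subset assms(1) by blast
  then have "TS #>\<^bsub>TF\<^esub> ((u - v) + v) = (TS #>\<^bsub>TF\<^esub> (u - v)) \<otimes>\<^bsub>TP\<^esub> (TS #>\<^bsub>TF\<^esub> v)"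
    using assms(2) by (rule coset_add)
  then show ?thesis
    using assms by (simp add: relator_trivial)
qed

lemma tens_closed [simp, intro]: "\<lbrakk>x \<in> carrier M; y \<in> carrier N\<rbrakk> \<Longrightarrow> x \<diamondop> y \<in> carrier TP"
  by (simp add: tensor_class_def)

lemma tens_add_left:
  assumes "x \<in> carrier M" "x' \<in> carrier M" "y \<in> carrier N"
  shows "(x \<otimes>\<^bsub>M\<^esub> x') \<diamondop> y = (x \<diamondop> y) \<otimes>\<^bsub>TP\<^esub> (x' \<diamondop> y)"
proof -
  have "TS #>\<^bsub>TF\<^esub> frag_of (x \<otimes>\<^bsub>M\<^esub> x', y) = TS #>\<^bsub>TF\<^esub> (frag_of (x, y) + frag_of (x', y))"
  proof (rule coset_relation)
    show "frag_of (x \<otimes>\<^bsub>M\<^esub> x', y) - (frag_of (x, y) + frag_of (x', y)) \<in> tensor_relators A M N"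
      using assms by (simp add: tensor_relators_def diff_diff_add[symmetric]) blast
    show "frag_of (x, y) + frag_of (x', y) \<in> carrier TF"
      using assms group.subgroup_self[OF free_group] subgroup.m_closed[of "carrier TF" TF "frag_of (x, y)" "frag_of (x', y)"]
      by (simp add: tensor_free_def)
  qed
  then show ?thesis
    using assms by (simp add: tensor_class_def coset_add)
qed

lemma tens_add_right:
  assumes "x \<in> carrier M" "y \<in> carrier N" "y' \<in> carrier N"
  shows "x \<diamondop> (y \<otimes>\<^bsub>N\<^esub> y') = (x \<diamondop> y) \<otimes>\<^bsub>TP\<^esub> (x \<diamondop> y')"
proof -
  have "TS #>\<^bsub>TF\<^esub> frag_of (x, y \<otimes>\<^bsub>N\<^esub> y') = TS #>\<^bsub>TF\<^esub> (frag_of (x, y) + frag_of (x, y'))"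
  proof (rule coset_relation)
    show "frag_of (x, y \<otimes>\<^bsub>N\<^esub> y') - (frag_of (x, y) + frag_of (x, y')) \<in> tensor_relators A M N"
      using assms by (simp add: tensor_relators_def diff_diff_add[symmetric]) blast
    show "frag_of (x, y) + frag_of (x, y') \<in> carrier TF"
      using assms group.subgroup_self[OF free_group] subgroup.m_closed[of "carrier TF" TF "frag_of (x, y)" "frag_of (x, y')"]
      by (simp add: tensor_free_def)
  qed
  then show ?thesis
    using assms by (simp add: tensor_class_def coset_add)
qed

lemma tens_balanced:
  assumes "x \<in> carrier M" "a \<in> carrier A" "y \<in> carrier N"
  shows "ract M x a \<diamondop> y = x \<diamondop> lact N a y"
  unfolding tensor_class_def
proof (rule coset_relation)
  show "frag_of (ract M x a, y) - frag_of (x, lact N a y) \<in> tensor_relators A M N"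
    using assms by (simp add: tensor_relators_def) blast
  show "frag_of (x, lact N a y) \<in> carrier TF"
    using assms by simp
qed

lemma tens_left_hom: "y \<in> carrier N \<Longrightarrow> (\<lambda>x. x \<diamondop> y) \<in> hom M TP"
  by (auto simp: hom_def tens_add_left)

lemma tens_right_hom: "x \<in> carrier M \<Longrightarrow> (\<lambda>y. x \<diamondop> y) \<in> hom N TP"
  by (auto simp: hom_def tens_add_right)

lemma tens_one_right [simp]: "x \<in> carrier M \<Longrightarrow> x \<diamondop> \<one>\<^bsub>N\<^esub> = \<one>\<^bsub>TP\<^esub>"
  using hom_one[OF tens_right_hom N.N.is_group TP.is_group] .

lemma tens_inv_left:
  "\<lbrakk>x \<in> carrier M; y \<in> carrier N\<rbrakk> \<Longrightarrow> (inv\<^bsub>M\<^esub> x) \<diamondop> y = inv\<^bsub>TP\<^esub> (x \<diamondop> y)"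
  using group_hom.hom_inv[OF group_hom_intro[OF M.M.comm_group_axioms tensor_comm_group tens_left_hom]]
  by blast

text \<open>Pure tensors generate the tensor product. The step \<open>X \<otimes> inv Y\<close>
  covers products and inverses at once and mirrors the differences in the induction rule for free
  abelian groups.\<close>

lemma tensor_induct [consumes 1, case_names one tens diff]:
  assumes "X \<in> carrier TP"
    and one: "P \<one>\<^bsub>TP\<^esub>"
    and tens: "\<And>x y. \<lbrakk>x \<in> carrier M; y \<in> carrier N\<rbrakk> \<Longrightarrow> P (x \<diamondop> y)"
    and diff: "\<And>X Y. \<lbrakk>X \<in> carrier TP; Y \<in> carrier TP; P X; P Y\<rbrakk> \<Longrightarrow> P (X \<otimes>\<^bsub>TP\<^esub> inv\<^bsub>TP\<^esub> Y)"
  shows "P X"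
proof -
  interpret c: group_hom TF TP "\<lambda>p. TS #>\<^bsub>TF\<^esub> p"
    by (rule group_hom_intro[OF free_comm_group tensor_comm_group coset_hom])
  obtain p where p: "p \<in> carrier TF" "X = TS #>\<^bsub>TF\<^esub> p"
    using assms(1) by (auto simp: carrier_tensor)
  have "Poly_Mapping.keys p \<subseteq> carrier M \<times> carrier N"
    using p by (simp add: tensor_free_def)
  then have "P (TS #>\<^bsub>TF\<^esub> p)"
  proof (rule free_Abelian_group_induct)
    show "P (TS #>\<^bsub>TF\<^esub> 0)"
      using c.hom_one one by (simp add: tensor_free_def)
  next
    fix p p'
    assume *: "Poly_Mapping.keys p \<subseteq> carrier M \<times> carrier N" "Poly_Mapping.keys p' \<subseteq> carrier M \<times> carrier N"
      "P (TS #>\<^bsub>TF\<^esub> p)" "P (TS #>\<^bsub>TF\<^esub> p')"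
    then have pc: "p \<in> carrier TF" "p' \<in> carrier TF"
      by (simp_all add: tensor_free_def)
    have "p - p' = p \<otimes>\<^bsub>TF\<^esub> inv\<^bsub>TF\<^esub> p'"
      using * by (simp add: tensor_free_def)
    then show "P (TS #>\<^bsub>TF\<^esub> (p - p'))"
      using * pc diff by simp
  next
    fix s assume "s \<in> carrier M \<times> carrier N"
    then show "P (TS #>\<^bsub>TF\<^esub> frag_of s)"
      using tens by (auto simp: tensor_class_def)
  qed
  then show ?thesis
    using p by simp
qed

lemma hom_into_subgroup:
  assumes "group G" "h \<in> hom TP G" "subgroup L G"
    and "\<And>x y. \<lbrakk>x \<in> carrier M; y \<in> carrier N\<rbrakk> \<Longrightarrow> h (x \<diamondop> y) \<in> L" "X \<in> carrier TP"
  shows "h X \<in> L"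
proof -
  interpret group_hom TP G h
    using assms by (simp add: group_hom_def group_hom_axioms_def TP.is_group)
  show ?thesis
    using assms(5)
    by (induction X rule: tensor_induct)
       (use assms(3,4) in \<open>auto simp: subgroup.one_closed subgroup.m_closed subgroup.m_inv_closed\<close>)
qed

text \<open>The extension of \<open>h\<close> to the free abelian group kills every relator, hence
  factors through the quotient. This produces the two maps out of tensor products on which
  injectivity and surjectivity of \<open>eta\<close> rest.\<close>

lemma tensor_lift:
  assumes "comm_group G"
    and closed: "\<And>x y. \<lbrakk>x \<in> carrier M; y \<in> carrier N\<rbrakk> \<Longrightarrow> h x y \<in> carrier G"
    and left: "\<And>x x' y. \<lbrakk>x \<in> carrier M; x' \<in> carrier M; y \<in> carrier N\<rbrakk>
      \<Longrightarrow> h (x \<otimes>\<^bsub>M\<^esub> x') y = h x y \<otimes>\<^bsub>G\<^esub> h x' y"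
    and right: "\<And>x y y'. \<lbrakk>x \<in> carrier M; y \<in> carrier N; y' \<in> carrier N\<rbrakk>
      \<Longrightarrow> h x (y \<otimes>\<^bsub>N\<^esub> y') = h x y \<otimes>\<^bsub>G\<^esub> h x y'"
    and balanced: "\<And>x a y. \<lbrakk>x \<in> carrier M; a \<in> carrier A; y \<in> carrier N\<rbrakk>
      \<Longrightarrow> h (ract M x a) y = h x (lact N a y)"
  obtains H where "H \<in> hom TP G"
    "\<And>x y. \<lbrakk>x \<in> carrier M; y \<in> carrier N\<rbrakk> \<Longrightarrow> H (x \<diamondop> y) = h x y"
proof -
  interpret G: comm_group G by fact
  obtain g where g: "g \<in> hom TF G" and gof: "\<And>s. s \<in> carrier M \<times> carrier N \<Longrightarrow> g (frag_of s) = (\<lambda>(x, y). h x y) s"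
    using G.free_Abelian_group_universal[of "\<lambda>(x, y). h x y" "carrier M \<times> carrier N"] closed
    unfolding tensor_free_def by (metis (no_types, lifting) case_prod_conv image_subsetI mem_Sigma_iff surj_pair)
  interpret g: group_hom TF G g
    by (rule group_hom_intro[OF free_comm_group assms(1) g])
  have gof': "g (frag_of (x, y)) = h x y" if "x \<in> carrier M" "y \<in> carrier N" for x y
    using gof that by simp
  have diff: "g (u - v) = g u \<otimes>\<^bsub>G\<^esub> inv\<^bsub>G\<^esub> g v" if "u \<in> carrier TF" "v \<in> carrier TF" for u v
  proof -
    have "u - v = u \<otimes>\<^bsub>TF\<^esub> inv\<^bsub>TF\<^esub> v"
      using that by (simp add: tensor_free_def)
    then show ?thesis
      using that by (simp add: g.hom_mult g.hom_inv)
  qed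
  have TFdiff: "u - v \<in> carrier TF" if "u \<in> carrier TF" "v \<in> carrier TF" for u v
    using that by (auto simp: tensor_free_def dest!: subsetD[OF keys_diff])
  \<comment> \<open>The image of a biadditivity relator takes this form once commutativity has
    sorted its factors.\<close>
  have cancel: "inv\<^bsub>G\<^esub> v \<otimes>\<^bsub>G\<^esub> (inv\<^bsub>G\<^esub> u \<otimes>\<^bsub>G\<^esub> (u \<otimes>\<^bsub>G\<^esub> v)) = \<one>\<^bsub>G\<^esub>"
    if "u \<in> carrier G" "v \<in> carrier G" for u v
    using that by (simp add: G.m_assoc[symmetric])
  have "g r \<in> {\<one>\<^bsub>G\<^esub>}" if "r \<in> tensor_relators A M N" for r
    using that unfolding tensor_relators_def
    by (auto simp: diff TFdiff gof' left right balanced closed cancel G.m_comm)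
  then have "TS \<subseteq> kernel TF G g"
    using hom_generate_subset[OF free_group G.is_group g relators_subset G.triv_subgroup]
      subgroup.mem_carrier[OF subgroup_TS]
    unfolding kernel_def tensor_subgroup_def by blast
  then obtain H where "H \<in> hom (TF Mod TS) G" "\<And>p. p \<in> carrier TF \<Longrightarrow> H (TS #>\<^bsub>TF\<^esub> p) = g p"
    using g.FactGroup_universal_kernel[OF normal_TS] by blast
  then show thesis
    using that[of H] by (simp add: tensor_def tensor_class_def gof')
qed

end

locale tensor_map_pair = X: tensor_pair A X Y + M: tensor_pair A M N
  for A :: "('a, 'z) ring_scheme" and X :: "('s, 'a, 'x, 'c) bimodule_scheme"
    and Y :: "('a, 'u, 'y, 'd) bimodule_scheme" and M :: "('t, 'a, 'm, 'e) bimodule_scheme"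
    and N :: "('a, 'v, 'n, 'f) bimodule_scheme" +
  fixes f g
  assumes f: "right_linear A X M f" and g: "left_linear A Y N g"
begin

abbreviation "ext \<equiv> frag_extend (\<lambda>(x, y). frag_of (f x, g y))"

lemma ext_closed:
  assumes "p \<in> carrier X.TF" shows "ext p \<in> carrier M.TF"
proof -
  have "Poly_Mapping.keys (ext p) \<subseteq> (\<Union>s\<in>Poly_Mapping.keys p. Poly_Mapping.keys ((\<lambda>(x, y). frag_of (f x, g y)) s))"
    by (rule keys_frag_extend)
  also have "\<dots> \<subseteq> carrier M \<times> carrier N"
    using assms right_linearD(2)[OF f] left_linearD(2)[OF g]
    by (auto simp: tensor_free_def keys_frag_of)
  finally show ?thesis
    by (simp add: tensor_free_def)
qed

lemma ext_hom: "ext \<in> hom X.TF M.TF"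
  using ext_closed by (auto simp: hom_def tensor_free_def frag_extend_add)

text \<open>Since \<open>f\<close> and \<open>g\<close> are linear, each of the three kinds of
  relator goes to a relator of the same kind. This makes \<open>tensor_map\<close> well defined on
  cosets.\<close>

lemma ext_relator:
  assumes "r \<in> tensor_relators A X Y" shows "ext r \<in> tensor_relators A M N"
  using assms
proof (cases rule: tensor_relatorsE)
  case (left x x' y)
  then show ?thesis
    using tensor_relatorsI(1)[of "f x" M "f x'" "g y" N A] right_linearD[OF f] left_linearD[OF g]
    by (simp add: frag_extend_diff)
next
  case (right x y y')
  then show ?thesis
    using tensor_relatorsI(2)[of "f x" M "g y" N "g y'" A] right_linearD[OF f] left_linearD[OF g]
    by (simp add: frag_extend_diff)
next
  case (balanced x a y)
  then show ?thesis
    using tensor_relatorsI(3)[of "f x" M a A "g y" N] right_linearD[OF f] left_linearD[OF g]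
    by (simp add: frag_extend_diff)
qed

lemma ext_subgroup:
  assumes "p \<in> X.TS" shows "ext p \<in> M.TS"
proof (rule hom_generate_subset[OF X.free_group M.free_group ext_hom X.relators_subset M.subgroup_TS])
  show "p \<in> generate X.TF (tensor_relators A X Y)"
    using assms by (simp add: tensor_subgroup_def)
  show "ext r \<in> M.TS" if "r \<in> tensor_relators A X Y" for r
    unfolding tensor_subgroup_def using ext_relator[OF that] by (rule generate.incl)
qed

lemma tensor_map_coset:
  assumes "p \<in> carrier X.TF"
  shows "tensor_map A M N f g (X.TS #>\<^bsub>X.TF\<^esub> p) = M.TS #>\<^bsub>M.TF\<^esub> ext p"
  unfolding tensor_map_def
  by (rule UN_coset_hom[OF X.free_group M.free_group ext_hom X.subgroup_TS M.subgroup_TS ext_subgroup assms])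

lemma tensor_map_tens:
  assumes "x \<in> carrier X" "y \<in> carrier Y"
  shows "tensor_map A M N f g (tensor_class A X Y x y) = tensor_class A M N (f x) (g y)"
  unfolding tensor_class_def using assms by (simp add: tensor_map_coset)

lemma tensor_map_hom: "tensor_map A M N f g \<in> hom X.TP M.TP"
proof (rule homI)
  fix U assume "U \<in> carrier X.TP"
  then show "tensor_map A M N f g U \<in> carrier M.TP"
    by (auto simp: X.carrier_tensor tensor_map_coset ext_closed)
next
  fix U V assume "U \<in> carrier X.TP" "V \<in> carrier X.TP"
  then obtain u v where uv: "u \<in> carrier X.TF" "U = X.TS #>\<^bsub>X.TF\<^esub> u" "v \<in> carrier X.TF" "V = X.TS #>\<^bsub>X.TF\<^esub> v"
    by (auto simp: X.carrier_tensor)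
  have "u + v \<in> carrier X.TF"
    using uv by (auto simp: tensor_free_def dest!: subsetD[OF keys_add])
  then show "tensor_map A M N f g (U \<otimes>\<^bsub>X.TP\<^esub> V) = tensor_map A M N f g U \<otimes>\<^bsub>M.TP\<^esub> tensor_map A M N f g V"
    using uv by (simp add: X.coset_add[symmetric] tensor_map_coset M.coset_add[symmetric] ext_closed frag_extend_add)
qed

end

section \<open>Free right modules\<close>

text \<open>This is the element \<open>e_z a\<close> of the free module. For \<open>z\<close>
  outside \<open>Z\<close> it is the zero function on \<open>Z\<close>, so it lies in the free
  module for every \<open>z\<close>.\<close>

definition single :: "('a, 'z) ring_scheme \<Rightarrow> 'q set \<Rightarrow> 'q \<Rightarrow> 'a \<Rightarrow> 'q \<Rightarrow> 'a" where
  "single A Z z a = (\<lambda>y\<in>Z. if y = z then a else \<zero>\<^bsub>A\<^esub>)"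

locale free_module = Q: right_module A Q
  for A :: "('a, 'z) ring_scheme" and Q :: "('s, 'a, 'q, 'c) bimodule_scheme" +
  fixes Z
  assumes subset: "Z \<subseteq> carrier Q"
begin

abbreviation FM where "FM \<equiv> free_right_module A Q Z"
abbreviation e where "e \<equiv> single A Z"

lemma carrier_free:
  "carrier FM = {f \<in> Z \<rightarrow>\<^sub>E carrier A. finite {y \<in> Z. f y \<noteq> \<zero>\<^bsub>A\<^esub>}}"
  by (simp add: free_right_module_def carrier_sum_group Q.A.a_group)

lemma mult_free: "f \<otimes>\<^bsub>FM\<^esub> g = (\<lambda>y\<in>Z. f y \<oplus>\<^bsub>A\<^esub> g y)"
  by (simp add: free_right_module_def)

lemma one_free: "\<one>\<^bsub>FM\<^esub> = (\<lambda>y\<in>Z. \<zero>\<^bsub>A\<^esub>)"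
  by (simp add: free_right_module_def)

lemma ract_free: "ract FM f a = (\<lambda>y\<in>Z. f y \<otimes>\<^bsub>A\<^esub> a)"
  by (simp add: free_right_module_def)

lemma free_apply [simp]: "\<lbrakk>f \<in> carrier FM; y \<in> Z\<rbrakk> \<Longrightarrow> f y \<in> carrier A"
  by (auto simp: carrier_free)

lemma free_finite: "f \<in> carrier FM \<Longrightarrow> finite {y \<in> Z. f y \<noteq> \<zero>\<^bsub>A\<^esub>}"
  by (simp add: carrier_free)

lemma free_comm_group: "comm_group FM"
  unfolding free_right_module_def
proof (rule comm_group_with_actions, rule group.group_comm_groupI)
  show "group (sum_group Z (\<lambda>_. add_monoid A))"
    by (simp add: Q.A.a_group)
  show "f \<otimes>\<^bsub>sum_group Z (\<lambda>_. add_monoid A)\<^esub> g = g \<otimes>\<^bsub>sum_group Z (\<lambda>_. add_monoid A)\<^esub> f"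
    if "f \<in> carrier (sum_group Z (\<lambda>_. add_monoid A))" "g \<in> carrier (sum_group Z (\<lambda>_. add_monoid A))" for f g
    using that by (auto simp: carrier_sum_group Q.A.a_group PiE_iff Q.A.a_comm intro!: restrict_ext)
qed

lemma ract_free_closed:
  assumes "f \<in> carrier FM" "a \<in> carrier A" shows "ract FM f a \<in> carrier FM"
proof -
  have "{y \<in> Z. ract FM f a y \<noteq> \<zero>\<^bsub>A\<^esub>} \<subseteq> {y \<in> Z. f y \<noteq> \<zero>\<^bsub>A\<^esub>}"
    using assms by (auto simp: ract_free)
  then have "finite {y \<in> Z. ract FM f a y \<noteq> \<zero>\<^bsub>A\<^esub>}"
    using free_finite[OF assms(1)] finite_subset by blast
  moreover have "ract FM f a \<in> Z \<rightarrow>\<^sub>E carrier A"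
    using assms by (simp add: ract_free)
  ultimately show ?thesis
    unfolding carrier_free by blast
qed

lemma free_ext: "f \<in> carrier FM \<Longrightarrow> (\<lambda>y\<in>Z. f y) = f"
  unfolding carrier_free by (auto intro: PiE_restrict)

lemma free_right_module: "right_module A FM"
proof (intro right_module.intro right_module_axioms.intro)
  show "ring A" "comm_group FM"
    by (simp_all add: Q.A.ring_axioms free_comm_group)
next
  fix f a assume "f \<in> carrier FM" "a \<in> carrier A"
  then show "ract FM f a \<in> carrier FM"
    by (rule ract_free_closed)
next
  fix f g a assume "f \<in> carrier FM" "g \<in> carrier FM" "a \<in> carrier A"
  then show "ract FM (f \<otimes>\<^bsub>FM\<^esub> g) a = ract FM f a \<otimes>\<^bsub>FM\<^esub> ract FM g a"
    unfolding ract_free mult_free by (intro restrict_ext) (simp add: Q.A.l_distr)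
next
  fix f a b assume "f \<in> carrier FM" "a \<in> carrier A" "b \<in> carrier A"
  then show "ract FM f (a \<oplus>\<^bsub>A\<^esub> b) = ract FM f a \<otimes>\<^bsub>FM\<^esub> ract FM f b"
    "ract FM f (a \<otimes>\<^bsub>A\<^esub> b) = ract FM (ract FM f a) b"
    unfolding ract_free mult_free by (intro restrict_ext; simp add: Q.A.r_distr Q.A.m_assoc)+
next
  fix f assume f: "f \<in> carrier FM"
  then have "ract FM f \<one>\<^bsub>A\<^esub> = (\<lambda>y\<in>Z. f y)"
    unfolding ract_free by (intro restrict_ext) simp
  then show "ract FM f \<one>\<^bsub>A\<^esub> = f"
    using free_ext f by simp
qed

sublocale FM: right_module A FM
  by (rule free_right_module)

lemma e_closed [simp, intro]: "a \<in> carrier A \<Longrightarrow> e z a \<in> carrier FM"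
  unfolding carrier_free single_def
  by (auto intro: finite_subset[of _ "{z}"])

lemma e_ract: "\<lbrakk>a \<in> carrier A; b \<in> carrier A\<rbrakk> \<Longrightarrow> ract FM (e z a) b = e z (a \<otimes>\<^bsub>A\<^esub> b)"
  by (auto simp: single_def ract_free intro!: restrict_ext)

lemma e_add: "\<lbrakk>a \<in> carrier A; b \<in> carrier A\<rbrakk> \<Longrightarrow> e z (a \<oplus>\<^bsub>A\<^esub> b) = e z a \<otimes>\<^bsub>FM\<^esub> e z b"
  by (auto simp: single_def mult_free intro!: restrict_ext)

lemma free_induct [consumes 1, case_names single mult one]:
  assumes "f \<in> carrier FM"
    and single: "\<And>z a. \<lbrakk>z \<in> Z; a \<in> carrier A\<rbrakk> \<Longrightarrow> P (e z a)"
    and mult: "\<And>f g. \<lbrakk>f \<in> carrier FM; g \<in> carrier FM; P f; P g\<rbrakk> \<Longrightarrow> P (f \<otimes>\<^bsub>FM\<^esub> g)"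
    and one: "P \<one>\<^bsub>FM\<^esub>"
  shows "P f"
proof -
  \<comment> \<open>The induction runs over a finite set containing the support, for all
    \<open>f\<close> at once; erasing the value at one point leaves an element supported in the
    smaller set.\<close>
  have "\<forall>f\<in>carrier FM. {y \<in> Z. f y \<noteq> \<zero>\<^bsub>A\<^esub>} \<subseteq> S \<longrightarrow> P f" if "finite S" for S
    using that
  proof (induction S)
    case empty
    have "f = \<one>\<^bsub>FM\<^esub>" if "f \<in> carrier FM" "{y \<in> Z. f y \<noteq> \<zero>\<^bsub>A\<^esub>} \<subseteq> {}" for f
    proof -
      have "f = (\<lambda>y\<in>Z. f y)"
        using free_ext that by simp
      also have "\<dots> = (\<lambda>y\<in>Z. \<zero>\<^bsub>A\<^esub>)"
        using that by (intro restrict_ext) auto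
      finally show ?thesis
        by (simp add: one_free)
    qed
    then show ?case
      using one by (intro ballI impI) (simp only:)
  next
    case (insert z S)
    show ?case
    proof (intro ballI impI)
      fix f assume f: "f \<in> carrier FM" "{y \<in> Z. f y \<noteq> \<zero>\<^bsub>A\<^esub>} \<subseteq> insert z S"
      show "P f"
      proof (cases "z \<in> Z")
        case False
        then have "{y \<in> Z. f y \<noteq> \<zero>\<^bsub>A\<^esub>} \<subseteq> S"
          using f by auto
        then show ?thesis
          using insert.IH f by blast
      next
        case True
        define g where "g = (\<lambda>y\<in>Z. if y = z then \<zero>\<^bsub>A\<^esub> else f y)"
        have gs: "{y \<in> Z. g y \<noteq> \<zero>\<^bsub>A\<^esub>} \<subseteq> S"
          using f(2) by (auto simp: g_def)
        have g: "g \<in> carrier FM"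
          using f gs finite_subset[OF gs insert.hyps(1)] by (auto simp: carrier_free g_def)
        have "f = (\<lambda>y\<in>Z. f y)"
          using free_ext f by simp
        also have "\<dots> = e z (f z) \<otimes>\<^bsub>FM\<^esub> g"
          unfolding mult_free using f by (intro restrict_ext) (auto simp: single_def g_def)
        finally have "f = e z (f z) \<otimes>\<^bsub>FM\<^esub> g" .
        moreover have "P g"
          using insert.IH g gs by blast
        moreover have "f z \<in> carrier A"
          using f True by simp
        ultimately show ?thesis
          using mult[of "e z (f z)" g] single True g by auto
      qed
    qed
  qed
  from this[OF free_finite[OF assms(1)]] show ?thesis
    using assms(1) by blast
qed

text \<open>Agreement is required on all \<open>e_z a\<close>, not only on the generators, because
  \<open>h\<close> and \<open>h'\<close> are merely additive. In this form the lemma proves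
  linearity itself, by comparing the action of \<open>A\<close> before and after a
  homomorphism.\<close>

lemma free_hom_eqI:
  assumes "group G" "h \<in> hom FM G" "h' \<in> hom FM G"
    and "\<And>z a. \<lbrakk>z \<in> Z; a \<in> carrier A\<rbrakk> \<Longrightarrow> h (e z a) = h' (e z a)" "f \<in> carrier FM"
  shows "h f = h' f"
  using assms(5)
proof (induction f rule: free_induct)
  case (single z a)
  then show ?case using assms(4) by simp
next
  case (mult f g)
  then show ?case using assms(2,3) by (simp add: hom_mult)
next
  case one
  show ?case using hom_one[of _ FM G] assms(1-3) FM.M.is_group by metis
qed

text \<open>The linear map determined by sending \<open>e_z\<close> to \<open>s z\<close>. As
  \<open>Z\<close> may be infinite, \<open>gfinprod\<close> is used: it multiplies only over the
  indices with a nontrivial factor.\<close>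

definition free_extend :: "('t, 'a, 'w, 'd) bimodule_scheme \<Rightarrow> ('q \<Rightarrow> 'w) \<Rightarrow> ('q \<Rightarrow> 'a) \<Rightarrow> 'w" where
  "free_extend W s f = gfinprod W (\<lambda>z. ract W (s z) (f z)) Z"

context
  fixes W :: "('t, 'a, 'w, 'd) bimodule_scheme" and s
  assumes W: "right_module A W" and s: "\<And>z. z \<in> Z \<Longrightarrow> s z \<in> carrier W"
begin

interpretation W: right_module A W by (rule W)

lemma free_extend_hom: "free_extend W s \<in> hom FM W"
proof -
  have "(\<lambda>x. gfinprod W (\<lambda>i. ract W (s i) (x i)) Z) \<in> hom (sum_group Z (\<lambda>_. add_monoid A)) W"
    by (rule W.M.hom_group_sum) (auto simp: W.act_add_hom s Q.A.a_group)
  then show ?thesis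
    by (simp add: free_extend_def[abs_def] free_right_module_def)
qed

lemma free_extend_e: "\<lbrakk>z \<in> Z; a \<in> carrier A\<rbrakk> \<Longrightarrow> free_extend W s (e z a) = ract W (s z) a"
proof -
  assume z: "z \<in> Z" "a \<in> carrier A"
  have "free_extend W s (e z a) = gfinprod W (\<lambda>y. ract W (s y) (e z a y)) {z}"
    unfolding free_extend_def
    by (rule W.M.gfinprod_mono_neutral_cong_right) (use z s in \<open>auto simp: single_def\<close>)
  also have "\<dots> = ract W (s z) a"
    using z s by (simp add: W.M.finprod_singleton single_def)
  finally show ?thesis .
qed

lemma free_extend_linear: "right_linear A FM W (free_extend W s)"
  unfolding right_linear_def
proof (intro conjI ballI free_extend_hom)
  fix f a assume f: "f \<in> carrier FM" and a: "a \<in> carrier A"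
  have "(\<lambda>f. free_extend W s (ract FM f a)) \<in> hom FM W"
    using hom_compose[OF FM.act_hom[OF a] free_extend_hom] by (simp add: comp_def)
  moreover have "(\<lambda>f. ract W (free_extend W s f) a) \<in> hom FM W"
    using hom_compose[OF free_extend_hom W.act_hom[OF a]] by (simp add: comp_def)
  ultimately show "free_extend W s (ract FM f a) = ract W (free_extend W s f) a"
    by (rule free_hom_eqI[OF W.M.is_group _ _ _ f]) (use a s in \<open>auto simp: e_ract free_extend_e W.act_assoc\<close>)
qed

end

lemma free_eval_extend: "free_eval Q Z = free_extend Q id"
  by (simp add: free_eval_def[abs_def] free_extend_def[abs_def])

lemma free_eval_linear: "right_linear A FM Q (free_eval Q Z)"
  unfolding free_eval_extend by (rule free_extend_linear[OF Q.right_module_axioms]) (use subset in auto)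

lemma free_eval_e: "\<lbrakk>z \<in> Z; a \<in> carrier A\<rbrakk> \<Longrightarrow> free_eval Q Z (e z a) = ract Q z a"
  unfolding free_eval_extend using free_extend_e[OF Q.right_module_axioms, of id] subset by auto

lemma free_eval_e_one: "z \<in> Z \<Longrightarrow> free_eval Q Z (e z \<one>\<^bsub>A\<^esub>) = z"
  using subset by (auto simp: free_eval_e)

section \<open>The functorial left action of one scalar on a free module\<close>

context
  fixes t
  assumes t: "right_linear A Q Q (lact Q t)" and tZ: "\<And>z. z \<in> Z \<Longrightarrow> lact Q t z \<in> Z"
begin

lemma lact_free_apply:
  "y \<in> Z \<Longrightarrow> lact FM t f y = gfinprod (add_monoid A) f {x \<in> Z. lact Q t x = y}"
  by (simp add: free_right_module_def)

lemma lact_free_closed: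
  assumes f: "f \<in> carrier FM" shows "lact FM t f \<in> carrier FM"
proof -
  \<comment> \<open>The value at \<open>y\<close> is the sum of \<open>f\<close> over the fibre
    above \<open>y\<close>. It is zero when the support misses this fibre, so the new support lies
    in the image of the old one and is finite.\<close>
  have "y \<in> lact Q t ` {x \<in> Z. f x \<noteq> \<zero>\<^bsub>A\<^esub>}" if "y \<in> Z" "lact FM t f y \<noteq> \<zero>\<^bsub>A\<^esub>" for y
  proof (rule ccontr)
    assume n: "y \<notin> lact Q t ` {x \<in> Z. f x \<noteq> \<zero>\<^bsub>A\<^esub>}"
    have "gfinprod (add_monoid A) f {x \<in> Z. lact Q t x = y} = gfinprod (add_monoid A) f {}"
      by (rule comm_monoid.gfinprod_mono_neutral_cong_right[OF Q.A.a_comm_monoid]) (use n f in auto)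
    then show False
      using that by (simp add: lact_free_apply gfinprod_def comm_monoid.finprod_empty[OF Q.A.a_comm_monoid])
  qed
  then have "{y \<in> Z. lact FM t f y \<noteq> \<zero>\<^bsub>A\<^esub>} \<subseteq> lact Q t ` {x \<in> Z. f x \<noteq> \<zero>\<^bsub>A\<^esub>}"
    by blast
  then have "finite {y \<in> Z. lact FM t f y \<noteq> \<zero>\<^bsub>A\<^esub>}"
    using free_finite[OF f] finite_surj by blast
  moreover have "lact FM t f y \<in> carrier A" if "y \<in> Z" for y
    using comm_monoid.gfinprod_closed[OF Q.A.a_comm_monoid, of f "{x \<in> Z. lact Q t x = y}"] that f
    by (auto simp: lact_free_apply)
  moreover have "lact FM t f \<in> extensional Z"
    by (simp add: free_right_module_def)
  ultimately show ?thesis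
    unfolding carrier_free PiE_iff by (intro CollectI conjI ballI)
qed

lemma lact_free_hom: "lact FM t \<in> hom FM FM"
proof (rule homI)
  fix f g assume fg: "f \<in> carrier FM" "g \<in> carrier FM"
  have "lact FM t (f \<otimes>\<^bsub>FM\<^esub> g) = (\<lambda>y\<in>Z. lact FM t (f \<otimes>\<^bsub>FM\<^esub> g) y)"
    using free_ext lact_free_closed FM.M.m_closed fg by metis
  also have "\<dots> = (\<lambda>y\<in>Z. lact FM t f y \<oplus>\<^bsub>A\<^esub> lact FM t g y)"
  proof (rule restrict_ext)
    fix y assume y: "y \<in> Z"
    let ?S = "{x \<in> Z. lact Q t x = y}"
    \<comment> \<open>Fibres may be infinite; additivity of the fibre sum rests on the finite
      supports.\<close>
    have fin: "finite {x \<in> ?S. h x \<noteq> \<one>\<^bsub>add_monoid A\<^esub>}" if "h \<in> carrier FM" for h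
      using free_finite[OF that] by (rule rev_finite_subset) auto
    have "gfinprod (add_monoid A) (f \<otimes>\<^bsub>FM\<^esub> g) ?S = gfinprod (add_monoid A) (\<lambda>x. f x \<otimes>\<^bsub>add_monoid A\<^esub> g x) ?S"
      by (rule comm_monoid.gfinprod_cong[OF Q.A.a_comm_monoid])
         (use fg in \<open>auto simp: mult_free simp_implies_def\<close>)
    also have "\<dots> = gfinprod (add_monoid A) f ?S \<otimes>\<^bsub>add_monoid A\<^esub> gfinprod (add_monoid A) g ?S"
      by (rule comm_monoid.gfinprod_distrib[OF Q.A.a_comm_monoid fin fin]) (use fg in auto)
    finally show "lact FM t (f \<otimes>\<^bsub>FM\<^esub> g) y = lact FM t f y \<oplus>\<^bsub>A\<^esub> lact FM t g y"
      using y by (simp add: lact_free_apply)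
  qed
  finally show "lact FM t (f \<otimes>\<^bsub>FM\<^esub> g) = lact FM t f \<otimes>\<^bsub>FM\<^esub> lact FM t g"
    by (simp add: mult_free)
qed (rule lact_free_closed)

lemma lact_free_e:
  assumes z: "z \<in> Z" "a \<in> carrier A" shows "lact FM t (e z a) = e (lact Q t z) a"
proof -
  have "lact FM t (e z a) = (\<lambda>y\<in>Z. lact FM t (e z a) y)"
    using free_ext lact_free_closed assms by simp
  also have "\<dots> = (\<lambda>y\<in>Z. if y = lact Q t z then a else \<zero>\<^bsub>A\<^esub>)"
  proof (rule restrict_ext)
    fix y assume y: "y \<in> Z"
    let ?S = "{x \<in> Z. lact Q t x = y}"
    \<comment> \<open>Within the fibre above \<open>y\<close> only \<open>z\<close> can contribute,
      and it lies there exactly when \<open>y = lact Q t z\<close>.\<close>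
    have "gfinprod (add_monoid A) (e z a) ?S = gfinprod (add_monoid A) (e z a) (if y = lact Q t z then {z} else {})"
      by (rule comm_monoid.gfinprod_mono_neutral_cong_right[OF Q.A.a_comm_monoid])
         (use assms in \<open>auto simp: single_def\<close>)
    then show "lact FM t (e z a) y = (if y = lact Q t z then a else \<zero>\<^bsub>A\<^esub>)"
      using y assms
      by (simp add: lact_free_apply comm_monoid.gfinprod_eq_finprod[OF Q.A.a_comm_monoid]
          comm_monoid.finprod_singleton[OF Q.A.a_comm_monoid] comm_monoid.finprod_empty[OF Q.A.a_comm_monoid] Pi_def)
         (simp add: single_def)
  qed
  finally show ?thesis
    by (simp add: single_def)
qed

lemma lact_free_linear: "right_linear A FM FM (lact FM t)"
  unfolding right_linear_def
proof (intro conjI ballI lact_free_hom)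
  fix f a assume f: "f \<in> carrier FM" and a: "a \<in> carrier A"
  have "(\<lambda>f. lact FM t (ract FM f a)) \<in> hom FM FM"
    using hom_compose[OF FM.act_hom[OF a] lact_free_hom] by (simp add: comp_def)
  moreover have "(\<lambda>f. ract FM (lact FM t f) a) \<in> hom FM FM"
    using hom_compose[OF lact_free_hom FM.act_hom[OF a]] by (simp add: comp_def)
  ultimately show "lact FM t (ract FM f a) = ract FM (lact FM t f) a"
    by (rule free_hom_eqI[OF FM.M.is_group _ _ _ f]) (use a in \<open>auto simp: e_ract lact_free_e\<close>)
qed

text \<open>Equivariance makes the action preserve the kernel of the evaluation, which is the
  generating set of the next free module. In this way the action climbs the resolution stage by
  stage.\<close>

lemma free_eval_lact:
  assumes f: "f \<in> carrier FM"
  shows "free_eval Q Z (lact FM t f) = lact Q t (free_eval Q Z f)"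
proof -
  have "(\<lambda>f. free_eval Q Z (lact FM t f)) \<in> hom FM Q"
    using hom_compose[OF lact_free_hom right_linearD(1)[OF free_eval_linear]] by (simp add: comp_def)
  moreover have "(\<lambda>f. lact Q t (free_eval Q Z f)) \<in> hom FM Q"
    using hom_compose[OF right_linearD(1)[OF free_eval_linear] right_linearD(1)[OF t]] by (simp add: comp_def)
  ultimately show ?thesis
    by (rule free_hom_eqI[OF Q.M.is_group _ _ _ f])
       (use right_linearD(4)[OF t] subset tZ in \<open>auto simp: lact_free_e free_eval_e\<close>)
qed

end

end

section \<open>The conormal bimodule of a ring surjection\<close>

lemma restrict_right_simps [simp]:
  "carrier (restrict_right R q) = carrier R"
  "mult (restrict_right R q) = add R"
  "one (restrict_right R q) = zero R"
  "lact (restrict_right R q) = mult R"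
  "ract (restrict_right R q) x a = x \<otimes>\<^bsub>R\<^esub> q a"
  by (simp_all add: restrict_right_def)

lemma restrict_left_simps [simp]:
  "carrier (restrict_left R q) = carrier R"
  "mult (restrict_left R q) = add R"
  "one (restrict_left R q) = zero R"
  "lact (restrict_left R q) a x = q a \<otimes>\<^bsub>R\<^esub> x"
  "ract (restrict_left R q) = mult R"
  by (simp_all add: restrict_left_def)

lemma regular_bimodule_simps [simp]:
  "carrier (regular_bimodule A) = carrier A"
  "mult (regular_bimodule A) = add A"
  "one (regular_bimodule A) = zero A"
  "lact (regular_bimodule A) = mult A"
  "ract (regular_bimodule A) = mult A"
  by (simp_all add: regular_bimodule_def)

text \<open>The axioms for \<open>Tor1\<close> cannot be read off from the chain level, where the
  left action is not additive in the scalar. So \<open>N\<close> starts as a commutative group with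
  two operations; since \<open>\<phi>\<close> is onto and intertwines them, each axiom comes from
  the one for \<open>M\<close>.\<close>

lemma bimodule_transport:
  assumes M: "bimodule R S M" and N: "comm_group N" and iso: "\<phi> \<in> iso M N"
    and l: "\<And>r x. \<lbrakk>r \<in> carrier R; x \<in> carrier M\<rbrakk> \<Longrightarrow> \<phi> (lact M r x) = lact N r (\<phi> x)"
    and r: "\<And>s x. \<lbrakk>s \<in> carrier S; x \<in> carrier M\<rbrakk> \<Longrightarrow> \<phi> (ract M x s) = ract N (\<phi> x) s"
  shows "bimodule R S N"
proof -
  interpret M: bimodule R S M by fact
  have onto: "\<exists>x\<in>carrier M. y = \<phi> x" if "y \<in> carrier N" for y
    using that iso by (auto simp: iso_def bij_betw_def)
  have closed: "\<And>x. x \<in> carrier M \<Longrightarrow> \<phi> x \<in> carrier N"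
    and mult: "\<And>x y. \<lbrakk>x \<in> carrier M; y \<in> carrier M\<rbrakk> \<Longrightarrow> \<phi> x \<otimes>\<^bsub>N\<^esub> \<phi> y = \<phi> (x \<otimes>\<^bsub>M\<^esub> y)"
    using iso by (auto simp: iso_def hom_def)
  show ?thesis
  proof (intro bimodule.intro bimodule_axioms.intro N M.L.ring_axioms M.R.ring_axioms)
    fix r r' y y' assume r: "r \<in> carrier R" "r' \<in> carrier R" and y: "y \<in> carrier N" "y' \<in> carrier N"
    obtain x x' where x: "x \<in> carrier M" "y = \<phi> x" "x' \<in> carrier M" "y' = \<phi> x'"
      using onto y by blast
    show "lact N r y \<in> carrier N"
      using r x by (simp add: l[symmetric] closed M.lact_closed)
    show "lact N r (y \<otimes>\<^bsub>N\<^esub> y') = lact N r y \<otimes>\<^bsub>N\<^esub> lact N r y'"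
      using r x by (simp add: l[symmetric] mult M.lact_closed M.lact_add_right)
    show "lact N (r \<oplus>\<^bsub>R\<^esub> r') y = lact N r y \<otimes>\<^bsub>N\<^esub> lact N r' y"
      using r x by (simp add: l[symmetric] mult M.lact_closed M.lact_add_left)
    show "lact N (r \<otimes>\<^bsub>R\<^esub> r') y = lact N r (lact N r' y)"
      using r x by (simp add: l[symmetric] M.lact_closed M.lact_assoc)
  next
    fix s s' y y' assume s: "s \<in> carrier S" "s' \<in> carrier S" and y: "y \<in> carrier N" "y' \<in> carrier N"
    obtain x x' where x: "x \<in> carrier M" "y = \<phi> x" "x' \<in> carrier M" "y' = \<phi> x'"
      using onto y by blast
    show "ract N y s \<in> carrier N"
      using s x by (simp add: r[symmetric] closed M.ract_closed)
    show "ract N (y \<otimes>\<^bsub>N\<^esub> y') s = ract N y s \<otimes>\<^bsub>N\<^esub> ract N y' s"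
      using s x by (simp add: r[symmetric] mult M.ract_closed M.ract_add_left)
    show "ract N y (s \<oplus>\<^bsub>S\<^esub> s') = ract N y s \<otimes>\<^bsub>N\<^esub> ract N y s'"
      using s x by (simp add: r[symmetric] mult M.ract_closed M.ract_add_right)
    show "ract N y (s \<otimes>\<^bsub>S\<^esub> s') = ract N (ract N y s) s'"
      using s x by (simp add: r[symmetric] M.ract_closed M.ract_assoc)
  next
    fix y assume "y \<in> carrier N"
    then obtain x where x: "x \<in> carrier M" "y = \<phi> x"
      using onto by blast
    show "lact N \<one>\<^bsub>R\<^esub> y = y" "ract N y \<one>\<^bsub>S\<^esub> = y"
      using x by (simp_all add: l[symmetric] r[symmetric] M.lact_one M.ract_one)
  next
    fix r y s assume rs: "r \<in> carrier R" "s \<in> carrier S" and y: "y \<in> carrier N"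
    obtain x where x: "x \<in> carrier M" "y = \<phi> x"
      using onto y by blast
    show "ract N (lact N r y) s = lact N r (ract N y s)"
      using rs x by (simp add: l[symmetric] r[symmetric] M.lact_closed M.ract_closed M.lact_ract)
  qed
qed

locale ring_surjection = A: ring A + R: ring R
  for A :: "('a, 'm) ring_scheme" and R :: "('r, 'n) ring_scheme" +
  fixes q
  assumes hom: "q \<in> ring_hom A R" and surj: "q ` carrier A = carrier R"
begin

sublocale q: ring_hom_ring A R q
  by unfold_locales (rule hom)

abbreviation K where "K \<equiv> a_kernel A R q"
abbreviation K2 where "K2 \<equiv> ideal_prod A K K"
abbreviation RM where "RM \<equiv> restrict_right R q"
abbreviation RN where "RN \<equiv> restrict_left R q"
abbreviation RA where "RA \<equiv> regular_bimodule A"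
abbreviation KM where "KM \<equiv> RA\<lparr>carrier := K\<rparr>"

lemma K_iff: "k \<in> K \<longleftrightarrow> k \<in> carrier A \<and> q k = \<zero>\<^bsub>R\<^esub>"
  unfolding a_kernel_def' by simp

lemma ideal_K: "ideal K A"
  by (rule q.kernel_is_ideal)

sublocale K: ideal K A
  by (rule ideal_K)

lemma ideal_K2: "ideal K2 A"
  by (rule A.ideal_prod_is_ideal[OF ideal_K ideal_K])

sublocale K2: ideal K2 A
  by (rule ideal_K2)

lemma K2_subset: "K2 \<subseteq> K"
  using A.ideal_prod_inter[OF ideal_K ideal_K] by blast

lemma lift_exists: "r \<in> carrier R \<Longrightarrow> \<exists>a\<in>carrier A. q a = r"
  using surj by (metis imageE)

lemma diff_in_K:
  assumes "a \<in> carrier A" "b \<in> carrier A" "q a = q b" shows "a \<ominus>\<^bsub>A\<^esub> b \<in> K"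
  using assms by (simp add: K_iff a_minus_def R.r_neg)

lemma K2_coset_eqI:
  assumes "a \<in> carrier A" "b \<in> carrier A" "a \<ominus>\<^bsub>A\<^esub> b \<in> K2" shows "K2 +>\<^bsub>A\<^esub> a = K2 +>\<^bsub>A\<^esub> b"
  using assms A.add.r_coset_eq_iff[OF K2.a_subgroup] by (simp add: a_r_coset_def a_minus_def a_inv_def)

text \<open>The two products differ by \<open>k (a - b)\<close> with both factors in
  \<open>K\<close>. Hence, modulo \<open>K2\<close>, multiplication by an element of
  \<open>K\<close> does not see which lift of an element of \<open>R\<close> was chosen.\<close>

lemma K2_coset_mult_right:
  assumes "k \<in> K" "a \<in> carrier A" "b \<in> carrier A" "q a = q b"
  shows "K2 +>\<^bsub>A\<^esub> (k \<otimes>\<^bsub>A\<^esub> a) = K2 +>\<^bsub>A\<^esub> (k \<otimes>\<^bsub>A\<^esub> b)"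
proof (rule K2_coset_eqI)
  have "k \<otimes>\<^bsub>A\<^esub> a \<ominus>\<^bsub>A\<^esub> k \<otimes>\<^bsub>A\<^esub> b = k \<otimes>\<^bsub>A\<^esub> (a \<ominus>\<^bsub>A\<^esub> b)"
    using assms by (simp add: a_minus_def A.r_distr A.r_minus)
  then show "k \<otimes>\<^bsub>A\<^esub> a \<ominus>\<^bsub>A\<^esub> k \<otimes>\<^bsub>A\<^esub> b \<in> K2"
    using assms diff_in_K by (simp add: ideal_prod.prod)
qed (use assms in auto)

lemma K2_coset_mult_left:
  assumes "k \<in> K" "a \<in> carrier A" "b \<in> carrier A" "q a = q b"
  shows "K2 +>\<^bsub>A\<^esub> (a \<otimes>\<^bsub>A\<^esub> k) = K2 +>\<^bsub>A\<^esub> (b \<otimes>\<^bsub>A\<^esub> k)"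
proof (rule K2_coset_eqI)
  have "a \<otimes>\<^bsub>A\<^esub> k \<ominus>\<^bsub>A\<^esub> b \<otimes>\<^bsub>A\<^esub> k = (a \<ominus>\<^bsub>A\<^esub> b) \<otimes>\<^bsub>A\<^esub> k"
    using assms by (simp add: a_minus_def A.l_distr A.l_minus)
  then show "a \<otimes>\<^bsub>A\<^esub> k \<ominus>\<^bsub>A\<^esub> b \<otimes>\<^bsub>A\<^esub> k \<in> K2"
    using assms diff_in_K by (simp add: ideal_prod.prod)
qed (use assms in auto)

abbreviation KG where "KG \<equiv> (add_monoid A)\<lparr>carrier := K\<rparr>"

lemma comm_group_KG: "comm_group KG"
proof (rule group.group_comm_groupI)
  show "group KG"
    using group.subgroup_imp_group[OF A.a_group K.a_subgroup] .
qed (simp add: A.a_comm)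

lemma subgroup_K2_KG: "subgroup K2 KG"
  using group.subgroup_incl[OF A.a_group K2.a_subgroup K.a_subgroup] K2_subset by simp

abbreviation CN where "CN \<equiv> conormal_bimodule A R q"

lemma carrier_conormal: "carrier CN = (\<lambda>k. K2 +>\<^bsub>A\<^esub> k) ` K"
  unfolding conormal_bimodule_def Let_def with_actions_simps FactGroup_def RCOSETS_def a_r_coset_def
  by (auto simp: r_coset_def)

lemma mult_conormal:
  "\<lbrakk>k \<in> K; l \<in> K\<rbrakk> \<Longrightarrow> (K2 +>\<^bsub>A\<^esub> k) \<otimes>\<^bsub>CN\<^esub> (K2 +>\<^bsub>A\<^esub> l) = K2 +>\<^bsub>A\<^esub> (k \<oplus>\<^bsub>A\<^esub> l)"
  using K2.a_rcos_sum[of k l]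
  by (simp add: conormal_bimodule_def Let_def FactGroup_def set_add_def set_mult_def)

text \<open>The definition takes a union over the lifts \<open>b\<close> of \<open>q a\<close> and
  the representatives \<open>l\<close> of the coset. Replacing \<open>l\<close> by \<open>k\<close>
  changes the product by \<open>b c\<close> with \<open>c \<in> K2\<close>; replacing
  \<open>b\<close> by \<open>a\<close> changes it by an element of \<open>K2\<close> because
  \<open>k \<in> K\<close>.\<close>

lemma lact_conormal:
  assumes "a \<in> carrier A" "k \<in> K"
  shows "lact CN (q a) (K2 +>\<^bsub>A\<^esub> k) = K2 +>\<^bsub>A\<^esub> (a \<otimes>\<^bsub>A\<^esub> k)"
proof -
  have "(\<Union>l\<in>K2 +>\<^bsub>A\<^esub> k. K2 +>\<^bsub>A\<^esub> (b \<otimes>\<^bsub>A\<^esub> l)) = K2 +>\<^bsub>A\<^esub> (a \<otimes>\<^bsub>A\<^esub> k)"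
    if b: "b \<in> carrier A" "q b = q a" for b
  proof (rule UN_const)
    show "k \<in> K2 +>\<^bsub>A\<^esub> k"
      by (rule K2.a_rcos_self) (use assms in simp)
    fix l assume l: "l \<in> K2 +>\<^bsub>A\<^esub> k"
    then obtain c where c: "c \<in> K2" "l = c \<oplus>\<^bsub>A\<^esub> k"
      by (auto simp: a_r_coset_def r_coset_def)
    have "K2 +>\<^bsub>A\<^esub> (b \<otimes>\<^bsub>A\<^esub> l) = K2 +>\<^bsub>A\<^esub> (b \<otimes>\<^bsub>A\<^esub> k)"
    proof (rule K2_coset_eqI)
      have "b \<otimes>\<^bsub>A\<^esub> l \<ominus>\<^bsub>A\<^esub> b \<otimes>\<^bsub>A\<^esub> k = b \<otimes>\<^bsub>A\<^esub> c"
        using b c assms K2.a_Hcarr by (simp add: A.r_distr a_minus_def A.a_assoc A.r_neg)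
      then show "b \<otimes>\<^bsub>A\<^esub> l \<ominus>\<^bsub>A\<^esub> b \<otimes>\<^bsub>A\<^esub> k \<in> K2"
        using b c K2.I_l_closed by simp
    qed (use b c assms in auto)
    also have "\<dots> = K2 +>\<^bsub>A\<^esub> (a \<otimes>\<^bsub>A\<^esub> k)"
      by (rule K2_coset_mult_left) (use b assms in simp_all)
    finally show "K2 +>\<^bsub>A\<^esub> (b \<otimes>\<^bsub>A\<^esub> l) = K2 +>\<^bsub>A\<^esub> (a \<otimes>\<^bsub>A\<^esub> k)" .
  qed
  note lift = this
  show ?thesis
    unfolding conormal_bimodule_def Let_def with_actions_simps
    by (rule UN_const[of a]) (use assms lift in simp_all)
qed

lemma ract_conormal:
  assumes "a \<in> carrier A" "k \<in> K"
  shows "ract CN (K2 +>\<^bsub>A\<^esub> k) (q a) = K2 +>\<^bsub>A\<^esub> (k \<otimes>\<^bsub>A\<^esub> a)"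
proof -
  have "(\<Union>l\<in>K2 +>\<^bsub>A\<^esub> k. K2 +>\<^bsub>A\<^esub> (l \<otimes>\<^bsub>A\<^esub> b)) = K2 +>\<^bsub>A\<^esub> (k \<otimes>\<^bsub>A\<^esub> a)"
    if b: "b \<in> carrier A" "q b = q a" for b
  proof (rule UN_const)
    show "k \<in> K2 +>\<^bsub>A\<^esub> k"
      by (rule K2.a_rcos_self) (use assms in simp)
    fix l assume l: "l \<in> K2 +>\<^bsub>A\<^esub> k"
    then obtain c where c: "c \<in> K2" "l = c \<oplus>\<^bsub>A\<^esub> k"
      by (auto simp: a_r_coset_def r_coset_def)
    have "K2 +>\<^bsub>A\<^esub> (l \<otimes>\<^bsub>A\<^esub> b) = K2 +>\<^bsub>A\<^esub> (k \<otimes>\<^bsub>A\<^esub> b)"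
    proof (rule K2_coset_eqI)
      have "l \<otimes>\<^bsub>A\<^esub> b \<ominus>\<^bsub>A\<^esub> k \<otimes>\<^bsub>A\<^esub> b = c \<otimes>\<^bsub>A\<^esub> b"
        using b c assms K2.a_Hcarr by (simp add: A.l_distr a_minus_def A.a_assoc A.r_neg)
      then show "l \<otimes>\<^bsub>A\<^esub> b \<ominus>\<^bsub>A\<^esub> k \<otimes>\<^bsub>A\<^esub> b \<in> K2"
        using b c K2.I_r_closed by simp
    qed (use b c assms in auto)
    also have "\<dots> = K2 +>\<^bsub>A\<^esub> (k \<otimes>\<^bsub>A\<^esub> a)"
      by (rule K2_coset_mult_right) (use b assms in simp_all)
    finally show "K2 +>\<^bsub>A\<^esub> (l \<otimes>\<^bsub>A\<^esub> b) = K2 +>\<^bsub>A\<^esub> (k \<otimes>\<^bsub>A\<^esub> a)" .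
  qed
  note lift = this
  show ?thesis
    unfolding conormal_bimodule_def Let_def with_actions_simps
    by (rule UN_const[of a]) (use assms lift in simp_all)
qed

lemma bimodule_conormal: "bimodule R R CN"
proof -
  have CG: "comm_group CN"
    unfolding conormal_bimodule_def Let_def
    by (rule comm_group_with_actions, rule comm_group.abelian_FactGroup[OF comm_group_KG subgroup_K2_KG])
  have ex: "\<exists>k\<in>K. X = K2 +>\<^bsub>A\<^esub> k" if "X \<in> carrier CN" for X
    using that by (simp add: carrier_conormal image_iff)
  have exl: "\<exists>a\<in>carrier A. r = q a" if "r \<in> carrier R" for r
    using lift_exists[OF that] by metis
  have closed: "K2 +>\<^bsub>A\<^esub> k \<in> carrier CN" if "k \<in> K" for k
    using that by (simp add: carrier_conormal)
  \<comment> \<open>Scalars of \<open>R\<close> are written as \<open>q\<close> of a lift. Their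
    sums and products are folded back into this form so that the action rules apply, and the
    opposite simplification rules are switched off.\<close>
  have q_simps: "q a \<oplus>\<^bsub>R\<^esub> q b = q (a \<oplus>\<^bsub>A\<^esub> b)" "q a \<otimes>\<^bsub>R\<^esub> q b = q (a \<otimes>\<^bsub>A\<^esub> b)"
    if "a \<in> carrier A" "b \<in> carrier A" for a b
    using that by simp_all
  note facts = lact_conormal ract_conormal mult_conormal closed K.I_l_closed K.I_r_closed
    A.l_distr A.r_distr A.m_assoc K.a_closed K.a_Hcarr
  note [simp del] = q.hom_add q.hom_mult q.hom_one
  show ?thesis
  proof (intro bimodule.intro bimodule_axioms.intro CG R.ring_axioms)
    fix r s X Y assume r: "r \<in> carrier R" and s: "s \<in> carrier R" and X: "X \<in> carrier CN" and Y: "Y \<in> carrier CN"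
    obtain a b k l where *: "a \<in> carrier A" "r = q a" "b \<in> carrier A" "s = q b"
      "k \<in> K" "X = K2 +>\<^bsub>A\<^esub> k" "l \<in> K" "Y = K2 +>\<^bsub>A\<^esub> l"
      using ex[OF X] ex[OF Y] exl[OF r] exl[OF s] by blast
    show "lact CN r X \<in> carrier CN" "ract CN X r \<in> carrier CN"
      "lact CN r (X \<otimes>\<^bsub>CN\<^esub> Y) = lact CN r X \<otimes>\<^bsub>CN\<^esub> lact CN r Y"
      "ract CN (X \<otimes>\<^bsub>CN\<^esub> Y) r = ract CN X r \<otimes>\<^bsub>CN\<^esub> ract CN Y r"
      "lact CN (r \<oplus>\<^bsub>R\<^esub> s) X = lact CN r X \<otimes>\<^bsub>CN\<^esub> lact CN s X"
      "ract CN X (r \<oplus>\<^bsub>R\<^esub> s) = ract CN X r \<otimes>\<^bsub>CN\<^esub> ract CN X s"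
      "lact CN (r \<otimes>\<^bsub>R\<^esub> s) X = lact CN r (lact CN s X)"
      "ract CN X (r \<otimes>\<^bsub>R\<^esub> s) = ract CN (ract CN X r) s"
      "ract CN (lact CN r X) s = lact CN r (ract CN X s)"
      unfolding * using *(1,3,5,7) by (simp_all add: facts q_simps)
  next
    fix X assume "X \<in> carrier CN"
    then obtain k where *: "k \<in> K" "X = K2 +>\<^bsub>A\<^esub> k"
      using ex by blast
    have "lact CN (q \<one>\<^bsub>A\<^esub>) X = X" "ract CN X (q \<one>\<^bsub>A\<^esub>) = X"
      unfolding * using *(1) by (simp_all add: facts)
    then show "lact CN \<one>\<^bsub>R\<^esub> X = X" "ract CN X \<one>\<^bsub>R\<^esub> = X"
      by (simp_all only: q.hom_one)
  qed
qed

end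

section \<open>The isomorphism with Tor\<close>

lemma kernel_iff: "x \<in> kernel G H h \<longleftrightarrow> x \<in> carrier G \<and> h x = \<one>\<^bsub>H\<^esub>"
  by (simp add: kernel_def)

context ring_surjection
begin

lemma inv_RM [simp]: "inv\<^bsub>RM\<^esub> x = \<ominus>\<^bsub>R\<^esub> x"
  by (simp add: a_inv_def m_inv_def)

lemma right_module_RM: "right_module A RM"
proof (intro right_module.intro right_module_axioms.intro A.ring_axioms)
  show "comm_group RM"
    unfolding restrict_right_def by (rule comm_group_with_actions[OF R.a_comm_group])
qed (simp_all add: R.l_distr R.r_distr R.m_assoc)

lemma left_module_RN: "left_module A RN"
proof (intro left_module.intro left_module_axioms.intro A.ring_axioms)
  show "comm_group RN"
    unfolding restrict_left_def by (rule comm_group_with_actions[OF R.a_comm_group])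
qed (simp_all add: R.l_distr R.r_distr R.m_assoc)

lemma right_module_RA: "right_module A RA"
proof (intro right_module.intro right_module_axioms.intro A.ring_axioms)
  show "comm_group RA"
    unfolding regular_bimodule_def by (rule comm_group_with_actions[OF A.a_comm_group])
qed (simp_all add: A.l_distr A.r_distr A.m_assoc)

lemma right_module_KM: "right_module A KM"
proof (intro right_module.intro right_module_axioms.intro A.ring_axioms)
  show "comm_group KM"
  proof (rule comm_groupI)
    fix x assume x: "x \<in> carrier KM"
    show "\<exists>y\<in>carrier KM. y \<otimes>\<^bsub>KM\<^esub> x = \<one>\<^bsub>KM\<^esub>"
      by (rule bexI[of _ "\<ominus>\<^bsub>A\<^esub> x"]) (use x in \<open>simp_all add: A.l_neg\<close>)
  qed (auto intro: A.a_assoc A.a_comm)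
qed (simp_all add: A.l_distr A.r_distr A.m_assoc K.I_r_closed)

sublocale RM: right_module A RM by (rule right_module_RM)
sublocale RN: left_module A RN by (rule left_module_RN)
sublocale RA: right_module A RA by (rule right_module_RA)
sublocale KM: right_module A KM by (rule right_module_KM)

section \<open>The resolution of \<open>R\<close> by free right \<open>A\<close>-modules\<close>

abbreviation P0 where "P0 \<equiv> free_right_module A RM (carrier R)"
abbreviation d0 where "d0 \<equiv> free_eval RM (carrier R)"
abbreviation Z0 where "Z0 \<equiv> kernel P0 RM d0"
abbreviation P1 where "P1 \<equiv> free_right_module A P0 Z0"
abbreviation d1 where "d1 \<equiv> free_eval P0 Z0"
abbreviation Z1 where "Z1 \<equiv> kernel P1 P0 d1"
abbreviation P2 where "P2 \<equiv> free_right_module A P1 Z1"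
abbreviation d2 where "d2 \<equiv> free_eval P1 Z1"

lemma resolution_simps:
  "res0 A RM = P0" "augmentation RM = d0" "syzygies0 A RM = Z0" "res1 A RM = P1" "diff1 A RM = d1"
  "syzygies1 A RM = Z1" "res2 A RM = P2" "diff2 A RM = d2"
  by (simp_all add: res0_def augmentation_def syzygies0_def res1_def diff1_def syzygies1_def res2_def diff2_def)

sublocale F0: free_module A RM "carrier R"
  by unfold_locales simp

sublocale F1: free_module A P0 Z0
  by unfold_locales (auto simp: kernel_def)

sublocale F2: free_module A P1 Z1
  by unfold_locales (auto simp: kernel_def)

sublocale T0: tensor_pair A P0 RN ..
sublocale T1: tensor_pair A P1 RN ..
sublocale T2: tensor_pair A P2 RN ..
sublocale TK: tensor_pair A KM RN ..

lemma Z0_iff: "z \<in> Z0 \<longleftrightarrow> z \<in> carrier P0 \<and> d0 z = \<zero>\<^bsub>R\<^esub>"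
  by (simp add: kernel_def)

lemma Z1_iff: "z \<in> Z1 \<longleftrightarrow> z \<in> carrier P1 \<and> d1 z = \<one>\<^bsub>P0\<^esub>"
  by (simp add: kernel_def)

lemmas d0 = right_linearD[OF F0.free_eval_linear, simplified]
lemmas d1 = right_linearD[OF F1.free_eval_linear]
lemmas d2 = right_linearD[OF F2.free_eval_linear]

sublocale d0: group_hom P0 RM d0
  by (rule group_hom_intro[OF F0.free_comm_group RM.M.comm_group_axioms right_linearD(1)[OF F0.free_eval_linear]])

sublocale d1: group_hom P1 P0 d1
  by (rule group_hom_intro[OF F1.free_comm_group F0.free_comm_group right_linearD(1)[OF F1.free_eval_linear]])

lemma d1_in_Z0:
  assumes "p \<in> carrier P1" shows "d1 p \<in> Z0"
  using assms
proof (induction p rule: F1.free_induct)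
  case (single z a)
  then show ?case by (simp add: F1.free_eval_e Z0_iff d0)
next
  case (mult f g)
  then show ?case by (simp add: Z0_iff)
next
  case one
  then show ?case using d0.hom_one by (simp add: Z0_iff)
qed

lemma d2_in_Z1:
  assumes "p \<in> carrier P2" shows "d2 p \<in> Z1"
  using assms
proof (induction p rule: F2.free_induct)
  case (single z a)
  then show ?case by (simp add: F2.free_eval_e Z1_iff d1)
next
  case (mult f g)
  then show ?case by (simp add: Z1_iff d2(3))
next
  case one
  have "d2 \<one>\<^bsub>P2\<^esub> = \<one>\<^bsub>P1\<^esub>"
    using hom_one[OF d2(1)] F1.FM.M.is_group F2.FM.M.is_group by blast
  then show ?case by (simp add: Z1_iff)
qed

lemma Z0_closed:
  "z \<in> Z0 \<Longrightarrow> z \<in> carrier P0" "\<lbrakk>z \<in> Z0; z' \<in> Z0\<rbrakk> \<Longrightarrow> z \<otimes>\<^bsub>P0\<^esub> z' \<in> Z0"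
  "\<lbrakk>z \<in> Z0; a \<in> carrier A\<rbrakk> \<Longrightarrow> ract P0 z a \<in> Z0"
  by (simp_all add: Z0_iff d0(4))

section \<open>The complex tensored with \<open>R\<close>, its cycles and its boundaries\<close>

abbreviation t0 where "t0 \<equiv> tensor_class A P0 RN"
abbreviation t1 where "t1 \<equiv> tensor_class A P1 RN"

abbreviation D1 where "D1 \<equiv> tensor_map A P0 RN d1 id"
abbreviation D2 where "D2 \<equiv> tensor_map A P1 RN d2 id"

sublocale D1: tensor_map_pair A P1 RN P0 RN d1 id
  by unfold_locales (simp_all add: F1.free_eval_linear left_linear_id)

sublocale D2: tensor_map_pair A P2 RN P1 RN d2 id
  by unfold_locales (simp_all add: F2.free_eval_linear left_linear_id)

abbreviation B where "B \<equiv> D2 ` carrier T2.TP"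
abbreviation Cyc where "Cyc \<equiv> kernel T1.TP T0.TP D1"
abbreviation cls where "cls x \<equiv> B #>\<^bsub>T1.TP\<^esub> x"

lemma subgroup_B: "subgroup B T1.TP"
  by (rule group_hom.img_is_subgroup)
     (rule group_hom_intro[OF T2.tensor_comm_group T1.tensor_comm_group D2.tensor_map_hom])

text \<open>\<open>P2\<close> has a generator for each element of \<open>Z1\<close>, and
  \<open>d2\<close> sends the generator of \<open>z\<close> to \<open>z\<close>.\<close>

lemma t1_in_B: "\<lbrakk>z \<in> Z1; r \<in> carrier R\<rbrakk> \<Longrightarrow> t1 z r \<in> B"
proof -
  assume z: "z \<in> Z1" "r \<in> carrier R"
  have "D2 (tensor_class A P2 RN (F2.e z \<one>\<^bsub>A\<^esub>) r) = t1 z r"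
    using z by (simp add: D2.tensor_map_tens F2.free_eval_e_one)
  moreover have "tensor_class A P2 RN (F2.e z \<one>\<^bsub>A\<^esub>) r \<in> carrier T2.TP"
    using z by (simp add: T2.tens_closed)
  ultimately show ?thesis
    by (metis imageI)
qed

text \<open>\<open>d2\<close> has values in \<open>Z1\<close>, so the tensors \<open>t1 z r\<close>
  with \<open>z \<in> Z1\<close> generate the boundaries. With \<open>L\<close> trivial the lemma
  shows that \<open>h\<close> kills \<open>B\<close>; with \<open>L = B\<close>, that
  \<open>h\<close> preserves \<open>B\<close>.\<close>

lemma hom_B:
  assumes G: "group G" and h: "h \<in> hom T1.TP G" and L: "subgroup L G"
    and Z: "\<And>z r. \<lbrakk>z \<in> Z1; r \<in> carrier R\<rbrakk> \<Longrightarrow> h (t1 z r) \<in> L" and b: "b \<in> B"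
  shows "h b \<in> L"
proof -
  obtain X where X: "X \<in> carrier T2.TP" "b = D2 X"
    using b by blast
  have "(\<lambda>X. h (D2 X)) \<in> hom T2.TP G"
    using hom_compose[OF D2.tensor_map_hom h] by (simp add: comp_def)
  then have "h (D2 X) \<in> L"
    by (rule T2.hom_into_subgroup[OF G _ L _ X(1)]) (simp add: D2.tensor_map_tens Z d2_in_Z1)
  then show ?thesis
    using X by simp
qed

lemma subgroup_Cyc: "subgroup Cyc T1.TP"
  by (rule group_hom.subgroup_kernel)
     (rule group_hom_intro[OF T1.tensor_comm_group T0.tensor_comm_group D1.tensor_map_hom])

lemma B_subset_Cyc: "B \<subseteq> Cyc"
proof
  fix b assume b: "b \<in> B"
  have "D1 b \<in> {\<one>\<^bsub>T0.TP\<^esub>}"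
  proof (rule hom_B[OF T0.TP.is_group D1.tensor_map_hom subgroup_trivial[OF T0.TP.is_group] _ b])
    fix z r assume z: "z \<in> Z1" "r \<in> carrier R"
    then have "z \<in> carrier P1" "d1 z = \<one>\<^bsub>P0\<^esub>"
      by (simp_all add: Z1_iff)
    then show "D1 (t1 z r) \<in> {\<one>\<^bsub>T0.TP\<^esub>}"
      using z hom_one[OF T0.tens_left_hom F0.FM.M.is_group T0.TP.is_group]
      by (simp add: D1.tensor_map_tens)
  qed
  moreover have "b \<in> carrier T1.TP"
    using b subgroup.mem_carrier[OF subgroup_B] by blast
  ultimately show "b \<in> Cyc"
    by (simp add: kernel_def)
qed

abbreviation QB where "QB \<equiv> T1.TP Mod B"

lemma comm_group_QB: "comm_group QB"
  by (rule comm_group.abelian_FactGroup[OF T1.tensor_comm_group subgroup_B])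

sublocale QB: comm_group QB by (rule comm_group_QB)

lemma cls_hom: "(\<lambda>x. cls x) \<in> hom T1.TP QB"
  using normal.r_coset_hom_Mod comm_group.normal_iff_subgroup[OF T1.tensor_comm_group] subgroup_B by blast

sublocale cls: group_hom T1.TP QB "\<lambda>x. cls x"
  by (rule group_hom_intro[OF T1.tensor_comm_group comm_group_QB cls_hom])

lemma cls_eq_one_iff: "x \<in> carrier T1.TP \<Longrightarrow> cls x = B \<longleftrightarrow> x \<in> B"
  using T1.TP.coset_join1[OF _ _ subgroup_B] T1.TP.coset_join2[OF _ subgroup_B]
    subgroup.subset[OF subgroup_B] by blast

section \<open>The class of a syzygy tensored with an element of \<open>R\<close>\<close>

definition u where "u z r = cls (t1 (F1.e z \<one>\<^bsub>A\<^esub>) r)"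

lemma u_closed: "\<lbrakk>z \<in> Z0; r \<in> carrier R\<rbrakk> \<Longrightarrow> u z r \<in> carrier QB"
  unfolding u_def by (rule cls.hom_closed) (simp add: T1.tens_closed)

text \<open>The chain \<open>p - e_(d1 p)\<close> lies in \<open>Z1\<close>, so its tensors are
  boundaries. Thus any preimage of a syzygy computes \<open>u\<close>, and with the preimages
  \<open>e_z + e_z'\<close> and \<open>e_z a\<close> the rules for \<open>u\<close> follow from
  those for pure tensors.\<close>

lemma cls_t1:
  assumes p: "p \<in> carrier P1" and r: "r \<in> carrier R"
  shows "cls (t1 p r) = u (d1 p) r"
proof -
  let ?p = "F1.e (d1 p) \<one>\<^bsub>A\<^esub>"
  have "p \<otimes>\<^bsub>P1\<^esub> inv\<^bsub>P1\<^esub> ?p \<in> Z1"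
    using p d1_in_Z0[OF p] by (simp add: Z1_iff F1.free_eval_e_one)
  then have "t1 (p \<otimes>\<^bsub>P1\<^esub> inv\<^bsub>P1\<^esub> ?p) r \<in> B"
    using r by (rule t1_in_B)
  then have "t1 p r \<otimes>\<^bsub>T1.TP\<^esub> inv\<^bsub>T1.TP\<^esub> t1 ?p r \<in> B"
    using p r by (simp add: T1.tens_add_left T1.tens_inv_left)
  then show ?thesis
    unfolding u_def using T1.TP.r_coset_eq_iff[OF subgroup_B] p r by (simp add: T1.tens_closed)
qed

lemma u_add_left:
  assumes "z \<in> Z0" "z' \<in> Z0" "r \<in> carrier R"
  shows "u (z \<otimes>\<^bsub>P0\<^esub> z') r = u z r \<otimes>\<^bsub>QB\<^esub> u z' r"
proof -
  let ?e = "\<lambda>z. F1.e z \<one>\<^bsub>A\<^esub>"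
  have "u z r \<otimes>\<^bsub>QB\<^esub> u z' r = cls (t1 (?e z) r \<otimes>\<^bsub>T1.TP\<^esub> t1 (?e z') r)"
    unfolding u_def using assms by (simp add: T1.tens_closed cls.hom_mult del: mult_FactGroup)
  also have "\<dots> = cls (t1 (?e z \<otimes>\<^bsub>P1\<^esub> ?e z') r)"
    using assms by (simp add: T1.tens_add_left)
  also have "\<dots> = u (z \<otimes>\<^bsub>P0\<^esub> z') r"
    using assms by (subst cls_t1) (simp_all add: F1.free_eval_e_one)
  finally show ?thesis by simp
qed

lemma u_add_right:
  assumes "z \<in> Z0" "r \<in> carrier R" "r' \<in> carrier R"
  shows "u z (r \<oplus>\<^bsub>R\<^esub> r') = u z r \<otimes>\<^bsub>QB\<^esub> u z r'"
  unfolding u_def using assms T1.tens_add_right[of "F1.e z \<one>\<^bsub>A\<^esub>" r r']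
  by (simp add: T1.tens_closed cls.hom_mult del: mult_FactGroup)

lemma u_ract:
  assumes "z \<in> Z0" "a \<in> carrier A" "r \<in> carrier R"
  shows "u (ract P0 z a) r = u z (q a \<otimes>\<^bsub>R\<^esub> r)"
proof -
  have "u z (q a \<otimes>\<^bsub>R\<^esub> r) = cls (t1 (ract P1 (F1.e z \<one>\<^bsub>A\<^esub>) a) r)"
    unfolding u_def using assms by (subst T1.tens_balanced) simp_all
  also have "\<dots> = u (ract P0 z a) r"
    using assms Z0_closed(1) by (subst cls_t1) (simp_all add: d1 F1.free_eval_e_one)
  finally show ?thesis by simp
qed

lemma u_zero_right: "z \<in> Z0 \<Longrightarrow> u z \<zero>\<^bsub>R\<^esub> = B"
  using hom_one[of "u z" "add_monoid R" QB] u_closed u_add_right R.a_group QB.is_group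
  by (simp add: hom_def)

text \<open>\<open>k\<close> acts on the left module \<open>R\<close> through
  \<open>q k = 0\<close>. Only multiples of syzygies are concerned: \<open>i k = e_1 k\<close> is in
  general not covered, as \<open>e_1\<close> has augmentation \<open>1\<close>.\<close>

lemma u_ract_K:
  assumes "z \<in> Z0" "k \<in> K" "r \<in> carrier R" shows "u (ract P0 z k) r = B"
  using assms u_ract[of z k r] u_zero_right by (simp add: K_iff)

section \<open>The map \<open>eta\<close> from \<open>K\<close> to \<open>Tor\<close>\<close>

abbreviation i where "i \<equiv> F0.e \<one>\<^bsub>R\<^esub>"

lemma d0_i [simp]: "a \<in> carrier A \<Longrightarrow> d0 (i a) = q a"
  by (simp add: F0.free_eval_e)

lemma i_in_Z0: "k \<in> K \<Longrightarrow> i k \<in> Z0"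
  by (simp add: Z0_iff K_iff)

lemma i_add: "\<lbrakk>a \<in> carrier A; b \<in> carrier A\<rbrakk> \<Longrightarrow> i (a \<oplus>\<^bsub>A\<^esub> b) = i a \<otimes>\<^bsub>P0\<^esub> i b"
  by (rule F0.e_add)

lemma i_ract: "\<lbrakk>a \<in> carrier A; b \<in> carrier A\<rbrakk> \<Longrightarrow> i (a \<otimes>\<^bsub>A\<^esub> b) = ract P0 (i a) b"
  by (simp add: F0.e_ract)

definition eta where "eta k = u (i k) \<one>\<^bsub>R\<^esub>"

abbreviation TorG where "TorG \<equiv> T1.TP\<lparr>carrier := Cyc\<rparr> Mod B"

text \<open>Coset multiplication is multiplication of sets and does not refer to the carrier, so
  calculations with \<open>u\<close> in \<open>QB\<close> are also calculations in
  \<open>TorG\<close>.\<close>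

lemma mult_TorG: "mult TorG = mult QB"
  by (simp add: fun_eq_iff set_mult_def)

lemma carrier_TorG: "carrier TorG = (\<lambda>x. cls x) ` Cyc"
  by (auto simp: FactGroup_def RCOSETS_def)

lemma comm_group_TorG: "comm_group TorG"
proof (rule comm_group.abelian_FactGroup)
  show "comm_group (T1.TP\<lparr>carrier := Cyc\<rparr>)"
    using group.group_comm_groupI[OF group.subgroup_imp_group[OF T1.TP.is_group subgroup_Cyc]]
      T1.TP.m_comm subgroup.mem_carrier[OF subgroup_Cyc] by simp
  show "subgroup B (T1.TP\<lparr>carrier := Cyc\<rparr>)"
    by (rule T1.TP.subgroup_incl[OF subgroup_B subgroup_Cyc B_subset_Cyc])
qed

text \<open>Inside \<open>P0\<close> the syzygy \<open>i k\<close> is the multiple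
  \<open>e_1 k\<close> of a generator, and \<open>k\<close> moves across the tensor sign to become
  \<open>q k = 0\<close>. This makes \<open>eta k\<close> a class of cycles, unlike a general
  \<open>u z r\<close>.\<close>

lemma D1_i: "k \<in> K \<Longrightarrow> D1 (t1 (F1.e (i k) \<one>\<^bsub>A\<^esub>) \<one>\<^bsub>R\<^esub>) = \<one>\<^bsub>T0.TP\<^esub>"
proof -
  assume k: "k \<in> K"
  have "D1 (t1 (F1.e (i k) \<one>\<^bsub>A\<^esub>) \<one>\<^bsub>R\<^esub>) = t0 (i k) \<one>\<^bsub>R\<^esub>"
    using k i_in_Z0 by (simp add: D1.tensor_map_tens F1.free_eval_e_one)
  also have "\<dots> = t0 (ract P0 (i \<one>\<^bsub>A\<^esub>) k) \<one>\<^bsub>R\<^esub>"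
    using k i_ract[of "\<one>\<^bsub>A\<^esub>" k] by simp
  also have "\<dots> = t0 (i \<one>\<^bsub>A\<^esub>) \<zero>\<^bsub>R\<^esub>"
    using k by (subst T0.tens_balanced) (simp_all add: K_iff)
  also have "\<dots> = \<one>\<^bsub>T0.TP\<^esub>"
    using T0.tens_one_right[of "i \<one>\<^bsub>A\<^esub>"] by simp
  finally show ?thesis .
qed

lemma eta_closed: "k \<in> K \<Longrightarrow> eta k \<in> carrier TorG"
  unfolding carrier_TorG eta_def u_def
  by (rule imageI) (simp add: kernel_iff D1_i T1.tens_closed i_in_Z0)

lemma eta_hom: "eta \<in> hom KG TorG"
proof (rule homI)
  fix k l assume "k \<in> carrier KG" "l \<in> carrier KG"
  then show "eta (k \<otimes>\<^bsub>KG\<^esub> l) = eta k \<otimes>\<^bsub>TorG\<^esub> eta l"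
    by (simp add: eta_def i_add u_add_left i_in_Z0 mult_TorG del: mult_FactGroup)
qed (simp add: eta_closed)

section \<open>Linear lifts of the augmentation, and bijectivity modulo \<open>K2\<close>\<close>

lemma augmentation_lift_iff:
  "augmentation_lift A RA RM q f \<longleftrightarrow> right_linear A P0 RA f \<and> (\<forall>x\<in>carrier P0. q (f x) = d0 x)"
  by (auto simp: augmentation_lift_def right_linear_def resolution_simps)

lemma augmentation_lift_exists: "\<exists>f. augmentation_lift A RA RM q f"
proof -
  \<comment> \<open>\<open>s\<close> is a set-theoretic section of \<open>q\<close>. As
    \<open>P0\<close> is free on the elements of \<open>R\<close>, sending \<open>e_r\<close> to
    \<open>s r\<close> extends to a linear lift although \<open>s\<close> need not be
    additive.\<close>
  obtain s where s: "\<And>r. r \<in> carrier R \<Longrightarrow> s r \<in> carrier A" "\<And>r. r \<in> carrier R \<Longrightarrow> q (s r) = r"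
    using lift_exists by metis
  let ?f = "F0.free_extend RA s"
  have lin: "right_linear A P0 RA ?f"
    by (rule F0.free_extend_linear[OF right_module_RA]) (simp add: s)
  have "q (?f x) = d0 x" if x: "x \<in> carrier P0" for x
  proof (rule F0.free_hom_eqI[OF RM.M.is_group _ right_linearD(1)[OF F0.free_eval_linear] _ x])
    have "q \<in> hom RA RM"
      by (simp add: hom_def)
    then show "(\<lambda>x. q (?f x)) \<in> hom P0 RM"
      using hom_compose[OF right_linearD(1)[OF lin]] by (simp add: comp_def)
    show "q (?f (F0.e z a)) = d0 (F0.e z a)" if "z \<in> carrier R" "a \<in> carrier A" for z a
      using that s by (simp add: F0.free_extend_e[OF right_module_RA] F0.free_eval_e)
  qed
  then show ?thesis
    using lin by (auto simp: augmentation_lift_iff)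
qed

text \<open>The lift is arbitrary: \<open>connecting_hom\<close> uses the one selected by
  \<open>SOME\<close>, while the kernel and the image of \<open>eta\<close> are computed with any
  lift.\<close>

context
  fixes f
  assumes f: "augmentation_lift A RA RM q f"
begin

lemma f_linear: "right_linear A P0 RA f"
  using f by (simp add: augmentation_lift_iff)

lemma q_f: "x \<in> carrier P0 \<Longrightarrow> q (f x) = d0 x"
  using f by (simp add: augmentation_lift_iff)

lemmas f_simps = right_linearD(2-4)[OF f_linear, simplified]

interpretation f: group_hom P0 RA f
  by (rule group_hom_intro[OF F0.free_comm_group RA.M.comm_group_axioms right_linearD(1)[OF f_linear]])

lemma f_one: "f \<one>\<^bsub>P0\<^esub> = \<zero>\<^bsub>A\<^esub>"
  using f.hom_one by simp

lemma f_Z0: "z \<in> Z0 \<Longrightarrow> f z \<in> K"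
  by (simp add: Z0_iff K_iff f_simps q_f)

lemma f_i_one: "q (f (i \<one>\<^bsub>A\<^esub>)) = \<one>\<^bsub>R\<^esub>"
  by (simp add: q_f)

lemma f_i: "a \<in> carrier A \<Longrightarrow> f (i a) = f (i \<one>\<^bsub>A\<^esub>) \<otimes>\<^bsub>A\<^esub> a"
  using f_simps(3)[of "i \<one>\<^bsub>A\<^esub>" a] i_ract[of "\<one>\<^bsub>A\<^esub>" a] by simp

lemma K2_coset_f_i: "k \<in> K \<Longrightarrow> K2 +>\<^bsub>A\<^esub> f (i k) = K2 +>\<^bsub>A\<^esub> k"
  using K2_coset_mult_left[of k "f (i \<one>\<^bsub>A\<^esub>)" "\<one>\<^bsub>A\<^esub>"] f_i_one f_simps(1)[of "i \<one>\<^bsub>A\<^esub>"] f_i[of k]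
  by simp

lemma eta_injective:
  assumes k: "k \<in> K" and eta: "eta k = B" shows "k \<in> K2"
proof -
  \<comment> \<open>The target is \<open>A\<close> modulo \<open>K2\<close> rather than
    \<open>K\<close> modulo \<open>K2\<close>: the question is only whether a coset equals
    \<open>K2\<close>, and representatives have to be tracked in \<open>carrier A\<close>
    alone.\<close>
  let ?G = "add_monoid A Mod K2"
  obtain s where s: "\<And>r. r \<in> carrier R \<Longrightarrow> s r \<in> carrier A" "\<And>r. r \<in> carrier R \<Longrightarrow> q (s r) = r"
    using lift_exists by metis
  have G: "comm_group ?G"
    by (rule comm_group.abelian_FactGroup[OF A.a_comm_group K2.a_subgroup])
  interpret G: comm_group ?G by (rule G)
  have coset_hom: "(\<lambda>a. K2 +>\<^bsub>A\<^esub> a) \<in> hom (add_monoid A) ?G"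
    using normal.r_coset_hom_Mod comm_group.normal_iff_subgroup[OF A.a_comm_group] K2.a_subgroup
    unfolding a_r_coset_def by blast
  have closed: "K2 +>\<^bsub>A\<^esub> a \<in> carrier ?G" if "a \<in> carrier A" for a
    using coset_hom that by (auto simp: hom_def)
  have add: "(K2 +>\<^bsub>A\<^esub> a) \<otimes>\<^bsub>?G\<^esub> (K2 +>\<^bsub>A\<^esub> b) = K2 +>\<^bsub>A\<^esub> (a \<oplus>\<^bsub>A\<^esub> b)" if "a \<in> carrier A" "b \<in> carrier A" for a b
    using hom_mult[OF coset_hom] that by (simp del: mult_FactGroup)
  \<comment> \<open>The section \<open>s\<close> respects sums and the action of \<open>A\<close>
    only up to \<open>K\<close>. As \<open>f (d1 p)\<close> lies in \<open>K\<close>, the error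
    disappears modulo \<open>K2\<close>, so \<open>h\<close> is additive in \<open>r\<close> and
    balanced.\<close>
  define h where "h p r = K2 +>\<^bsub>A\<^esub> (f (d1 p) \<otimes>\<^bsub>A\<^esub> s r)" for p r
  have fd: "f (d1 p) \<in> K" "f (d1 p) \<in> carrier A" if "p \<in> carrier P1" for p
    using f_Z0[OF d1_in_Z0[OF that]] by simp_all
  obtain H where H: "H \<in> hom T1.TP ?G"
    and Ht: "\<And>p r. \<lbrakk>p \<in> carrier P1; r \<in> carrier RN\<rbrakk> \<Longrightarrow> H (t1 p r) = h p r"
  proof (rule T1.tensor_lift[OF G, of h])
    fix p r assume "p \<in> carrier P1" "r \<in> carrier RN"
    then show "h p r \<in> carrier ?G"
      unfolding h_def by (intro closed) (simp add: fd s)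
  next
    fix p p' r assume "p \<in> carrier P1" "p' \<in> carrier P1" "r \<in> carrier RN"
    then show "h (p \<otimes>\<^bsub>P1\<^esub> p') r = h p r \<otimes>\<^bsub>?G\<^esub> h p' r"
      unfolding h_def by (subst add) (simp_all add: fd s f_simps A.l_distr)
  next
    fix p r r' assume p: "p \<in> carrier P1" and r: "r \<in> carrier RN" "r' \<in> carrier RN"
    have "h p (r \<otimes>\<^bsub>RN\<^esub> r') = K2 +>\<^bsub>A\<^esub> (f (d1 p) \<otimes>\<^bsub>A\<^esub> (s r \<oplus>\<^bsub>A\<^esub> s r'))"
      unfolding h_def by (rule K2_coset_mult_right) (use p r in \<open>simp_all add: fd s\<close>)
    then show "h p (r \<otimes>\<^bsub>RN\<^esub> r') = h p r \<otimes>\<^bsub>?G\<^esub> h p r'"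
      unfolding h_def using p r by (subst add) (simp_all add: fd s A.r_distr)
  next
    fix p a r assume p: "p \<in> carrier P1" and a: "a \<in> carrier A" and r: "r \<in> carrier RN"
    have "K2 +>\<^bsub>A\<^esub> (f (d1 p) \<otimes>\<^bsub>A\<^esub> (a \<otimes>\<^bsub>A\<^esub> s r)) = h p (lact RN a r)"
      unfolding h_def by (rule K2_coset_mult_right) (use p a r in \<open>simp_all add: fd s\<close>)
    then show "h (ract P1 p a) r = h p (lact RN a r)"
      using p a r by (simp add: h_def d1 f_simps fd s A.m_assoc)
  qed (rule that)
  let ?e = "F1.e (i k) \<one>\<^bsub>A\<^esub>"
  have e: "?e \<in> carrier P1" "d1 ?e = i k"
    using k i_in_Z0 by (simp_all add: F1.free_eval_e_one)
  have "t1 ?e \<one>\<^bsub>R\<^esub> \<in> B"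
    using eta cls_eq_one_iff[of "t1 ?e \<one>\<^bsub>R\<^esub>"] e by (simp add: eta_def u_def T1.tens_closed)
  \<comment> \<open>For \<open>z \<in> Z1\<close> the element \<open>d1 z\<close> is trivial, so
    \<open>H\<close> vanishes on \<open>t1 z r\<close> and therefore on all boundaries.\<close>
  then have "H (t1 ?e \<one>\<^bsub>R\<^esub>) \<in> {\<one>\<^bsub>?G\<^esub>}"
  proof (rule hom_B[OF G.is_group H subgroup_trivial[OF G.is_group], rotated])
    fix z r assume "z \<in> Z1" "r \<in> carrier R"
    then show "H (t1 z r) \<in> {\<one>\<^bsub>?G\<^esub>}"
      using A.a_coset_add_zero[OF K2.a_subset] by (simp add: Ht h_def Z1_iff f_one s)
  qed
  then have "K2 +>\<^bsub>A\<^esub> (f (i k) \<otimes>\<^bsub>A\<^esub> s \<one>\<^bsub>R\<^esub>) = K2"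
    using e by (simp add: Ht h_def)
  moreover have "K2 +>\<^bsub>A\<^esub> (f (i k) \<otimes>\<^bsub>A\<^esub> s \<one>\<^bsub>R\<^esub>) = K2 +>\<^bsub>A\<^esub> (f (i k) \<otimes>\<^bsub>A\<^esub> \<one>\<^bsub>A\<^esub>)"
    by (rule K2_coset_mult_right) (use k i_in_Z0 in \<open>simp_all add: f_Z0 s\<close>)
  moreover have "\<dots> = K2 +>\<^bsub>A\<^esub> k"
    using k f_Z0[OF i_in_Z0[OF k]] K2_coset_f_i[OF k] by simp
  ultimately show ?thesis
    using k K2.a_rcos_self[of k] by simp
qed

lemma eta_surjective:
  assumes X: "X \<in> carrier TorG" shows "\<exists>k\<in>K. X = eta k"
proof -
  obtain x where x: "x \<in> Cyc" "X = cls x"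
    using X by (auto simp: carrier_TorG)
  then have xc: "x \<in> carrier T1.TP" and Dx: "D1 x = \<one>\<^bsub>T0.TP\<^esub>"
    by (simp_all add: kernel_def)
  \<comment> \<open>Surjectivity of \<open>q\<close> turns \<open>p \<otimes> r\<close> into
    \<open>p a \<otimes> 1\<close> for a lift \<open>a\<close> of \<open>r\<close>, so sums of
    tensors collapse to a single tensor with second factor \<open>1\<close>.\<close>
  have "\<exists>p\<in>carrier P1. x = t1 p \<one>\<^bsub>R\<^esub>"
    using xc
  proof (induction x rule: T1.tensor_induct)
    case one
    then show ?case
      using hom_one[OF T1.tens_left_hom[of "\<one>\<^bsub>R\<^esub>"] F1.FM.M.is_group T1.TP.is_group]
      by (intro bexI[of _ "\<one>\<^bsub>P1\<^esub>"]) simp_all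
  next
    case (tens p r)
    obtain a where a: "a \<in> carrier A" "q a = r"
      using lift_exists[of r] tens by auto
    then have "t1 p r = t1 (ract P1 p a) \<one>\<^bsub>R\<^esub>"
      using tens T1.tens_balanced[of p a "\<one>\<^bsub>R\<^esub>"] by simp
    then show ?case
      using tens a by (intro bexI[of _ "ract P1 p a"]) simp_all
  next
    case (diff X Y)
    then obtain p p' where "p \<in> carrier P1" "X = t1 p \<one>\<^bsub>R\<^esub>" "p' \<in> carrier P1" "Y = t1 p' \<one>\<^bsub>R\<^esub>"
      by blast
    then show ?case
      by (intro bexI[of _ "p \<otimes>\<^bsub>P1\<^esub> inv\<^bsub>P1\<^esub> p'"]) (simp_all add: T1.tens_add_left T1.tens_inv_left)
  qed
  then obtain p where p: "p \<in> carrier P1" "x = t1 p \<one>\<^bsub>R\<^esub>"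
    by blast
  \<comment> \<open>\<open>i (f y)\<close> has augmentation \<open>q (f y) = d0 y\<close>, so
    \<open>w\<close> maps all of \<open>P0\<close> linearly to \<open>Z0\<close>. It turns
    \<open>u\<close>, whose rules hold only over \<open>Z0\<close>, into a balanced function on
    \<open>P0\<close> and \<open>R\<close>.\<close>
  define w where "w y = y \<otimes>\<^bsub>P0\<^esub> inv\<^bsub>P0\<^esub> (i (f y))" for y
  have w_Z0: "w y \<in> Z0" if "y \<in> carrier P0" for y
    using that by (simp add: w_def Z0_iff f_simps q_f R.r_neg d0(2))
  have w_mult: "w (y \<otimes>\<^bsub>P0\<^esub> y') = w y \<otimes>\<^bsub>P0\<^esub> w y'" if "y \<in> carrier P0" "y' \<in> carrier P0" for y y'
    using that by (simp add: w_def f_simps i_add F0.FM.M.inv_mult F0.FM.M.m_ac)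
  have w_ract: "w (ract P0 y a) = ract P0 (w y) a" if "y \<in> carrier P0" "a \<in> carrier A" for y a
    using that by (simp add: w_def f_simps i_ract F0.FM.act_mult F0.FM.act_inv)
  obtain H where H: "H \<in> hom T0.TP QB"
    and Ht: "\<And>y r. \<lbrakk>y \<in> carrier P0; r \<in> carrier RN\<rbrakk> \<Longrightarrow> H (t0 y r) = u (w y) r"
    by (rule T0.tensor_lift[OF comm_group_QB, of "\<lambda>y r. u (w y) r"])
       (simp_all add: u_closed w_Z0 w_mult u_add_left u_add_right w_ract u_ract del: mult_FactGroup)
  have dp: "d1 p \<in> Z0" "d1 p \<in> carrier P0"
    using d1_in_Z0[OF p(1)] by (simp_all add: Z0_iff)
  have k: "f (d1 p) \<in> K"
    using f_Z0 dp by simp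
  have "t0 (d1 p) \<one>\<^bsub>R\<^esub> = \<one>\<^bsub>T0.TP\<^esub>"
    using Dx p by (simp add: D1.tensor_map_tens)
  then have "u (w (d1 p)) \<one>\<^bsub>R\<^esub> = \<one>\<^bsub>QB\<^esub>"
    using Ht[of "d1 p" "\<one>\<^bsub>R\<^esub>"] hom_one[OF H T0.TP.is_group QB.is_group] dp by (simp del: one_FactGroup)
  \<comment> \<open>For the syzygy \<open>d1 p\<close> both summands lie in \<open>Z0\<close>, so
    \<open>u\<close> splits; the part with \<open>w\<close> has just been shown to vanish.\<close>
  moreover have "d1 p = w (d1 p) \<otimes>\<^bsub>P0\<^esub> i (f (d1 p))"
    using dp f_simps(1) by (simp add: w_def F0.FM.M.m_assoc)
  then have "u (d1 p) \<one>\<^bsub>R\<^esub> = u (w (d1 p)) \<one>\<^bsub>R\<^esub> \<otimes>\<^bsub>QB\<^esub> eta (f (d1 p))"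
    using u_add_left[OF w_Z0[OF dp(2)] i_in_Z0[OF k], of "\<one>\<^bsub>R\<^esub>"] by (simp add: eta_def del: mult_FactGroup)
  ultimately have "u (d1 p) \<one>\<^bsub>R\<^esub> = eta (f (d1 p))"
    using u_closed[OF i_in_Z0[OF k], of "\<one>\<^bsub>R\<^esub>"] by (simp add: eta_def del: mult_FactGroup one_FactGroup)
  then show ?thesis
    using x p k cls_t1[of p "\<one>\<^bsub>R\<^esub>"] by auto
qed

end

end

lemma iso_with_actions: "\<phi> \<in> iso G H \<Longrightarrow> \<phi> \<in> iso (with_actions G l r) (with_actions H l' r')"
  by (simp add: iso_def)

context ring_surjection
begin

section \<open>The induced isomorphism of groups\<close>

lemma Tor1_eq:
  "Tor1 A RM RN = with_actions TorG
     (\<lambda>s X. \<Union>x\<in>X. cls (tensor_map A P1 RN (lact P1 s) id x))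
     (\<lambda>X t. \<Union>x\<in>X. cls (tensor_map A P1 RN id (\<lambda>y. ract RN y t) x))"
  unfolding Tor1_def Let_def tor1_cycles_def tor1_boundaries_def resolution_simps
  by (simp add: tensor_def)

sublocale eta: group_hom KG TorG eta
  by (rule group_hom_intro[OF comm_group_KG comm_group_TorG eta_hom])

lemma kernel_eta: "kernel KG TorG eta = K2"
proof
  obtain f where f: "augmentation_lift A RA RM q f"
    using augmentation_lift_exists by blast
  show "kernel KG TorG eta \<subseteq> K2"
    using eta_injective[OF f] by (auto simp: kernel_iff)
next
  have "k \<in> kernel KG TorG eta" if "k \<in> K2" for k
    using that
  proof induction
    \<comment> \<open>Here \<open>i (k l)\<close> is \<open>(i k) l\<close> with
      \<open>i k \<in> Z0\<close> and \<open>l \<in> K\<close>, so \<open>u_ract_K\<close>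
      applies.\<close>
    case (prod k l)
    then have "eta (k \<otimes>\<^bsub>A\<^esub> l) = B"
      by (simp add: eta_def i_ract i_in_Z0 u_ract_K)
    then have "eta (k \<otimes>\<^bsub>A\<^esub> l) = \<one>\<^bsub>TorG\<^esub>"
      unfolding one_FactGroup .
    moreover have "k \<otimes>\<^bsub>A\<^esub> l \<in> carrier KG"
      using prod by (simp add: K.I_r_closed)
    ultimately show ?case
      unfolding kernel_iff by (intro conjI)
  next
    case (sum k l)
    show ?case
      using subgroup.m_closed[OF eta.subgroup_kernel sum.IH] by simp
  qed
  then show "K2 \<subseteq> kernel KG TorG eta"
    by blast
qed

text \<open>The form is that of the isomorphism which \<open>FactGroup_iso_set\<close> supplies for
  a homomorphism and its kernel.\<close>

definition conormal_to_Tor where "conormal_to_Tor X = the_elem (eta ` X)"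

lemma conormal_to_Tor_coset: "k \<in> K \<Longrightarrow> conormal_to_Tor (K2 +>\<^bsub>A\<^esub> k) = eta k"
proof -
  assume k: "k \<in> K"
  have "eta x = eta k" if x: "x \<in> K2 +>\<^bsub>A\<^esub> k" for x
  proof -
    obtain c where c: "c \<in> K2" "x = c \<oplus>\<^bsub>A\<^esub> k"
      using x by (auto simp: a_r_coset_def r_coset_def)
    have "c \<in> kernel KG TorG eta"
      using c kernel_eta by simp
    then show ?thesis
      using eta.hom_mult[of c k] k c eta_closed[OF k] eta.H.l_one by (simp add: kernel_iff del: mult_FactGroup one_FactGroup)
  qed
  moreover have "k \<in> K2 +>\<^bsub>A\<^esub> k"
    by (rule K2.a_rcos_self) (use k in simp)
  ultimately have "eta ` (K2 +>\<^bsub>A\<^esub> k) = {eta k}"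
    by blast
  then show ?thesis
    by (simp add: conormal_to_Tor_def)
qed

lemma conormal_to_Tor_iso: "conormal_to_Tor \<in> iso CN (Tor1 A RM RN)"
proof -
  obtain f where f: "augmentation_lift A RA RM q f"
    using augmentation_lift_exists by blast
  have "eta ` carrier KG = carrier TorG"
    using eta_closed eta_surjective[OF f] by (force simp del: one_FactGroup)
  then have "conormal_to_Tor \<in> iso (KG Mod K2) TorG"
    using eta.FactGroup_iso_set unfolding kernel_eta conormal_to_Tor_def[abs_def] by blast
  then show ?thesis
    unfolding Tor1_eq conormal_bimodule_def Let_def by (rule iso_with_actions)
qed

section \<open>Compatibility with the two actions of \<open>R\<close>\<close>

lemma UN_cls_hom:
  assumes h: "h \<in> hom T1.TP T1.TP" and B: "\<And>z r. \<lbrakk>z \<in> Z1; r \<in> carrier R\<rbrakk> \<Longrightarrow> h (t1 z r) \<in> B"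
    and x: "x \<in> carrier T1.TP"
  shows "(\<Union>y\<in>cls x. cls (h y)) = cls (h x)"
  using hom_B[OF T1.TP.is_group h subgroup_B B]
  by (intro UN_coset_hom[OF T1.TP.is_group T1.TP.is_group h subgroup_B subgroup_B _ x])

lemma lact_RM_linear: "s \<in> carrier R \<Longrightarrow> right_linear A RM RM (lact RM s)"
  by (simp add: right_linear_def hom_def R.r_distr R.m_assoc)

text \<open>The second claim lets the action continue to \<open>P1\<close>. The third contains the
  difficulty of the left action: \<open>e_1\<close> moves to \<open>e_s\<close>, so the result is in
  general outside the image of \<open>i\<close>.\<close>

lemma lact_P0:
  assumes "s \<in> carrier R"
  shows "right_linear A P0 P0 (lact P0 s)" "z \<in> Z0 \<Longrightarrow> lact P0 s z \<in> Z0"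
    "a \<in> carrier A \<Longrightarrow> lact P0 s (i a) = F0.e s a"
proof -
  note l = lact_RM_linear[OF assms]
  have c: "lact RM s z \<in> carrier R" if "z \<in> carrier R" for z
    using assms that by simp
  show "right_linear A P0 P0 (lact P0 s)"
    by (rule F0.lact_free_linear[OF l c])
  show "lact P0 s z \<in> Z0" if "z \<in> Z0" for z
    using that F0.free_eval_lact[OF l c, of z] F0.lact_free_closed[OF l c, of z] assms
    by (simp add: Z0_iff)
  show "lact P0 s (i a) = F0.e s a" if "a \<in> carrier A"
    using F0.lact_free_e[OF l c, of "\<one>\<^bsub>R\<^esub>" a] that assms by simp
qed

text \<open>Acting by \<open>q a\<close> gives the class of \<open>e_(q a) k\<close>, while
  \<open>eta (a k)\<close> is the class of \<open>e_1 a k\<close>. They differ by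
  \<open>(e_1 a - e_(q a)) k\<close>. The bracket has augmentation \<open>q a - q a = 0\<close>,
  hence is a syzygy, and \<open>u_ract_K\<close> removes its multiple by \<open>k\<close>.\<close>

lemma lact_Tor1_eta:
  assumes a: "a \<in> carrier A" and k: "k \<in> K"
  shows "lact (Tor1 A RM RN) (q a) (eta k) = eta (a \<otimes>\<^bsub>A\<^esub> k)"
proof -
  have s: "q a \<in> carrier R"
    using a by simp
  note l = lact_P0[OF s]
  interpret L: tensor_map_pair A P1 RN P1 RN "lact P1 (q a)" id
    by unfold_locales (simp_all add: F1.lact_free_linear[OF l(1,2)] left_linear_id)
  let ?h = "tensor_map A P1 RN (lact P1 (q a)) id"
  let ?e = "F1.e (i k) \<one>\<^bsub>A\<^esub>"
  have "?h (t1 z r) \<in> B" if "z \<in> Z1" "r \<in> carrier R" for z r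
  proof -
    have z: "z \<in> carrier P1" "d1 z = \<one>\<^bsub>P0\<^esub>"
      using that by (simp_all add: Z1_iff)
    have "lact P0 (q a) \<one>\<^bsub>P0\<^esub> = \<one>\<^bsub>P0\<^esub>"
      using hom_one[OF right_linearD(1)[OF l(1)]] F0.FM.M.is_group by blast
    then have "lact P1 (q a) z \<in> Z1"
      using z F1.free_eval_lact[OF l(1,2), of z] F1.lact_free_closed[OF l(1,2), of z] by (simp add: Z1_iff)
    then show ?thesis
      using that z by (simp add: L.tensor_map_tens t1_in_B)
  qed
  then have "lact (Tor1 A RM RN) (q a) (eta k) = cls (?h (t1 ?e \<one>\<^bsub>R\<^esub>))"
    unfolding Tor1_eq with_actions_simps eta_def u_def
    by (rule UN_cls_hom[OF L.tensor_map_hom]) (use k in \<open>simp_all add: T1.tens_closed\<close>)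
  also have "?h (t1 ?e \<one>\<^bsub>R\<^esub>) = t1 (F1.e (F0.e (q a) k) \<one>\<^bsub>A\<^esub>) \<one>\<^bsub>R\<^esub>"
    using k i_in_Z0[OF k] F1.lact_free_e[OF l(1,2), of "i k" "\<one>\<^bsub>A\<^esub>"] l(3)[of k]
    by (simp add: L.tensor_map_tens)
  also have "cls \<dots> = u (F0.e (q a) k) \<one>\<^bsub>R\<^esub>"
    by (simp add: u_def)
  also have "\<dots> = eta (a \<otimes>\<^bsub>A\<^esub> k)"
  proof -
    let ?g = "F0.e (q a) \<one>\<^bsub>A\<^esub>"
    let ?z = "i a \<otimes>\<^bsub>P0\<^esub> inv\<^bsub>P0\<^esub> ?g"
    have g: "ract P0 ?g k = F0.e (q a) k" "d0 ?g = q a"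
      using a k by (simp_all add: F0.e_ract F0.free_eval_e)
    have z: "?z \<in> Z0"
      using a g by (simp add: Z0_iff R.r_neg)
    have gZ: "F0.e (q a) k \<in> Z0"
      using l(2)[OF i_in_Z0[OF k]] l(3)[of k] k by simp
    have "i a = ?z \<otimes>\<^bsub>P0\<^esub> ?g"
      using a by (simp add: F0.FM.M.m_assoc)
    then have "i (a \<otimes>\<^bsub>A\<^esub> k) = ract P0 ?z k \<otimes>\<^bsub>P0\<^esub> F0.e (q a) k"
      using i_ract[of a k] F0.FM.act_mult[of ?z ?g k] g a k by simp
    then have "eta (a \<otimes>\<^bsub>A\<^esub> k) = u (ract P0 ?z k) \<one>\<^bsub>R\<^esub> \<otimes>\<^bsub>QB\<^esub> u (F0.e (q a) k) \<one>\<^bsub>R\<^esub>"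
      using u_add_left[OF Z0_closed(3)[OF z] gZ, of k "\<one>\<^bsub>R\<^esub>"] k by (simp add: eta_def del: mult_FactGroup)
    also have "\<dots> = \<one>\<^bsub>QB\<^esub> \<otimes>\<^bsub>QB\<^esub> u (F0.e (q a) k) \<one>\<^bsub>R\<^esub>"
      using u_ract_K[OF z k] by (simp del: mult_FactGroup)
    also have "\<dots> = u (F0.e (q a) k) \<one>\<^bsub>R\<^esub>"
      using u_closed[OF gZ, of "\<one>\<^bsub>R\<^esub>"] by (simp del: mult_FactGroup one_FactGroup)
    finally show ?thesis by simp
  qed
  finally show ?thesis .
qed

text \<open>The right action changes the second factor from \<open>1\<close> to \<open>q a\<close>,
  and balancing moves this back as the factor \<open>a\<close> on \<open>i k\<close>.\<close>

lemma ract_Tor1_eta: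
  assumes a: "a \<in> carrier A" and k: "k \<in> K"
  shows "ract (Tor1 A RM RN) (eta k) (q a) = eta (k \<otimes>\<^bsub>A\<^esub> a)"
proof -
  have g: "left_linear A RN RN (\<lambda>y. ract RN y (q a))"
    using a by (simp add: left_linear_def hom_def R.l_distr R.m_assoc)
  interpret L: tensor_map_pair A P1 RN P1 RN id "\<lambda>y. ract RN y (q a)"
    by unfold_locales (simp_all add: g right_linear_id del: restrict_left_simps)
  let ?h = "tensor_map A P1 RN id (\<lambda>y. ract RN y (q a))"
  let ?e = "F1.e (i k) \<one>\<^bsub>A\<^esub>"
  have h: "?h (t1 p r) = t1 p (r \<otimes>\<^bsub>R\<^esub> q a)" if "p \<in> carrier P1" "r \<in> carrier R" for p r
    using L.tensor_map_tens[of p r] that by simp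
  have "ract (Tor1 A RM RN) (eta k) (q a) = cls (?h (t1 ?e \<one>\<^bsub>R\<^esub>))"
    unfolding Tor1_eq with_actions_simps eta_def u_def
  proof (rule UN_cls_hom[OF L.tensor_map_hom])
    fix z r assume zr: "z \<in> Z1" "r \<in> carrier R"
    then have "?h (t1 z r) = t1 z (r \<otimes>\<^bsub>R\<^esub> q a)"
      by (intro h) (simp_all add: Z1_iff)
    moreover have "t1 z (r \<otimes>\<^bsub>R\<^esub> q a) \<in> B"
      by (rule t1_in_B) (use zr a in simp_all)
    ultimately show "?h (t1 z r) \<in> B"
      by simp
  next
    show "t1 ?e \<one>\<^bsub>R\<^esub> \<in> carrier T1.TP"
      by (simp add: T1.tens_closed)
  qed
  also have "?h (t1 ?e \<one>\<^bsub>R\<^esub>) = t1 ?e (q a)"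
    using a h[of ?e "\<one>\<^bsub>R\<^esub>"] by simp
  also have "cls \<dots> = u (ract P0 (i k) a) \<one>\<^bsub>R\<^esub>"
    using a i_in_Z0[OF k] by (subst u_ract) (simp_all add: u_def)
  also have "\<dots> = eta (k \<otimes>\<^bsub>A\<^esub> a)"
    using a k by (simp add: eta_def i_ract)
  finally show ?thesis .
qed

lemma kernel_KM: "kernel RA RM q = K"
  unfolding a_kernel_def' kernel_def by simp

text \<open>\<open>K \<otimes> R\<close> over \<open>A\<close> is \<open>K\<close> modulo
  \<open>K2\<close> through \<open>k \<otimes> 1\<close>, so under this identification the
  isomorphism is inverse to the connecting homomorphism. This is the sense in which it is
  canonical.\<close>

lemma connecting_hom_eta:
  assumes k: "k \<in> K"
  shows "connecting_hom A RA RM RN q (eta k) = tensor_class A KM RN k \<one>\<^bsub>R\<^esub>"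
proof -
  define f where "f = (SOME f. augmentation_lift A RA RM q f)"
  have f: "augmentation_lift A RA RM q f"
    unfolding f_def using augmentation_lift_exists by (rule someI_ex)
  note f_simps = right_linearD[OF f_linear[OF f], simplified]
  \<comment> \<open>\<open>d1\<close> has values in the syzygies and \<open>f\<close> takes these
    into \<open>K\<close>, so the composite may be given the target \<open>KM\<close>.\<close>
  have lin: "right_linear A P1 KM (f \<circ> d1)"
    using f_Z0[OF f] d1_in_Z0
    by (simp add: right_linear_def hom_def d1 f_simps(2-4))
  interpret L: tensor_map_pair A P1 RN KM RN "f \<circ> d1" id
    by unfold_locales (simp_all add: lin left_linear_id)
  let ?h = "tensor_map A KM RN (f \<circ> d1) id"
  let ?tk = "tensor_class A KM RN"
  let ?e = "F1.e (i k) \<one>\<^bsub>A\<^esub>"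
  have zero_left: "?tk \<zero>\<^bsub>A\<^esub> r = \<one>\<^bsub>TK.TP\<^esub>" if "r \<in> carrier R" for r
    using hom_one[OF TK.tens_left_hom[of r] KM.M.is_group TK.TP.is_group] that by simp
  have hB: "?h b \<in> {\<one>\<^bsub>TK.TP\<^esub>}" if "b \<in> B" for b
  proof (rule hom_B[OF TK.TP.is_group L.tensor_map_hom subgroup_trivial[OF TK.TP.is_group] _ that])
    show "?h (t1 z r) \<in> {\<one>\<^bsub>TK.TP\<^esub>}" if "z \<in> Z1" "r \<in> carrier R" for z r
      using that by (simp add: L.tensor_map_tens Z1_iff f_one[OF f] zero_left)
  qed
  have "connecting_hom A RA RM RN q (eta k) = (\<Union>x\<in>eta k. ?h x)"
    by (simp add: connecting_hom_def Let_def f_def kernel_KM resolution_simps)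
  also have "\<dots> = ?h (t1 ?e \<one>\<^bsub>R\<^esub>)"
    unfolding eta_def u_def
    by (rule UN_coset_hom_const[OF T1.TP.is_group TK.TP.is_group L.tensor_map_hom subgroup_B])
       (use hB in \<open>simp_all add: T1.tens_closed\<close>)
  also have "\<dots> = ?tk (f (i k)) \<one>\<^bsub>R\<^esub>"
    using i_in_Z0[OF k] by (simp add: L.tensor_map_tens F1.free_eval_e_one)
  also have "\<dots> = ?tk k \<one>\<^bsub>R\<^esub>"
  proof -
    let ?a = "f (i \<one>\<^bsub>A\<^esub>)"
    have a: "?a \<in> carrier A" "q ?a = q \<one>\<^bsub>A\<^esub>"
      using f_i_one[OF f] f_simps(2) by simp_all
    \<comment> \<open>\<open>f (i 1)\<close> lifts \<open>1\<close> but need not equal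
      \<open>1\<close>; the discrepancy \<open>?l\<close> lies in \<open>K\<close>. Its contribution
      \<open>?l k \<otimes> 1\<close> equals \<open>?l \<otimes> q k\<close>, which is trivial in
      \<open>K \<otimes> R\<close>.\<close>
    let ?l = "?a \<ominus>\<^bsub>A\<^esub> \<one>\<^bsub>A\<^esub>"
    have l: "?l \<in> K"
      by (rule diff_in_K) (use a in simp_all)
    have "?a = ?l \<oplus>\<^bsub>A\<^esub> \<one>\<^bsub>A\<^esub>"
      using a by (simp add: a_minus_def A.a_assoc A.l_neg)
    then have "f (i k) = (?l \<otimes>\<^bsub>A\<^esub> k) \<oplus>\<^bsub>A\<^esub> k"
      using f_i[OF f, of k] A.l_distr[of ?l "\<one>\<^bsub>A\<^esub>" k] l k by simp
    then have "?tk (f (i k)) \<one>\<^bsub>R\<^esub> = ?tk (ract KM ?l k) \<one>\<^bsub>R\<^esub> \<otimes>\<^bsub>TK.TP\<^esub> ?tk k \<one>\<^bsub>R\<^esub>"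
      using TK.tens_add_left[of "?l \<otimes>\<^bsub>A\<^esub> k" k "\<one>\<^bsub>R\<^esub>"] l k by (simp add: K.I_r_closed)
    also have "?tk (ract KM ?l k) \<one>\<^bsub>R\<^esub> = ?tk ?l \<zero>\<^bsub>R\<^esub>"
      using l k by (subst TK.tens_balanced) (simp_all add: K_iff)
    also have "\<dots> = \<one>\<^bsub>TK.TP\<^esub>"
      using TK.tens_one_right[of ?l] l by simp
    finally show ?thesis
      using k by (simp add: TK.tens_closed)
  qed
  finally show ?thesis .
qed

theorem conormal_bimodule_iso_Tor1:
  "bimodule_iso R R CN (Tor1 A RM RN) conormal_to_Tor"
proof -
  have ex: "\<exists>k\<in>K. X = K2 +>\<^bsub>A\<^esub> k" if "X \<in> carrier CN" for X
    using that by (simp add: carrier_conormal image_iff)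
  have exl: "\<exists>a\<in>carrier A. r = q a" if "r \<in> carrier R" for r
    using lift_exists[OF that] by metis
  have l: "conormal_to_Tor (lact CN r X) = lact (Tor1 A RM RN) r (conormal_to_Tor X)"
    and r: "conormal_to_Tor (ract CN X r) = ract (Tor1 A RM RN) (conormal_to_Tor X) r"
    if rX: "r \<in> carrier R" "X \<in> carrier CN" for r X
  proof -
    obtain a k where *: "a \<in> carrier A" "r = q a" "k \<in> K" "X = K2 +>\<^bsub>A\<^esub> k"
      using ex exl rX by blast
    show "conormal_to_Tor (lact CN r X) = lact (Tor1 A RM RN) r (conormal_to_Tor X)"
      "conormal_to_Tor (ract CN X r) = ract (Tor1 A RM RN) (conormal_to_Tor X) r"
      unfolding * using *(1,3)
      by (simp_all add: lact_conormal ract_conormal conormal_to_Tor_coset lact_Tor1_eta ract_Tor1_eta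
          K.I_l_closed K.I_r_closed)
  qed
  have "comm_group (Tor1 A RM RN)"
    unfolding Tor1_eq by (rule comm_group_with_actions[OF comm_group_TorG])
  then show ?thesis
    unfolding bimodule_iso_def
    using bimodule_conormal conormal_to_Tor_iso bimodule_transport[OF bimodule_conormal _ conormal_to_Tor_iso] l r
    by blast
qed

end

section \<open>Rings without identity\<close>

text \<open>In the records for \<open>F\<close> and \<open>O\<close> the field \<open>one\<close> is
  arbitrary, so the axioms speak of the additive group and the multiplication alone.\<close>

locale nonunital_ring = abelian_group R for R (structure) +
  assumes mult_closed [simp, intro]: "\<lbrakk>x \<in> carrier R; y \<in> carrier R\<rbrakk> \<Longrightarrow> x \<otimes> y \<in> carrier R"
    and mult_assoc: "\<lbrakk>x \<in> carrier R; y \<in> carrier R; z \<in> carrier R\<rbrakk> \<Longrightarrow> (x \<otimes> y) \<otimes> z = x \<otimes> (y \<otimes> z)"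
    and mult_l_distr: "\<lbrakk>x \<in> carrier R; y \<in> carrier R; z \<in> carrier R\<rbrakk> \<Longrightarrow> (x \<oplus> y) \<otimes> z = x \<otimes> z \<oplus> y \<otimes> z"
    and mult_r_distr: "\<lbrakk>x \<in> carrier R; y \<in> carrier R; z \<in> carrier R\<rbrakk> \<Longrightarrow> z \<otimes> (x \<oplus> y) = z \<otimes> x \<oplus> z \<otimes> y"
begin

lemma mult_left_hom: "y \<in> carrier R \<Longrightarrow> (\<lambda>x. x \<otimes> y) \<in> hom (add_monoid R) (add_monoid R)"
  by (simp add: hom_def mult_l_distr)

lemma mult_right_hom: "x \<in> carrier R \<Longrightarrow> (\<lambda>y. x \<otimes> y) \<in> hom (add_monoid R) (add_monoid R)"
  by (simp add: hom_def mult_r_distr)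

lemma zero_mult [simp]: "x \<in> carrier R \<Longrightarrow> \<zero> \<otimes> x = \<zero>"
  using hom_one[OF mult_left_hom a_group a_group] by simp

lemma mult_zero [simp]: "x \<in> carrier R \<Longrightarrow> x \<otimes> \<zero> = \<zero>"
  using hom_one[OF mult_right_hom a_group a_group] by simp

lemma int_mult_left:
  "\<lbrakk>x \<in> carrier R; y \<in> carrier R\<rbrakk> \<Longrightarrow> add_pow R (n :: int) x \<otimes> y = add_pow R n (x \<otimes> y)"
  using hom_int_pow[OF mult_left_hom, of y x n] a_group by (simp add: add_pow_def)

lemma int_mult_right:
  "\<lbrakk>x \<in> carrier R; y \<in> carrier R\<rbrakk> \<Longrightarrow> x \<otimes> add_pow R (n :: int) y = add_pow R n (x \<otimes> y)"
  using hom_int_pow[OF mult_right_hom, of x y n] a_group by (simp add: add_pow_def)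

lemma ring_int_unitization: "ring (int_unitization R)"
proof (rule ringI)
  let ?U = "int_unitization R"
  show "abelian_group ?U"
  proof (rule abelian_groupI)
    fix x assume "x \<in> carrier ?U"
    then show "\<exists>y\<in>carrier ?U. y \<oplus>\<^bsub>?U\<^esub> x = \<zero>\<^bsub>?U\<^esub>"
      by (intro bexI[of _ "(- fst x, \<ominus> snd x)"]) (auto simp: int_unitization_def l_neg)
  qed (auto simp: int_unitization_def intro: a_assoc a_comm)
  show "monoid ?U"
  proof (rule monoidI)
    fix x y z assume "x \<in> carrier ?U" "y \<in> carrier ?U" "z \<in> carrier ?U"
    then show "(x \<otimes>\<^bsub>?U\<^esub> y) \<otimes>\<^bsub>?U\<^esub> z = x \<otimes>\<^bsub>?U\<^esub> (y \<otimes>\<^bsub>?U\<^esub> z)"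
      by (auto simp: int_unitization_def mult_l_distr mult_r_distr mult_assoc int_mult_left int_mult_right
          add.int_pow_distrib add.int_pow_pow a_ac mult.commute)
  qed (auto simp: int_unitization_def)
  show "(x \<oplus>\<^bsub>?U\<^esub> y) \<otimes>\<^bsub>?U\<^esub> z = x \<otimes>\<^bsub>?U\<^esub> z \<oplus>\<^bsub>?U\<^esub> y \<otimes>\<^bsub>?U\<^esub> z"
    "z \<otimes>\<^bsub>?U\<^esub> (x \<oplus>\<^bsub>?U\<^esub> y) = z \<otimes>\<^bsub>?U\<^esub> x \<oplus>\<^bsub>?U\<^esub> z \<otimes>\<^bsub>?U\<^esub> y"
    if "x \<in> carrier ?U" "y \<in> carrier ?U" "z \<in> carrier ?U" for x y z
    using that by (auto simp: int_unitization_def mult_l_distr mult_r_distr distrib_left distrib_right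
          add.int_pow_distrib add.int_pow_mult a_ac)
qed

end

text \<open>\<open>Quot\<close> fills the field \<open>one\<close>, while \<open>F_ring\<close> sets
  it to \<open>undefined\<close>; this bridges the two records.\<close>

lemma nonunital_ring_one_update:
  assumes "nonunital_ring R" shows "nonunital_ring (R\<lparr>one := e\<rparr>)"
proof -
  interpret nonunital_ring R by fact
  have "abelian_group (R\<lparr>one := e\<rparr>)"
    by (rule comm_group_abelian_groupI) (simp add: a_comm_group)
  then show ?thesis
    by (intro nonunital_ring.intro nonunital_ring_axioms.intro)
       (simp_all add: mult_assoc mult_l_distr mult_r_distr)
qed

locale nonunital_ideal = nonunital_ring R for I and R (structure) +
  assumes ideal: "two_sided_ideal R I"
begin

lemma subgroup_I: "subgroup I (add_monoid R)"
  using ideal by (simp add: two_sided_ideal_def)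

sublocale abelian_subgroup I R
  by (rule abelian_subgroupI3) (simp_all add: additive_subgroupI subgroup_I abelian_group_axioms)

lemma ideal_mult: "\<lbrakk>x \<in> carrier R; i \<in> I\<rbrakk> \<Longrightarrow> x \<otimes> i \<in> I" "\<lbrakk>x \<in> carrier R; i \<in> I\<rbrakk> \<Longrightarrow> i \<otimes> x \<in> I"
  using ideal by (simp_all add: two_sided_ideal_def)

text \<open>For representatives \<open>i \<oplus> x\<close> and \<open>y' = j \<oplus> y\<close> the
  product exceeds \<open>x \<otimes> y\<close> by
  \<open>i \<otimes> y' \<oplus> x \<otimes> j\<close>. Right absorption handles the first summand,
  left absorption the second.\<close>

lemma rcoset_mult_coset:
  assumes "x \<in> carrier R" "y \<in> carrier R"
  shows "rcoset_mult R I (I +> x) (I +> y) = I +> (x \<otimes> y)"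
  unfolding rcoset_mult_def
proof (rule UN_const)
  show "x \<in> I +> x"
    by (rule a_rcos_self) fact
  fix x' assume "x' \<in> I +> x"
  then obtain i where i: "i \<in> I" "x' = i \<oplus> x"
    by (auto simp: a_r_coset_def r_coset_def)
  show "(\<Union>b\<in>I +> y. I +> x' \<otimes> b) = I +> (x \<otimes> y)"
  proof (rule UN_const)
    show "y \<in> I +> y"
      by (rule a_rcos_self) fact
    fix y' assume "y' \<in> I +> y"
    then obtain j where j: "j \<in> I" "y' = j \<oplus> y"
      by (auto simp: a_r_coset_def r_coset_def)
    have y': "y' \<in> carrier R"
      using j assms by simp
    have "x' \<otimes> y' = i \<otimes> y' \<oplus> x \<otimes> y'"
      using i assms y' by (simp add: mult_l_distr)
    also have "x \<otimes> y' = x \<otimes> j \<oplus> x \<otimes> y"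
      using j assms by (simp add: mult_r_distr)
    finally have "x' \<otimes> y' = (i \<otimes> y' \<oplus> x \<otimes> j) \<oplus> x \<otimes> y"
      using i j(1) assms y' by (simp add: a_assoc)
    moreover have "i \<otimes> y' \<oplus> x \<otimes> j \<in> I"
      using i j assms by (intro a_closed ideal_mult) simp_all
    ultimately have "x' \<otimes> y' \<in> I +> (x \<otimes> y)"
      by (auto simp: a_r_coset_def r_coset_def)
    then show "I +> x' \<otimes> y' = I +> (x \<otimes> y)"
      using a_repr_independence[OF _ _ subgroup_I] assms by simp
  qed
qed

lemma coset_add: "\<lbrakk>x \<in> carrier R; y \<in> carrier R\<rbrakk> \<Longrightarrow> (I +> x) <+> (I +> y) = I +> (x \<oplus> y)"
  by (rule a_rcos_sum)

lemma quotient_cases: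
  assumes "X \<in> carrier (R Quot I)" obtains x where "x \<in> carrier R" "X = I +> x"
  using assms by (auto simp: FactRing_def A_RCOSETS_def' a_r_coset_def r_coset_def)

lemma quotient_closed: "x \<in> carrier R \<Longrightarrow> I +> x \<in> carrier (R Quot I)"
  by (simp add: FactRing_def a_rcosetsI a_subset)

lemma quotient_simps:
  "\<lbrakk>x \<in> carrier R; y \<in> carrier R\<rbrakk> \<Longrightarrow> (I +> x) \<otimes>\<^bsub>R Quot I\<^esub> (I +> y) = I +> (x \<otimes> y)"
  "\<lbrakk>x \<in> carrier R; y \<in> carrier R\<rbrakk> \<Longrightarrow> (I +> x) \<oplus>\<^bsub>R Quot I\<^esub> (I +> y) = I +> (x \<oplus> y)"
  by (simp_all add: FactRing_def rcoset_mult_coset coset_add)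

lemma nonunital_ring_quotient: "nonunital_ring (R Quot I)"
proof (intro nonunital_ring.intro nonunital_ring_axioms.intro)
  show "abelian_group (R Quot I)"
    by (rule comm_group_abelian_groupI)
      (simp add: FactRing_def a_factorgroup_is_comm_group[unfolded A_FactGroup_def'])
qed (auto elim!: quotient_cases simp: quotient_simps quotient_closed mult_assoc mult_l_distr mult_r_distr)

end

definition nonunital_ring_hom where
  "nonunital_ring_hom R S h \<longleftrightarrow> h \<in> hom (add_monoid R) (add_monoid S) \<and>
     (\<forall>x\<in>carrier R. \<forall>y\<in>carrier R. h (x \<otimes>\<^bsub>R\<^esub> y) = h x \<otimes>\<^bsub>S\<^esub> h y)"

lemma nonunital_ring_homD:
  assumes "nonunital_ring_hom R S h"
  shows "x \<in> carrier R \<Longrightarrow> h x \<in> carrier S"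
    "\<lbrakk>x \<in> carrier R; y \<in> carrier R\<rbrakk> \<Longrightarrow> h (x \<oplus>\<^bsub>R\<^esub> y) = h x \<oplus>\<^bsub>S\<^esub> h y"
    "\<lbrakk>x \<in> carrier R; y \<in> carrier R\<rbrakk> \<Longrightarrow> h (x \<otimes>\<^bsub>R\<^esub> y) = h x \<otimes>\<^bsub>S\<^esub> h y"
  using assms by (auto simp: nonunital_ring_hom_def hom_def)

lemma two_sided_ideal_kernel:
  assumes R: "nonunital_ring R" and S: "ring S" and h: "nonunital_ring_hom R S h"
  shows "two_sided_ideal R (a_kernel R S h)"
proof -
  interpret R: nonunital_ring R by fact
  interpret S: ring S by fact
  interpret h: group_hom "add_monoid R" "add_monoid S" h
    using h by (intro group_hom_intro R.a_comm_group S.a_comm_group) (simp add: nonunital_ring_hom_def)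
  show ?thesis
    unfolding two_sided_ideal_def a_kernel_def
    using h.subgroup_kernel by (simp add: kernel_iff nonunital_ring_homD[OF h])
qed

text \<open>Applied twice, from the free abelian group to \<open>F\<close> and from \<open>F\<close>
  to \<open>O\<close>. Constancy on cosets is what gives \<open>the_elem\<close> its
  meaning.\<close>

lemma nonunital_ring_hom_quotient:
  assumes R: "nonunital_ring R" and I: "two_sided_ideal R I" and S: "ring S"
    and h: "nonunital_ring_hom R S h" and hI: "I \<subseteq> a_kernel R S h"
  shows "x \<in> carrier R \<Longrightarrow> h ` (I +>\<^bsub>R\<^esub> x) = {h x}"
    "nonunital_ring_hom (R Quot I) S (\<lambda>X. the_elem (h ` X))"
proof -
  interpret nonunital_ideal I R
    by (intro nonunital_ideal.intro nonunital_ideal_axioms.intro R I)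
  interpret S: ring S by fact
  show coset: "h ` (I +>\<^bsub>R\<^esub> x) = {h x}" if x: "x \<in> carrier R" for x
  proof -
    have "h y = h x" if y: "y \<in> I +>\<^bsub>R\<^esub> x" for y
    proof -
      obtain i where i: "i \<in> I" "y = i \<oplus>\<^bsub>R\<^esub> x"
        using y by (auto simp: a_r_coset_def r_coset_def)
      moreover have "h i = \<zero>\<^bsub>S\<^esub>"
        using i hI unfolding a_kernel_def' by blast
      ultimately show ?thesis
        using x by (simp add: nonunital_ring_homD[OF h])
    qed
    then show ?thesis
      using a_rcos_self[OF x] by blast
  qed
  show "nonunital_ring_hom (R Quot I) S (\<lambda>X. the_elem (h ` X))"
    unfolding nonunital_ring_hom_def
  proof (intro conjI homI ballI)
    show "the_elem (h ` X) \<in> carrier (add_monoid S)" if "X \<in> carrier (add_monoid (R Quot I))" for X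
      using that by (auto elim!: quotient_cases simp: coset nonunital_ring_homD[OF h])
    show "the_elem (h ` (X \<otimes>\<^bsub>add_monoid (R Quot I)\<^esub> Y)) = the_elem (h ` X) \<otimes>\<^bsub>add_monoid S\<^esub> the_elem (h ` Y)"
      if "X \<in> carrier (add_monoid (R Quot I))" "Y \<in> carrier (add_monoid (R Quot I))" for X Y
      using that by (auto elim!: quotient_cases simp: quotient_simps coset nonunital_ring_homD[OF h])
    show "the_elem (h ` (X \<otimes>\<^bsub>R Quot I\<^esub> Y)) = the_elem (h ` X) \<otimes>\<^bsub>S\<^esub> the_elem (h ` Y)"
      if "X \<in> carrier (R Quot I)" "Y \<in> carrier (R Quot I)" for X Y
      using that by (auto elim!: quotient_cases simp: quotient_simps coset nonunital_ring_homD[OF h])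
  qed
qed

text \<open>The value on \<open>(n, u)\<close> is forced by sending \<open>(1, \<zero>)\<close> to
  the identity, and the product in \<open>int_unitization\<close> is the expansion of
  \<open>(n + r) (m + s)\<close>.\<close>

lemma int_unitization_ring_hom:
  assumes R: "nonunital_ring R" and S: "ring S" and h: "nonunital_ring_hom R S h"
  shows "(\<lambda>(n, u). add_pow S n \<one>\<^bsub>S\<^esub> \<oplus>\<^bsub>S\<^esub> h u) \<in> ring_hom (int_unitization R) S"
proof -
  interpret R: nonunital_ring R by fact
  interpret S: ring S by fact
  interpret h: group_hom "add_monoid R" "add_monoid S" h
    using h by (intro group_hom_intro R.a_comm_group S.a_comm_group) (simp add: nonunital_ring_hom_def)
  have pow: "h (add_pow R n r) = add_pow S n (h r)" if "r \<in> carrier R" for r and n :: int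
    using h.hom_int_pow[of r n] that by (simp add: add_pow_def)
  note hD = nonunital_ring_homD[OF h]
  show ?thesis
  proof (rule ring_hom_memI)
    fix x y assume x: "x \<in> carrier (int_unitization R)" and y: "y \<in> carrier (int_unitization R)"
    obtain n r m s where *: "x = (n, r)" "y = (m, s)" "r \<in> carrier R" "s \<in> carrier R"
      using x y by (auto simp: int_unitization_def)
    let ?h = "\<lambda>(n, u). add_pow S n \<one>\<^bsub>S\<^esub> \<oplus>\<^bsub>S\<^esub> h u"
    show "?h (x \<oplus>\<^bsub>int_unitization R\<^esub> y) = ?h x \<oplus>\<^bsub>S\<^esub> ?h y"
      using * by (simp add: int_unitization_def hD S.add.int_pow_mult S.a_ac)
    show "?h (x \<otimes>\<^bsub>int_unitization R\<^esub> y) = ?h x \<otimes>\<^bsub>S\<^esub> ?h y"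
      using * by (simp add: int_unitization_def hD pow S.l_distr S.r_distr S.add_pow_ldistr_int S.add_pow_rdistr_int
          S.add.int_pow_distrib S.add.int_pow_pow mult.commute S.a_ac)
  qed (auto simp: int_unitization_def hD h.hom_one[simplified])
qed

section \<open>The endomorphism ring\<close>

lemma (in comm_group) ring_End_ring: "ring (End_ring G)"
proof -
  let ?E = "End_ring G"
  \<comment> \<open>Endomorphisms are taken extensional, so their values on the carrier determine
    them and the ring axioms become pointwise identities in \<open>G\<close>.\<close>
  have ext: "f = g" if "f \<in> carrier ?E" "g \<in> carrier ?E" "\<And>x. x \<in> carrier G \<Longrightarrow> f x = g x" for f g
    using that by (auto simp: End_ring_def intro: extensionalityI)
  have homE: "f \<in> carrier ?E \<Longrightarrow> x \<in> carrier G \<Longrightarrow> f x \<in> carrier G"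
    "f \<in> carrier ?E \<Longrightarrow> x \<in> carrier G \<Longrightarrow> y \<in> carrier G \<Longrightarrow> f (x \<otimes> y) = f x \<otimes> f y" for f x y
    by (auto simp: End_ring_def hom_def)
  have addE: "f \<oplus>\<^bsub>?E\<^esub> g \<in> carrier ?E" "x \<in> carrier G \<Longrightarrow> (f \<oplus>\<^bsub>?E\<^esub> g) x = f x \<otimes> g x"
    if "f \<in> carrier ?E" "g \<in> carrier ?E" for f g x
    using that by (auto simp: End_ring_def hom_def Pi_iff m_ac)
  have multE: "f \<otimes>\<^bsub>?E\<^esub> g \<in> carrier ?E" "x \<in> carrier G \<Longrightarrow> (f \<otimes>\<^bsub>?E\<^esub> g) x = f (g x)"
    if "f \<in> carrier ?E" "g \<in> carrier ?E" for f g x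
    using that by (auto simp: End_ring_def hom_def compose_def Pi_iff)
  have oneE: "\<one>\<^bsub>?E\<^esub> \<in> carrier ?E" "x \<in> carrier G \<Longrightarrow> \<one>\<^bsub>?E\<^esub> x = x"
    "\<zero>\<^bsub>?E\<^esub> \<in> carrier ?E" "x \<in> carrier G \<Longrightarrow> \<zero>\<^bsub>?E\<^esub> x = \<one>" for x
    by (auto simp: End_ring_def hom_def)
  note E = homE addE multE oneE
  show ?thesis
  proof (rule ringI)
    show "abelian_group ?E"
    proof (rule abelian_groupI)
      fix f assume f: "f \<in> carrier ?E"
      let ?g = "\<lambda>x\<in>carrier G. inv (f x)"
      have g: "?g \<in> carrier ?E"
        using f by (auto simp: End_ring_def hom_def Pi_iff inv_mult)
      have "?g \<oplus>\<^bsub>?E\<^esub> f = \<zero>\<^bsub>?E\<^esub>"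
        by (rule ext) (use f g in \<open>simp_all add: E\<close>)
      then show "\<exists>g\<in>carrier ?E. g \<oplus>\<^bsub>?E\<^esub> f = \<zero>\<^bsub>?E\<^esub>"
        using g by blast
    next
      fix f g assume "f \<in> carrier ?E" "g \<in> carrier ?E"
      then show "f \<oplus>\<^bsub>?E\<^esub> g = g \<oplus>\<^bsub>?E\<^esub> f"
        by (intro ext) (simp_all add: E m_comm)
    qed (auto intro!: ext simp: E m_assoc)
    show "monoid ?E"
      by (rule monoidI) (auto intro!: ext simp: E)
  qed (auto intro!: ext simp: E)
qed

section \<open>Homomorphisms on free abelian groups\<close>

lemma free_Abelian_hom_diff:
  assumes "group G" "h \<in> hom (free_Abelian_group S) G"
    and "Poly_Mapping.keys p \<subseteq> S" "Poly_Mapping.keys q \<subseteq> S"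
  shows "h (p - q) = h p \<otimes>\<^bsub>G\<^esub> inv\<^bsub>G\<^esub> h q"
proof -
  interpret h: group_hom "free_Abelian_group S" G h
    using assms by (simp add: group_hom_def group_hom_axioms_def)
  have "p - q = p \<otimes>\<^bsub>free_Abelian_group S\<^esub> inv\<^bsub>free_Abelian_group S\<^esub> q"
    using assms by simp
  then show ?thesis
    using assms h.hom_mult[of p "inv\<^bsub>free_Abelian_group S\<^esub> q"] h.hom_inv[of q] h.G.inv_closed[of q] by simp
qed

lemma free_Abelian_hom_into:
  assumes G: "group G" and h: "h \<in> hom (free_Abelian_group S) G" and L: "subgroup L G"
    and gen: "\<And>s. s \<in> S \<Longrightarrow> h (frag_of s) \<in> L" and p: "Poly_Mapping.keys p \<subseteq> S"
  shows "h p \<in> L"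
  using p
proof (rule free_Abelian_group_induct)
  show "h 0 \<in> L"
    using hom_one[OF h group_free_Abelian_group G] subgroup.one_closed[OF L] by simp
qed (auto simp: free_Abelian_hom_diff[OF G h] gen intro: subgroup.m_closed[OF L] subgroup.m_inv_closed[OF L])

lemma free_Abelian_hom_eqI:
  assumes G: "group G" and h: "h \<in> hom (free_Abelian_group S) G" and h': "h' \<in> hom (free_Abelian_group S) G"
    and gen: "\<And>s. s \<in> S \<Longrightarrow> h (frag_of s) = h' (frag_of s)" and p: "Poly_Mapping.keys p \<subseteq> S"
  shows "h p = h' p"
  using p
proof (rule free_Abelian_group_induct)
  show "h 0 = h' 0"
    using hom_one[OF h group_free_Abelian_group G] hom_one[OF h' group_free_Abelian_group G] by simp
qed (auto simp: free_Abelian_hom_diff[OF G h] free_Abelian_hom_diff[OF G h'] gen)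

lemma (in comm_group) finprod_keys_hom:
  fixes f :: "'s \<Rightarrow> 'a"
  assumes f: "\<And>s. s \<in> S \<Longrightarrow> f s \<in> carrier G"
  defines "h \<equiv> \<lambda>p :: 's \<Rightarrow>\<^sub>0 int. finprod G (\<lambda>s. f s [^] Poly_Mapping.lookup p s) (Poly_Mapping.keys p)"
  shows "h \<in> hom (free_Abelian_group S) G" and "s \<in> S \<Longrightarrow> h (frag_of s) = f s"
proof -
  \<comment> \<open>Cancellation can make the support of a sum smaller than the union of the
    supports. The product is therefore first extended to a larger finite index set, where the added
    exponents are zero.\<close>
  have h: "h p = finprod G (\<lambda>s. f s [^] Poly_Mapping.lookup p s) V"
    if "finite V" "Poly_Mapping.keys p \<subseteq> V" "V \<subseteq> S" for p V
    unfolding h_def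
    by (rule finprod_mono_neutral_cong_left) (use that f in \<open>auto simp: in_keys_iff\<close>)
  show "h \<in> hom (free_Abelian_group S) G"
  proof (rule homI)
    fix p assume "p \<in> carrier (free_Abelian_group S)"
    then show "h p \<in> carrier G"
      using f unfolding h_def by (auto intro!: finprod_closed)
  next
    fix p q assume pq: "p \<in> carrier (free_Abelian_group S)" "q \<in> carrier (free_Abelian_group S)"
    define V where "V = Poly_Mapping.keys p \<union> Poly_Mapping.keys q"
    have V: "finite V" "Poly_Mapping.keys p \<subseteq> V" "Poly_Mapping.keys q \<subseteq> V" "Poly_Mapping.keys (p + q) \<subseteq> V" "V \<subseteq> S"
      using pq keys_add[of p q] by (auto simp: V_def)
    have fV: "f s \<in> carrier G" if "s \<in> V" for s
      using V f that by blast
    have "h (p + q) = finprod G (\<lambda>s. f s [^] Poly_Mapping.lookup p s \<otimes> f s [^] Poly_Mapping.lookup q s) V"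
      unfolding h[OF V(1,4,5)] by (rule finprod_cong') (use fV in \<open>auto simp: lookup_add int_pow_mult\<close>)
    also have "\<dots> = h p \<otimes> h q"
      unfolding h[OF V(1,2,5)] h[OF V(1,3,5)] by (rule finprod_multf) (use fV in auto)
    finally show "h (p \<otimes>\<^bsub>free_Abelian_group S\<^esub> q) = h p \<otimes> h q"
      by simp
  qed
  show "h (frag_of s) = f s" if "s \<in> S"
    unfolding h_def using f[OF that] by (simp add: finprod_singleton keys_frag_of)
qed

lemma frag_extend_add_fun:
  "frag_extend (\<lambda>s. f s + g s) p = frag_extend f p + frag_extend g p"
  by (simp add: frag_extend_def frag_cmul_distrib2 sum.distrib)

section \<open>The operator rings are rings\<close>

lemma two_sided_ideal_Inter:
  assumes "group (add_monoid R)" "\<I> \<noteq> {}" "\<And>I. I \<in> \<I> \<Longrightarrow> two_sided_ideal R I"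
  shows "two_sided_ideal R (\<Inter>\<I>)"
  using assms group.subgroups_Inter[of "add_monoid R" \<I>] unfolding two_sided_ideal_def by blast

context ternary_gamma_ring
begin

lemma tp_closed [simp, intro]:
  "\<lbrakk>x \<in> carrier T; \<alpha> \<in> carrier \<Gamma>; y \<in> carrier T; \<beta> \<in> carrier \<Gamma>; z \<in> carrier T\<rbrakk> \<Longrightarrow> tp x \<alpha> y \<beta> z \<in> carrier T"
  using hom_in_carrier[OF additive1, of \<alpha> y \<beta> z x] by simp

lemma tp_add:
  "\<lbrakk>x \<in> carrier T; x' \<in> carrier T; \<alpha> \<in> carrier \<Gamma>; y \<in> carrier T; \<beta> \<in> carrier \<Gamma>; z \<in> carrier T\<rbrakk>
    \<Longrightarrow> tp (x \<otimes>\<^bsub>T\<^esub> x') \<alpha> y \<beta> z = tp x \<alpha> y \<beta> z \<otimes>\<^bsub>T\<^esub> tp x' \<alpha> y \<beta> z"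
  "\<lbrakk>x \<in> carrier T; \<alpha> \<in> carrier \<Gamma>; \<alpha>' \<in> carrier \<Gamma>; y \<in> carrier T; \<beta> \<in> carrier \<Gamma>; z \<in> carrier T\<rbrakk>
    \<Longrightarrow> tp x (\<alpha> \<otimes>\<^bsub>\<Gamma>\<^esub> \<alpha>') y \<beta> z = tp x \<alpha> y \<beta> z \<otimes>\<^bsub>T\<^esub> tp x \<alpha>' y \<beta> z"
  "\<lbrakk>x \<in> carrier T; \<alpha> \<in> carrier \<Gamma>; y \<in> carrier T; y' \<in> carrier T; \<beta> \<in> carrier \<Gamma>; z \<in> carrier T\<rbrakk>
    \<Longrightarrow> tp x \<alpha> (y \<otimes>\<^bsub>T\<^esub> y') \<beta> z = tp x \<alpha> y \<beta> z \<otimes>\<^bsub>T\<^esub> tp x \<alpha> y' \<beta> z"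
  "\<lbrakk>x \<in> carrier T; \<alpha> \<in> carrier \<Gamma>; y \<in> carrier T; \<beta> \<in> carrier \<Gamma>; \<beta>' \<in> carrier \<Gamma>; z \<in> carrier T\<rbrakk>
    \<Longrightarrow> tp x \<alpha> y (\<beta> \<otimes>\<^bsub>\<Gamma>\<^esub> \<beta>') z = tp x \<alpha> y \<beta> z \<otimes>\<^bsub>T\<^esub> tp x \<alpha> y \<beta>' z"
  "\<lbrakk>x \<in> carrier T; \<alpha> \<in> carrier \<Gamma>; y \<in> carrier T; \<beta> \<in> carrier \<Gamma>; z \<in> carrier T; z' \<in> carrier T\<rbrakk>
    \<Longrightarrow> tp x \<alpha> y \<beta> (z \<otimes>\<^bsub>T\<^esub> z') = tp x \<alpha> y \<beta> z \<otimes>\<^bsub>T\<^esub> tp x \<alpha> y \<beta> z'"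
  using additive1 additive2 additive3 additive4 additive5 by (simp_all add: hom_def)

section \<open>The multiplication on the free abelian group of quadruples\<close>

abbreviation Q where "Q \<equiv> carrier T \<times> carrier \<Gamma> \<times> carrier T \<times> carrier \<Gamma>"
abbreviation FG where "FG \<equiv> free_Abelian_group Q"
abbreviation QS where "QS \<equiv> quad_subgroup T \<Gamma>"
abbreviation E where "E \<equiv> End_ring T"

text \<open>The product is bilinear and associative even before the tensor relations are imposed. So
  \<open>F\<close>, and then \<open>O\<close>, can be treated as the quotient of a nonunital ring by
  an ideal, which settles well-definedness of their products.\<close>

definition free_ring where
  "free_ring = \<lparr>carrier = carrier FG, mult = quad_mult tp, one = undefined, zero = 0, add = (+)\<rparr>"

lemma free_ring_simps [simp]:
  "carrier free_ring = carrier FG" "mult free_ring = quad_mult tp" "zero free_ring = 0" "add free_ring = (+)"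
  by (simp_all add: free_ring_def)

lemma add_monoid_free_ring: "add_monoid free_ring = FG"
  by (simp add: free_Abelian_group_def free_ring_def)

lemma free_group_record: "\<lparr>carrier = carrier FG, mult = (+), one = 0\<rparr> = FG"
  by (simp add: free_Abelian_group_def)

lemma quad_mult_add_left: "quad_mult tp (p + p') q = quad_mult tp p q + quad_mult tp p' q"
  by (simp add: quad_mult_def frag_extend_add)

lemma quad_mult_add_right: "quad_mult tp p (q + q') = quad_mult tp p q + quad_mult tp p q'"
proof -
  have "(\<lambda>(a, \<alpha>, b, \<beta>). frag_extend (\<lambda>(c, \<gamma>, d, \<delta>). frag_of (tp a \<alpha> b \<beta> c, \<gamma>, d, \<delta>)) (q + q')) =
    (\<lambda>s. (\<lambda>(a, \<alpha>, b, \<beta>). frag_extend (\<lambda>(c, \<gamma>, d, \<delta>). frag_of (tp a \<alpha> b \<beta> c, \<gamma>, d, \<delta>)) q) s +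
      (\<lambda>(a, \<alpha>, b, \<beta>). frag_extend (\<lambda>(c, \<gamma>, d, \<delta>). frag_of (tp a \<alpha> b \<beta> c, \<gamma>, d, \<delta>)) q') s)"
    by (auto simp: fun_eq_iff frag_extend_add)
  then show ?thesis
    by (simp add: quad_mult_def frag_extend_add_fun)
qed

lemma quad_mult_frag_of [simp]:
  "quad_mult tp (frag_of (a, \<alpha>, b, \<beta>)) (frag_of (c, \<gamma>, d, \<delta>)) = frag_of (tp a \<alpha> b \<beta> c, \<gamma>, d, \<delta>)"
  by (simp add: quad_mult_def)

lemma quad_mult_closed:
  assumes p: "Poly_Mapping.keys p \<subseteq> Q" and q: "Poly_Mapping.keys q \<subseteq> Q"
  shows "Poly_Mapping.keys (quad_mult tp p q) \<subseteq> Q"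
proof -
  have inner: "Poly_Mapping.keys (frag_extend (\<lambda>(c, \<gamma>, d, \<delta>). frag_of (tp a \<alpha> b \<beta> c, \<gamma>, d, \<delta>)) q) \<subseteq> Q"
    if "(a, \<alpha>, b, \<beta>) \<in> Q" for a \<alpha> b \<beta>
  proof -
    have "Poly_Mapping.keys (frag_extend (\<lambda>(c, \<gamma>, d, \<delta>). frag_of (tp a \<alpha> b \<beta> c, \<gamma>, d, \<delta>)) q)
      \<subseteq> (\<Union>s\<in>Poly_Mapping.keys q. Poly_Mapping.keys ((\<lambda>(c, \<gamma>, d, \<delta>). frag_of (tp a \<alpha> b \<beta> c, \<gamma>, d, \<delta>)) s))"
      by (rule keys_frag_extend)
    also have "\<dots> \<subseteq> Q"
      using q that by (force simp: keys_frag_of)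
    finally show ?thesis .
  qed
  let ?f = "\<lambda>(a, \<alpha>, b, \<beta>). frag_extend (\<lambda>(c, \<gamma>, d, \<delta>). frag_of (tp a \<alpha> b \<beta> c, \<gamma>, d, \<delta>)) q"
  have "Poly_Mapping.keys (quad_mult tp p q) \<subseteq> (\<Union>s\<in>Poly_Mapping.keys p. Poly_Mapping.keys (?f s))"
    unfolding quad_mult_def by (rule keys_frag_extend)
  also have "\<dots> \<subseteq> Q"
  proof (rule UN_least)
    fix s assume "s \<in> Poly_Mapping.keys p"
    then have "s \<in> Q" using p by blast
    then show "Poly_Mapping.keys (?f s) \<subseteq> Q"
      using inner by (cases s) simp
  qed
  finally show ?thesis .
qed

lemma quad_mult_left_hom: "Poly_Mapping.keys q \<subseteq> Q \<Longrightarrow> (\<lambda>p. quad_mult tp p q) \<in> hom FG FG"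
  by (simp add: hom_def quad_mult_add_left quad_mult_closed Pi_iff)

lemma quad_mult_right_hom: "Poly_Mapping.keys p \<subseteq> Q \<Longrightarrow> quad_mult tp p \<in> hom FG FG"
  by (simp add: hom_def quad_mult_add_right quad_mult_closed Pi_iff)

text \<open>Both sides are additive in each variable, which leaves the generators. There the claim
  is \<open>(a\<alpha>b\<beta>c)\<gamma>d\<delta>e = a\<alpha>b\<beta>(c\<gamma>d\<delta>e)\<close>,
  the composite of the two associativity laws.\<close>

lemma quad_mult_assoc:
  assumes p: "Poly_Mapping.keys p \<subseteq> Q" and q: "Poly_Mapping.keys q \<subseteq> Q" and r: "Poly_Mapping.keys r \<subseteq> Q"
  shows "quad_mult tp (quad_mult tp p q) r = quad_mult tp p (quad_mult tp q r)"
proof (rule free_Abelian_hom_eqI[OF group_free_Abelian_group _ _ _ p])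
  show "(\<lambda>p. quad_mult tp (quad_mult tp p q) r) \<in> hom FG FG" "(\<lambda>p. quad_mult tp p (quad_mult tp q r)) \<in> hom FG FG"
    using p q r by (simp_all add: hom_def quad_mult_add_left quad_mult_closed Pi_iff)
  fix s assume s: "s \<in> Q"
  then have sk: "Poly_Mapping.keys (frag_of s) \<subseteq> Q"
    by (simp add: keys_frag_of)
  show "quad_mult tp (quad_mult tp (frag_of s) q) r = quad_mult tp (frag_of s) (quad_mult tp q r)"
  proof (rule free_Abelian_hom_eqI[OF group_free_Abelian_group _ _ _ q])
    show "(\<lambda>q. quad_mult tp (quad_mult tp (frag_of s) q) r) \<in> hom FG FG"
      "(\<lambda>q. quad_mult tp (frag_of s) (quad_mult tp q r)) \<in> hom FG FG"
      using sk r by (simp_all add: hom_def quad_mult_add_left quad_mult_add_right quad_mult_closed Pi_iff)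
    fix t assume t: "t \<in> Q"
    then have tk: "Poly_Mapping.keys (frag_of t) \<subseteq> Q"
      by (simp add: keys_frag_of)
    show "quad_mult tp (quad_mult tp (frag_of s) (frag_of t)) r = quad_mult tp (frag_of s) (quad_mult tp (frag_of t) r)"
    proof (rule free_Abelian_hom_eqI[OF group_free_Abelian_group _ _ _ r])
      show "(\<lambda>r. quad_mult tp (quad_mult tp (frag_of s) (frag_of t)) r) \<in> hom FG FG"
        "(\<lambda>r. quad_mult tp (frag_of s) (quad_mult tp (frag_of t) r)) \<in> hom FG FG"
        using sk tk by (simp_all add: hom_def quad_mult_add_right quad_mult_closed Pi_iff)
      fix v assume v: "v \<in> Q"
      show "quad_mult tp (quad_mult tp (frag_of s) (frag_of t)) (frag_of v)
        = quad_mult tp (frag_of s) (quad_mult tp (frag_of t) (frag_of v))"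
        using s t v by (cases s; cases t; cases v) (simp add: assoc_left assoc_right)
    qed
  qed
qed

lemma nonunital_ring_free_ring: "nonunital_ring free_ring"
proof (intro nonunital_ring.intro nonunital_ring_axioms.intro)
  show "abelian_group free_ring"
    by (rule comm_group_abelian_groupI) (simp only: add_monoid_free_ring abelian_free_Abelian_group)
qed (simp_all add: quad_mult_closed quad_mult_assoc quad_mult_add_left quad_mult_add_right)

section \<open>The subgroup of tensor relations as a two-sided ideal\<close>

lemma quad_relatorsI:
  "\<lbrakk>a \<in> carrier T; a' \<in> carrier T; \<alpha> \<in> carrier \<Gamma>; b \<in> carrier T; \<beta> \<in> carrier \<Gamma>\<rbrakk>
    \<Longrightarrow> frag_of (a \<otimes>\<^bsub>T\<^esub> a', \<alpha>, b, \<beta>) - frag_of (a, \<alpha>, b, \<beta>) - frag_of (a', \<alpha>, b, \<beta>) \<in> quad_relators T \<Gamma>"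
  "\<lbrakk>a \<in> carrier T; \<alpha> \<in> carrier \<Gamma>; \<alpha>' \<in> carrier \<Gamma>; b \<in> carrier T; \<beta> \<in> carrier \<Gamma>\<rbrakk>
    \<Longrightarrow> frag_of (a, \<alpha> \<otimes>\<^bsub>\<Gamma>\<^esub> \<alpha>', b, \<beta>) - frag_of (a, \<alpha>, b, \<beta>) - frag_of (a, \<alpha>', b, \<beta>) \<in> quad_relators T \<Gamma>"
  "\<lbrakk>a \<in> carrier T; \<alpha> \<in> carrier \<Gamma>; b \<in> carrier T; b' \<in> carrier T; \<beta> \<in> carrier \<Gamma>\<rbrakk>
    \<Longrightarrow> frag_of (a, \<alpha>, b \<otimes>\<^bsub>T\<^esub> b', \<beta>) - frag_of (a, \<alpha>, b, \<beta>) - frag_of (a, \<alpha>, b', \<beta>) \<in> quad_relators T \<Gamma>"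
  "\<lbrakk>a \<in> carrier T; \<alpha> \<in> carrier \<Gamma>; b \<in> carrier T; \<beta> \<in> carrier \<Gamma>; \<beta>' \<in> carrier \<Gamma>\<rbrakk>
    \<Longrightarrow> frag_of (a, \<alpha>, b, \<beta> \<otimes>\<^bsub>\<Gamma>\<^esub> \<beta>') - frag_of (a, \<alpha>, b, \<beta>) - frag_of (a, \<alpha>, b, \<beta>') \<in> quad_relators T \<Gamma>"
  unfolding quad_relators_def by blast+

lemma quad_relatorsE [consumes 1, case_names first second third fourth]:
  assumes "r \<in> quad_relators T \<Gamma>"
  obtains a a' \<alpha> b \<beta> where
      "r = frag_of (a \<otimes>\<^bsub>T\<^esub> a', \<alpha>, b, \<beta>) - frag_of (a, \<alpha>, b, \<beta>) - frag_of (a', \<alpha>, b, \<beta>)"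
      "a \<in> carrier T" "a' \<in> carrier T" "\<alpha> \<in> carrier \<Gamma>" "b \<in> carrier T" "\<beta> \<in> carrier \<Gamma>"
    | a \<alpha> \<alpha>' b \<beta> where
      "r = frag_of (a, \<alpha> \<otimes>\<^bsub>\<Gamma>\<^esub> \<alpha>', b, \<beta>) - frag_of (a, \<alpha>, b, \<beta>) - frag_of (a, \<alpha>', b, \<beta>)"
      "a \<in> carrier T" "\<alpha> \<in> carrier \<Gamma>" "\<alpha>' \<in> carrier \<Gamma>" "b \<in> carrier T" "\<beta> \<in> carrier \<Gamma>"
    | a \<alpha> b b' \<beta> where
      "r = frag_of (a, \<alpha>, b \<otimes>\<^bsub>T\<^esub> b', \<beta>) - frag_of (a, \<alpha>, b, \<beta>) - frag_of (a, \<alpha>, b', \<beta>)"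
      "a \<in> carrier T" "\<alpha> \<in> carrier \<Gamma>" "b \<in> carrier T" "b' \<in> carrier T" "\<beta> \<in> carrier \<Gamma>"
    | a \<alpha> b \<beta> \<beta>' where
      "r = frag_of (a, \<alpha>, b, \<beta> \<otimes>\<^bsub>\<Gamma>\<^esub> \<beta>') - frag_of (a, \<alpha>, b, \<beta>) - frag_of (a, \<alpha>, b, \<beta>')"
      "a \<in> carrier T" "\<alpha> \<in> carrier \<Gamma>" "b \<in> carrier T" "\<beta> \<in> carrier \<Gamma>" "\<beta>' \<in> carrier \<Gamma>"
  using assms unfolding quad_relators_def by blast

lemma quad_relators_subset: "quad_relators T \<Gamma> \<subseteq> carrier FG"
proof
  fix r assume "r \<in> quad_relators T \<Gamma>"
  then show "r \<in> carrier FG"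
    by (cases rule: quad_relatorsE) (auto simp: keys_frag_of dest!: subsetD[OF keys_diff])
qed

lemma QS_generate: "QS = generate FG (quad_relators T \<Gamma>)"
  by (simp add: quad_subgroup_def quad_group_def)

lemma subgroup_QS: "subgroup QS FG"
  unfolding QS_generate by (rule group.generate_is_subgroup[OF group_free_Abelian_group quad_relators_subset])

lemma quad_relator_in_QS: "r \<in> quad_relators T \<Gamma> \<Longrightarrow> r \<in> QS"
  unfolding QS_generate by (rule generate.incl)

lemma quad_mult_diff:
  "quad_mult tp (p - p') q = quad_mult tp p q - quad_mult tp p' q"
  "quad_mult tp p (q - q') = quad_mult tp p q - quad_mult tp p q'"
  using quad_mult_add_left[of "p - p'" p' q] by simp (use quad_mult_add_right[of p "q - q'" q'] in simp)

text \<open>Left multiplication by a generator keeps a relator in its slot: the first slot needs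
  additivity of \<open>tp\<close> in the last argument, the others are untouched. Right
  multiplication absorbs all four slots into the first, by additivity of \<open>tp\<close> in its
  first four arguments.\<close>

lemma quad_mult_relator:
  assumes r: "r \<in> quad_relators T \<Gamma>" and s: "s \<in> Q"
  shows "quad_mult tp (frag_of s) r \<in> quad_relators T \<Gamma>" "quad_mult tp r (frag_of s) \<in> quad_relators T \<Gamma>"
proof -
  obtain c \<gamma> d \<delta> where s: "s = (c, \<gamma>, d, \<delta>)" "c \<in> carrier T" "\<gamma> \<in> carrier \<Gamma>" "d \<in> carrier T" "\<delta> \<in> carrier \<Gamma>"
    using s by blast
  show "quad_mult tp (frag_of s) r \<in> quad_relators T \<Gamma>"
    using r by (cases rule: quad_relatorsE) (use s in \<open>simp_all add: quad_mult_diff tp_add quad_relatorsI\<close>)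
  show "quad_mult tp r (frag_of s) \<in> quad_relators T \<Gamma>"
    using r by (cases rule: quad_relatorsE) (use s in \<open>simp_all add: quad_mult_diff tp_add quad_relatorsI\<close>)
qed

text \<open>Bilinearity reduces the claim in two stages, from \<open>i\<close> to the relators and
  from \<open>p\<close> to the generators.\<close>

lemma two_sided_ideal_QS: "two_sided_ideal free_ring QS"
  unfolding two_sided_ideal_def add_monoid_free_ring
proof (intro conjI ballI subgroup_QS)
  fix p i assume p: "p \<in> carrier free_ring" and i: "i \<in> QS"
  then have pk: "Poly_Mapping.keys p \<subseteq> Q"
    by simp
  have rk: "Poly_Mapping.keys r \<subseteq> Q" if "r \<in> quad_relators T \<Gamma>" for r
    using subsetD[OF quad_relators_subset that] by simp
  have "quad_mult tp p i \<in> QS"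
  proof (rule hom_generate_subset[OF group_free_Abelian_group group_free_Abelian_group
        quad_mult_right_hom[OF pk] quad_relators_subset subgroup_QS])
    show "quad_mult tp p r \<in> QS" if r: "r \<in> quad_relators T \<Gamma>" for r
      by (rule free_Abelian_hom_into[OF group_free_Abelian_group quad_mult_left_hom[OF rk[OF r]] subgroup_QS _ pk])
         (use r in \<open>simp add: quad_mult_relator quad_relator_in_QS\<close>)
  qed (use i in \<open>simp add: QS_generate\<close>)
  moreover have "quad_mult tp i p \<in> QS"
  proof (rule hom_generate_subset[OF group_free_Abelian_group group_free_Abelian_group
        quad_mult_left_hom[OF pk] quad_relators_subset subgroup_QS])
    show "quad_mult tp r p \<in> QS" if r: "r \<in> quad_relators T \<Gamma>" for r
      by (rule free_Abelian_hom_into[OF group_free_Abelian_group quad_mult_right_hom[OF rk[OF r]] subgroup_QS _ pk])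
         (use r in \<open>simp add: quad_mult_relator quad_relator_in_QS\<close>)
  qed (use i in \<open>simp add: QS_generate\<close>)
  ultimately show "p \<otimes>\<^bsub>free_ring\<^esub> i \<in> QS" "i \<otimes>\<^bsub>free_ring\<^esub> p \<in> QS"
    by simp_all
qed

section \<open>The ring \<open>F\<close> and the representation on the free abelian group\<close>

abbreviation F where "F \<equiv> F_ring T \<Gamma> tp"
abbreviation J where "J \<equiv> J_ideal T \<Gamma> tp"
abbreviation rho0 where "rho0 \<equiv> free_rho T tp"
abbreviation rhoF where "rhoF X \<equiv> the_elem (rho0 ` X)"

lemma F_ring_eq: "F = (free_ring Quot QS)\<lparr>one := undefined\<rparr>"
  by (simp add: F_ring_def FactRing_def FactGroup_def quad_group_def A_RCOSETS_def a_r_coset_def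
      set_add_def free_group_record rcoset_mult_def[abs_def] fun_eq_iff)

lemma nonunital_ideal_QS: "nonunital_ideal QS free_ring"
  by (intro nonunital_ideal.intro nonunital_ideal_axioms.intro nonunital_ring_free_ring two_sided_ideal_QS)

lemma nonunital_ring_F: "nonunital_ring F"
  unfolding F_ring_eq
  by (rule nonunital_ring_one_update[OF nonunital_ideal.nonunital_ring_quotient[OF nonunital_ideal_QS]])

lemma ring_E: "ring E"
  by (rule T.ring_End_ring)

text \<open>Evaluation at a fixed \<open>x\<close> turns \<open>rho0\<close> into a homomorphism to
  \<open>T\<close>, determined on generators. Identities between endomorphisms are checked on
  generators in this way, one argument at a time.\<close>

lemma rho0_apply_hom:
  assumes x: "x \<in> carrier T"
  shows "(\<lambda>p. rho0 p x) \<in> hom FG T"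
    and "\<lbrakk>a \<in> carrier T; \<alpha> \<in> carrier \<Gamma>; b \<in> carrier T; \<beta> \<in> carrier \<Gamma>\<rbrakk> \<Longrightarrow> rho0 (frag_of (a, \<alpha>, b, \<beta>)) x = tp a \<alpha> b \<beta> x"
proof -
  let ?f = "\<lambda>(a, \<alpha>, b, \<beta>). tp a \<alpha> b \<beta> x"
  have f: "?f s \<in> carrier T" if "s \<in> Q" for s
    using that x by auto
  have "(\<lambda>p. rho0 p x) = (\<lambda>p. finprod T (\<lambda>s. ?f s [^]\<^bsub>T\<^esub> Poly_Mapping.lookup p s) (Poly_Mapping.keys p))"
  proof (intro ext)
    fix p :: "'t \<times> 'g \<times> 't \<times> 'g \<Rightarrow>\<^sub>0 int"
    have "(\<lambda>(a, \<alpha>, b, \<beta>). tp a \<alpha> b \<beta> x [^]\<^bsub>T\<^esub> Poly_Mapping.lookup p (a, \<alpha>, b, \<beta>)) =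
        (\<lambda>s. ?f s [^]\<^bsub>T\<^esub> Poly_Mapping.lookup p s)"
      by auto
    then show "rho0 p x = finprod T (\<lambda>s. ?f s [^]\<^bsub>T\<^esub> Poly_Mapping.lookup p s) (Poly_Mapping.keys p)"
      using x by (simp add: free_rho_def)
  qed
  note eq = this
  show "(\<lambda>p. rho0 p x) \<in> hom FG T"
    unfolding eq by (rule T.finprod_keys_hom(1)) (rule f)
  show "rho0 (frag_of (a, \<alpha>, b, \<beta>)) x = tp a \<alpha> b \<beta> x"
    if "a \<in> carrier T" "\<alpha> \<in> carrier \<Gamma>" "b \<in> carrier T" "\<beta> \<in> carrier \<Gamma>"
  proof -
    have "(a, \<alpha>, b, \<beta>) \<in> Q"
      using that by simp
    with fun_cong[OF eq, of "frag_of (a, \<alpha>, b, \<beta>)"] show ?thesis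
      using T.finprod_keys_hom(2)[of Q ?f, OF f] by (simp only: prod.case)
  qed
qed

lemma rho0_closed: "\<lbrakk>Poly_Mapping.keys p \<subseteq> Q; x \<in> carrier T\<rbrakk> \<Longrightarrow> rho0 p x \<in> carrier T"
  using rho0_apply_hom(1)[of x] by (simp add: hom_def Pi_iff)

lemma rho0_in_E:
  assumes p: "Poly_Mapping.keys p \<subseteq> Q" shows "rho0 p \<in> carrier E"
proof -
  have "rho0 p (x \<otimes>\<^bsub>T\<^esub> y) = rho0 p x \<otimes>\<^bsub>T\<^esub> rho0 p y" if x: "x \<in> carrier T" and y: "y \<in> carrier T" for x y
  proof (rule free_Abelian_hom_eqI[OF T.is_group rho0_apply_hom(1) _ _ p])
    show "x \<otimes>\<^bsub>T\<^esub> y \<in> carrier T"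
      using x y by simp
    show "(\<lambda>p. rho0 p x \<otimes>\<^bsub>T\<^esub> rho0 p y) \<in> hom FG T"
      using rho0_apply_hom(1)[OF x] rho0_apply_hom(1)[OF y] x y
      by (auto simp: hom_def Pi_iff T.m_ac)
    show "rho0 (frag_of s) (x \<otimes>\<^bsub>T\<^esub> y) = rho0 (frag_of s) x \<otimes>\<^bsub>T\<^esub> rho0 (frag_of s) y" if "s \<in> Q" for s
      using that x y by (auto simp: rho0_apply_hom(2) tp_add)
  qed
  then show ?thesis
    using rho0_closed[OF p] by (simp add: End_ring_def hom_def Pi_iff) (simp add: free_rho_def)
qed

lemma E_ext: "\<lbrakk>f \<in> carrier E; g \<in> carrier E; \<And>x. x \<in> carrier T \<Longrightarrow> f x = g x\<rbrakk> \<Longrightarrow> f = g"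
  by (auto simp: End_ring_def intro: extensionalityI)

text \<open>On generators this is \<open>(a\<alpha>b\<beta>c)\<gamma>d\<delta>x =
  a\<alpha>b\<beta>(c\<gamma>d\<delta>x)\<close>. The reduction in \<open>q\<close> uses that
  \<open>tp\<close> is additive in its last argument.\<close>

lemma rho0_mult_apply:
  assumes p: "Poly_Mapping.keys p \<subseteq> Q" and q: "Poly_Mapping.keys q \<subseteq> Q" and x: "x \<in> carrier T"
  shows "rho0 (quad_mult tp p q) x = rho0 p (rho0 q x)"
proof (rule free_Abelian_hom_eqI[OF T.is_group _ rho0_apply_hom(1) _ p])
  show "rho0 q x \<in> carrier T"
    by (rule rho0_closed[OF q x])
  show "(\<lambda>p. rho0 (quad_mult tp p q) x) \<in> hom FG T"
    using hom_compose[OF quad_mult_left_hom[OF q] rho0_apply_hom(1)[OF x]] by (simp add: comp_def)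
  fix s assume s: "s \<in> Q"
  then obtain a \<alpha> b \<beta> where *: "s = (a, \<alpha>, b, \<beta>)" "a \<in> carrier T" "\<alpha> \<in> carrier \<Gamma>" "b \<in> carrier T" "\<beta> \<in> carrier \<Gamma>"
    by blast
  have sk: "Poly_Mapping.keys (frag_of s) \<subseteq> Q"
    using s by (simp add: keys_frag_of)
  have "rho0 (quad_mult tp (frag_of s) q) x = tp a \<alpha> b \<beta> (rho0 q x)"
  proof (rule free_Abelian_hom_eqI[OF T.is_group _ _ _ q])
    show "(\<lambda>q. rho0 (quad_mult tp (frag_of s) q) x) \<in> hom FG T"
      using hom_compose[OF quad_mult_right_hom[OF sk] rho0_apply_hom(1)[OF x]] by (simp add: comp_def)
    show "(\<lambda>q. tp a \<alpha> b \<beta> (rho0 q x)) \<in> hom FG T"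
      using hom_compose[OF rho0_apply_hom(1)[OF x] additive5[OF *(2-5)]] by (simp add: comp_def)
    show "rho0 (quad_mult tp (frag_of s) (frag_of t)) x = tp a \<alpha> b \<beta> (rho0 (frag_of t) x)" if "t \<in> Q" for t
      using that * x by (cases t) (simp add: rho0_apply_hom(2) assoc_left assoc_right)
  qed
  then show "rho0 (quad_mult tp (frag_of s) q) x = rho0 (frag_of s) (rho0 q x)"
    using * rho0_closed[OF q x] by (simp add: rho0_apply_hom(2))
qed

lemma rho0_hom: "nonunital_ring_hom free_ring E rho0"
proof -
  interpret E: ring E by (rule ring_E)
  show ?thesis
    unfolding nonunital_ring_hom_def add_monoid_free_ring
  proof (intro conjI homI ballI)
    show "rho0 p \<in> carrier (add_monoid E)" if "p \<in> carrier FG" for p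
      using that rho0_in_E by simp
    show "rho0 (p \<otimes>\<^bsub>FG\<^esub> q) = rho0 p \<otimes>\<^bsub>add_monoid E\<^esub> rho0 q" if "p \<in> carrier FG" "q \<in> carrier FG" for p q
    proof (rule E_ext)
      show "rho0 (p \<otimes>\<^bsub>FG\<^esub> q) \<in> carrier E"
        using that by (intro rho0_in_E) (auto dest!: subsetD[OF keys_add])
      show "rho0 p \<otimes>\<^bsub>add_monoid E\<^esub> rho0 q \<in> carrier E"
        using that rho0_in_E by simp
      show "rho0 (p \<otimes>\<^bsub>FG\<^esub> q) x = (rho0 p \<otimes>\<^bsub>add_monoid E\<^esub> rho0 q) x" if x: "x \<in> carrier T" for x
        using hom_mult[OF rho0_apply_hom(1)[OF x] \<open>p \<in> carrier FG\<close> \<open>q \<in> carrier FG\<close>] x by (simp add: End_ring_def)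
    qed
    show "rho0 (p \<otimes>\<^bsub>free_ring\<^esub> q) = rho0 p \<otimes>\<^bsub>E\<^esub> rho0 q" if "p \<in> carrier free_ring" "q \<in> carrier free_ring" for p q
    proof (rule E_ext)
      show "rho0 (p \<otimes>\<^bsub>free_ring\<^esub> q) \<in> carrier E"
        using that by (intro rho0_in_E) (simp add: quad_mult_closed)
      show "rho0 p \<otimes>\<^bsub>E\<^esub> rho0 q \<in> carrier E"
        using that rho0_in_E by simp
      show "rho0 (p \<otimes>\<^bsub>free_ring\<^esub> q) x = (rho0 p \<otimes>\<^bsub>E\<^esub> rho0 q) x" if x: "x \<in> carrier T" for x
        using rho0_mult_apply \<open>p \<in> carrier free_ring\<close> \<open>q \<in> carrier free_ring\<close> x by (simp add: End_ring_def compose_def)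
    qed
  qed
qed

text \<open>Each kind of relator acts as zero because \<open>tp\<close> is additive in the
  corresponding one of its first four arguments.\<close>

lemma QS_kernel: "QS \<subseteq> a_kernel free_ring E rho0"
proof
  interpret E: ring E by (rule ring_E)
  fix i assume i: "i \<in> QS"
  have h: "rho0 \<in> hom FG (add_monoid E)"
    using rho0_hom by (simp add: nonunital_ring_hom_def free_group_record)
  have "rho0 i \<in> {\<one>\<^bsub>add_monoid E\<^esub>}"
  proof (rule hom_generate_subset[OF group_free_Abelian_group E.a_group h quad_relators_subset subgroup_trivial[OF E.a_group]])
    fix r assume r: "r \<in> quad_relators T \<Gamma>"
    have "rho0 r = \<zero>\<^bsub>E\<^esub>"
    proof (rule E_ext)
      show "rho0 r \<in> carrier E"
        using subsetD[OF quad_relators_subset r] by (intro rho0_in_E) simp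
      show "\<zero>\<^bsub>E\<^esub> \<in> carrier E"
        by simp
      fix x assume x: "x \<in> carrier T"
      have diff: "rho0 (u - v - w) x = rho0 u x \<otimes>\<^bsub>T\<^esub> inv\<^bsub>T\<^esub> rho0 v x \<otimes>\<^bsub>T\<^esub> inv\<^bsub>T\<^esub> rho0 w x"
        if "Poly_Mapping.keys u \<subseteq> Q" "Poly_Mapping.keys v \<subseteq> Q" "Poly_Mapping.keys w \<subseteq> Q" for u v w
        using that subset_trans[OF keys_diff[of u v]] free_Abelian_hom_diff[OF T.is_group rho0_apply_hom(1)[OF x]]
        by simp
      have cancel: "y \<otimes>\<^bsub>T\<^esub> z \<otimes>\<^bsub>T\<^esub> inv\<^bsub>T\<^esub> y \<otimes>\<^bsub>T\<^esub> inv\<^bsub>T\<^esub> z = \<one>\<^bsub>T\<^esub>" if "y \<in> carrier T" "z \<in> carrier T" for y z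
        using that by (metis T.inv_closed T.inv_mult T.m_assoc T.m_closed T.r_inv)
      have "rho0 r x = \<one>\<^bsub>T\<^esub>"
        using r by (cases rule: quad_relatorsE)
          (use x in \<open>simp_all add: diff keys_frag_of rho0_apply_hom(2) tp_add cancel\<close>)
      then show "rho0 r x = \<zero>\<^bsub>E\<^esub> x"
        using x by (simp add: End_ring_def)
    qed
    then show "rho0 r \<in> {\<one>\<^bsub>add_monoid E\<^esub>}"
      by simp
  qed (use i in \<open>simp add: QS_generate\<close>)
  then show "i \<in> a_kernel free_ring E rho0"
    using subgroup.mem_carrier[OF subgroup_QS i] unfolding a_kernel_def' by simp
qed

section \<open>Descent of the representation to \<open>F\<close>, \<open>O\<close> and
  \<open>A\<close>\<close>

lemma rhoF_hom: "nonunital_ring_hom F E rhoF"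
  using nonunital_ring_hom_quotient(2)[OF nonunital_ring_free_ring two_sided_ideal_QS ring_E rho0_hom QS_kernel]
  unfolding F_ring_eq by (simp add: nonunital_ring_hom_def)

lemma carrier_F: "carrier F = (\<lambda>p. QS +>\<^bsub>free_ring\<^esub> p) ` carrier FG"
  unfolding F_ring_eq by (auto simp: FactRing_def A_RCOSETS_def' a_r_coset_def r_coset_def)

lemma rho0_coset: "p \<in> carrier FG \<Longrightarrow> rho0 ` (QS +>\<^bsub>free_ring\<^esub> p) = {rho0 p}"
  using nonunital_ring_hom_quotient(1)[OF nonunital_ring_free_ring two_sided_ideal_QS ring_E rho0_hom QS_kernel]
  by simp

lemma pure_tensor_eq: "pure_tensor T \<Gamma> s = QS +>\<^bsub>free_ring\<^esub> frag_of s"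
  by (simp add: pure_tensor_def a_r_coset_def free_group_record quad_group_def)

lemma pure_tensor_closed: "s \<in> Q \<Longrightarrow> pure_tensor T \<Gamma> s \<in> carrier F"
  unfolding pure_tensor_eq carrier_F by (rule imageI) (simp add: keys_frag_of)

lemma rhoF_pure_tensor: "s \<in> Q \<Longrightarrow> rhoF (pure_tensor T \<Gamma> s) = rho0 (frag_of s)"
  unfolding pure_tensor_eq by (subst rho0_coset) (simp_all add: keys_frag_of)

text \<open>The two tensors in a generator act on \<open>x\<close> by
  \<open>(a\<alpha>b\<beta>c)\<gamma>d\<delta>x\<close> and
  \<open>a\<alpha>(b\<beta>c\<gamma>d)\<delta>x\<close>, which agree by
  \<open>assoc_left\<close>.\<close>

lemma J_generators_kernel: "J_generators T \<Gamma> tp \<subseteq> a_kernel F E rhoF"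
proof
  interpret F: nonunital_ring F by (rule nonunital_ring_F)
  interpret E: ring E by (rule ring_E)
  interpret h: group_hom "add_monoid F" "add_monoid E" rhoF
    using rhoF_hom by (intro group_hom_intro F.a_comm_group E.a_comm_group) (simp add: nonunital_ring_hom_def)
  fix X assume "X \<in> J_generators T \<Gamma> tp"
  then obtain a \<alpha> b \<beta> c \<gamma> d \<delta> where *: "a \<in> carrier T" "\<alpha> \<in> carrier \<Gamma>" "b \<in> carrier T" "\<beta> \<in> carrier \<Gamma>"
      "c \<in> carrier T" "\<gamma> \<in> carrier \<Gamma>" "d \<in> carrier T" "\<delta> \<in> carrier \<Gamma>"
    and X: "X = pure_tensor T \<Gamma> (tp a \<alpha> b \<beta> c, \<gamma>, d, \<delta>) \<ominus>\<^bsub>F\<^esub> pure_tensor T \<Gamma> (a, \<alpha>, tp b \<beta> c \<gamma> d, \<delta>)"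
    unfolding J_generators_def mem_Collect_eq by (elim exE conjE) (rule that; assumption)
  let ?s = "(tp a \<alpha> b \<beta> c, \<gamma>, d, \<delta>)" and ?t = "(a, \<alpha>, tp b \<beta> c \<gamma> d, \<delta>)"
  have st: "?s \<in> Q" "?t \<in> Q"
    using * by simp_all
  note cl = pure_tensor_closed[OF st(1)] pure_tensor_closed[OF st(2)]
  have "rho0 (frag_of ?s) = rho0 (frag_of ?t)"
    by (rule E_ext) (use * st in \<open>simp_all add: rho0_in_E keys_frag_of rho0_apply_hom(2) assoc_left\<close>)
  then have eq: "rhoF (pure_tensor T \<Gamma> ?s) = rhoF (pure_tensor T \<Gamma> ?t)"
    using st by (simp add: rhoF_pure_tensor)
  have "rhoF X = rhoF (pure_tensor T \<Gamma> ?s) \<otimes>\<^bsub>add_monoid E\<^esub> inv\<^bsub>add_monoid E\<^esub> rhoF (pure_tensor T \<Gamma> ?t)"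
    using h.hom_mult[of "pure_tensor T \<Gamma> ?s" "inv\<^bsub>add_monoid F\<^esub> pure_tensor T \<Gamma> ?t"]
      h.hom_inv[of "pure_tensor T \<Gamma> ?t"] F.a_inv_closed[of "pure_tensor T \<Gamma> ?t"] cl
    by (simp add: X a_minus_def a_inv_def)
  also have "\<dots> = \<zero>\<^bsub>E\<^esub>"
    unfolding eq using group.r_inv[OF E.a_group, of "rhoF (pure_tensor T \<Gamma> ?t)"] h.hom_closed[of "pure_tensor T \<Gamma> ?t"] cl
    by simp
  finally show "X \<in> a_kernel F E rhoF"
    using cl X unfolding a_kernel_def' by simp
qed

text \<open>The kernel of \<open>rhoF\<close> is a two-sided ideal containing the generators. It
  makes the family behind \<open>J_ideal\<close> nonempty, so that the intersection is an ideal, and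
  it bounds this intersection from above.\<close>

lemma two_sided_ideal_J: "two_sided_ideal F J"
  and J_kernel: "J \<subseteq> a_kernel F E rhoF"
proof -
  interpret F: nonunital_ring F by (rule nonunital_ring_F)
  have k: "two_sided_ideal F (a_kernel F E rhoF)"
    by (rule two_sided_ideal_kernel[OF nonunital_ring_F ring_E rhoF_hom])
  show "two_sided_ideal F J"
    unfolding J_ideal_def
    by (rule two_sided_ideal_Inter[OF F.a_group]) (use k J_generators_kernel in blast)+
  show "J \<subseteq> a_kernel F E rhoF"
    unfolding J_ideal_def using k J_generators_kernel by blast
qed

abbreviation OR where "OR \<equiv> O_ring T \<Gamma> tp"

lemma nonunital_ideal_J: "nonunital_ideal J F"
  by (intro nonunital_ideal.intro nonunital_ideal_axioms.intro nonunital_ring_F two_sided_ideal_J)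

lemma nonunital_ring_O: "nonunital_ring OR"
  unfolding O_ring_def by (rule nonunital_ideal.nonunital_ring_quotient[OF nonunital_ideal_J])

text \<open>\<open>rho\<close> flattens \<open>u\<close>, a coset of cosets, before applying
  \<open>rho0\<close>, whereas two successive quotients give an iterated \<open>the_elem\<close>.
  They agree because \<open>rho0\<close> has the same constant value on every
  \<open>Y \<in> u\<close>.\<close>

lemma rho_eq:
  assumes u: "u \<in> carrier OR" shows "rho T tp u = the_elem (rhoF ` u)"
proof -
  obtain X where X: "X \<in> carrier F" "u = J +>\<^bsub>F\<^esub> X"
    using u nonunital_ideal.quotient_cases[OF nonunital_ideal_J] unfolding O_ring_def by metis
  have img: "rhoF ` u = {rhoF X}"
    using nonunital_ring_hom_quotient(1)[OF nonunital_ring_F two_sided_ideal_J ring_E rhoF_hom J_kernel X(1)] X by simp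
  have uF: "u \<subseteq> carrier F"
    using X nonunital_ideal.subgroup_I[OF nonunital_ideal_J] monoid.r_coset_subset_G[of "add_monoid F" J X]
      nonunital_ring.axioms(1)[OF nonunital_ring_F] abelian_group.a_group group.is_monoid subgroup.subset
    by (fastforce simp: a_r_coset_def)
  have "rho0 ` Y = {rhoF X}" if Y: "Y \<in> u" for Y
  proof -
    obtain p where p: "p \<in> carrier FG" "Y = QS +>\<^bsub>free_ring\<^esub> p"
      using uF Y unfolding carrier_F by blast
    have "rhoF Y = rhoF X"
      using img Y by blast
    then show ?thesis
      using rho0_coset[OF p(1)] p(2) by simp
  qed
  moreover have "u \<noteq> {}"
    using img by blast
  ultimately have "rho0 ` \<Union>u = {rhoF X}"
    by (simp add: image_Union)
  then show ?thesis
    by (simp add: rho_def img)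
qed

lemma rho_hom: "nonunital_ring_hom OR E (rho T tp)"
proof -
  interpret OR: nonunital_ring OR by (rule nonunital_ring_O)
  have "nonunital_ring_hom OR E (\<lambda>u. the_elem (rhoF ` u))"
    unfolding O_ring_def
    by (rule nonunital_ring_hom_quotient(2)[OF nonunital_ring_F two_sided_ideal_J ring_E rhoF_hom J_kernel])
  then show ?thesis
    by (simp add: nonunital_ring_hom_def hom_def Pi_iff rho_eq)
qed

lemma ring_A: "ring (A_ring T \<Gamma> tp)"
  unfolding A_ring_def by (rule nonunital_ring.ring_int_unitization[OF nonunital_ring_O])

lemma rho_hat_hom: "rho_hat T tp \<in> ring_hom (A_ring T \<Gamma> tp) E"
  unfolding A_ring_def rho_hat_def by (rule int_unitization_ring_hom[OF nonunital_ring_O ring_E rho_hom])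

lemma ring_surjection_rho_hat: "ring_surjection (A_ring T \<Gamma> tp) (R_ring T \<Gamma> tp) (rho_hat T tp)"
proof -
  interpret A: ring "A_ring T \<Gamma> tp" by (rule ring_A)
  interpret E: ring E by (rule ring_E)
  interpret h: ring_hom_ring "A_ring T \<Gamma> tp" E "rho_hat T tp"
    by unfold_locales (rule rho_hat_hom)
  have "ring (R_ring T \<Gamma> tp)"
    unfolding R_ring_def by (rule E.subring_is_ring[OF h.img_is_subring[OF A.carrier_is_subring]])
  moreover have "rho_hat T tp \<in> ring_hom (A_ring T \<Gamma> tp) (R_ring T \<Gamma> tp)"
    using rho_hat_hom by (simp add: ring_hom_def R_ring_def)
  ultimately show ?thesis
    by (intro ring_surjection.intro ring_surjection_axioms.intro A.ring_axioms) (simp_all add: R_ring_def)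
qed

end

theorem corollary7p3:
  fixes T :: "('t, 'p) monoid_scheme" and \<Gamma> :: "('g, 'q) monoid_scheme"
    and tp :: "'t \<Rightarrow> 'g \<Rightarrow> 't \<Rightarrow> 'g \<Rightarrow> 't \<Rightarrow> 't"
  assumes "ternary_gamma_ring T \<Gamma> tp"
  shows "\<exists>\<phi>. bimodule_iso (R_ring T \<Gamma> tp) (R_ring T \<Gamma> tp)
               (conormal_operator_defect T \<Gamma> tp) (Tor1_R_R T \<Gamma> tp) \<phi> \<and>
             (\<forall>k\<in>K_ideal T \<Gamma> tp.
                connecting_R T \<Gamma> tp
                  (\<phi> (ideal_prod (A_ring T \<Gamma> tp) (K_ideal T \<Gamma> tp) (K_ideal T \<Gamma> tp)
                        +>\<^bsub>A_ring T \<Gamma> tp\<^esub> k))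
                = K_tensor_one T \<Gamma> tp k)"
proof -
  interpret ternary_gamma_ring T \<Gamma> tp by fact
  interpret S: ring_surjection "A_ring T \<Gamma> tp" "R_ring T \<Gamma> tp" "rho_hat T tp"
    by (rule ring_surjection_rho_hat)
  \<comment> \<open>\<open>K_ideal\<close> is a kernel with target \<open>End_ring\<close>, the
    general theory uses the target \<open>R_ring\<close>. A kernel sees only the zero of its target,
    which both share.\<close>
  have K: "K_ideal T \<Gamma> tp = S.K"
    unfolding K_ideal_def a_kernel_def' R_ring_def by simp
  show ?thesis
    unfolding conormal_operator_defect_def Tor1_R_R_def connecting_R_def K_tensor_one_def
      right_A_module_R_def left_A_module_R_def K
    using S.conormal_bimodule_iso_Tor1 S.connecting_hom_eta S.conormal_to_Tor_coset
    by (intro exI[of _ S.conormal_to_Tor]) simp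
qed

end
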